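(* Let $(GS,\varphi)$ be a Separated GR($k$) game over input variables $\mathcal I$ and output variables $\mathcal O$, and let $N=|2^{\mathcal I\cup\mathcal O}|$. Then the realizability problem for $(GS,\varphi)$ can be solved in $O(|\varphi|+N)$ symbolic operations, and the synthesis problem for $(GS,\varphi)$ can be solved in $O(|\varphi|\,N)$ symbolic operations.
   Context: States and assertions. A state over a finite set $\mathcal V$ of Boolean variables is a subset of $\mathcal V$ (the variables assigned true). $\mathcal V'=\{v'\mid v\in\mathcal V\}$ is a disjoint primed copy, and $s'$ is the primed copy of a state $s$. An assertion over $\mathcal V$ is a Boolean formula over $\mathcal V$. Separated game structure: $GS=(\mathcal I,\mathcal O,\theta_{\mathcal I},\theta_{\mathcal O},\rho_{\mathcal I},\rho_{\mathcal O})$, where $\mathcal I,\mathcal O$ are disjoint finite sets of Boolean variables (controlled by the environment and the system, respectively), $\theta_{\mathcal I}$ is an assertion over $\mathcal I$, $\theta_{\mathcal O}$ over $\mathcal O$, $\rho_{\mathcal I}$ over $\mathcal I\cup\mathcal I'$, $\rho_{\mathcal O}$ over $\mathcal O\cup\mathcal O'$. Both are deadlock free: for every $i_0\in 2^{\mathcal I}$ there is $i_1$ with $(i_0,i_1')\models\rho_{\mathcal I}$, and for every $o_0\in 2^{\mathcal O}$ there is $o_1$ with $(o_0,o_1')\models\rho_{\mathcal O}$. Separated GR($k$) winning condition: $\varphi=\bigwedge_{l=1}^k\big(\bigwedge_{i=1}^{n_l}\mathsf G\mathsf F(a_{l,i})\rightarrow\bigwedge_{j=1}^{m_l}\mathsf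 G\mathsf F(g_{l,j})\big)$, with each $a_{l,i}$ an assertion over $\mathcal I$ and each $g_{l,j}$ an assertion over $\mathcal O$; $\mathsf G\mathsf F(p)$ holds on an infinite sequence iff $p$ holds at infinitely many positions. $|\varphi|$ is the length of $\varphi$. Plays and strategies. A play from a state $s_0$ over $\mathcal I\cup\mathcal O$ is an infinite sequence $s_0,s_1,\dots$ of states over $\mathcal I\cup\mathcal O$ with $(s_j,s_{j+1}')\models\rho_{\mathcal I}\wedge\rho_{\mathcal O}$ for all $j\ge0$. A strategy (for the system) is a function $f:(2^{\mathcal I\cup\mathcal O})^+\times 2^{\mathcal I}\to 2^{\mathcal O}$ that always returns legal moves: for a finite prefix $s_0,\dots,s_m$ of a play and $i$ with $(s_m,i')\models\rho_{\mathcal I}$, the output $o=f(s_0,\dots,s_m,i)$ satisfies $(s_m,i',o')\models\rho_{\mathcal O}$. A play $s_0,s_1,\dots$ with $s_j=(i_j,o_j)$ is consistent with $f$ if $o_{j+1}=f(s_0,\dots,s_j,i_{j+1})$ for all $j\ge 0$. $f$ wins from $s$ if every play from $s$ consistent with $f$ satisfies $\varphi$. $f$ is winning if for every $i\models\theta_{\mathcal I}$ there is $o\in2^{\mathcal O}$ with $(i,o)\models\theta_{\mathcal O}$ such that $f$ wins from $(i,o)$. Problems. Realizability: decide whether a winning strategy exists. Synthesis: construct a winning strategy if one exists. Symbolic cost model. Assertions (and hence sets of states and relations between states) are represented by Binary Decision Diagrams (BDDs). The symbolic operations are the Boolean operations $\neg,\vee,\wedge,\rightarrow$ on BDDs and existential/universal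 quantification of sets of variables (with the usual renaming between primed and unprimed variables). The time of a symbolic algorithm is its worst-case number of symbolic operations. The components of $GS$ and the assertions occurring in $\varphi$ are given symbolically. A memoryless strategy (one depending only on the last state and the current input) is represented by a BDD over $\mathcal I\cup\mathcal O\cup\mathcal I'\cup\mathcal O'$ whose satisfying assignments $(s,i',o')$ are those with $f(s,i)=o$; a strategy using a memory variable with finitely many values is represented by finitely many such BDDs together with the rule for updating the memory. *)

theory Defs
  imports Main
begin

section \<open>Assertions\<close>

text \<open>State variables are named by natural numbers; every variable comes in an unprimed and a
  primed copy. A state is the set of variables that it makes true.\<close>

datatype bvar = Unp nat | Pri nat

datatype form =
    FTrue | FFalse | Atom bvar
  | FNot form | FAnd form form | FOr form form | FImp form form

primrec form_vars :: "form \<Rightarrow> bvar set" where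
  "form_vars FTrue = {}"
| "form_vars FFalse = {}"
| "form_vars (Atom x) = {x}"
| "form_vars (FNot p) = form_vars p"
| "form_vars (FAnd p q) = form_vars p \<union> form_vars q"
| "form_vars (FOr p q) = form_vars p \<union> form_vars q"
| "form_vars (FImp p q) = form_vars p \<union> form_vars q"

primrec sat :: "bvar set \<Rightarrow> form \<Rightarrow> bool" where
  "sat \<sigma> FTrue = True"
| "sat \<sigma> FFalse = False"
| "sat \<sigma> (Atom x) = (x \<in> \<sigma>)"
| "sat \<sigma> (FNot p) = (\<not> sat \<sigma> p)"
| "sat \<sigma> (FAnd p q) = (sat \<sigma> p \<and> sat \<sigma> q)"
| "sat \<sigma> (FOr p q) = (sat \<sigma> p \<or> sat \<sigma> q)"
| "sat \<sigma> (FImp p q) = (sat \<sigma> p \<longrightarrow> sat \<sigma> q)"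

text \<open>Number of symbols, not counting parentheses.\<close>

primrec form_length :: "form \<Rightarrow> nat" where
  "form_length FTrue = 1"
| "form_length FFalse = 1"
| "form_length (Atom x) = 1"
| "form_length (FNot p) = 1 + form_length p"
| "form_length (FAnd p q) = 1 + form_length p + form_length q"
| "form_length (FOr p q) = 1 + form_length p + form_length q"
| "form_length (FImp p q) = 1 + form_length p + form_length q"

text \<open>The valuation \<open>(s, t')\<close>.\<close>

definition step_val :: "nat set \<Rightarrow> nat set \<Rightarrow> bvar set" where
  "step_val s t = Unp ` s \<union> Pri ` t"


section \<open>Separated GR(k) games\<close>

record game_structure =
  ins :: "nat set"
  outs :: "nat set"
  init_in :: form
  init_out :: form
  trans_in :: form
  trans_out :: form

definition separated_game_structure :: "game_structure \<Rightarrow> bool" where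
  "separated_game_structure G \<longleftrightarrow>
     finite (ins G) \<and> finite (outs G) \<and> ins G \<inter> outs G = {} \<and>
     form_vars (init_in G) \<subseteq> Unp ` ins G \<and>
     form_vars (init_out G) \<subseteq> Unp ` outs G \<and>
     form_vars (trans_in G) \<subseteq> Unp ` ins G \<union> Pri ` ins G \<and>
     form_vars (trans_out G) \<subseteq> Unp ` outs G \<union> Pri ` outs G \<and>
     (\<forall>i0 \<subseteq> ins G. \<exists>i1 \<subseteq> ins G. sat (step_val i0 i1) (trans_in G)) \<and>
     (\<forall>o0 \<subseteq> outs G. \<exists>o1 \<subseteq> outs G. sat (step_val o0 o1) (trans_out G))"

text \<open>A GR(k) condition is the list of its \<open>k\<close> conjuncts, each given by its assumptions
  \<open>a\<^sub>l\<^sub>,\<^sub>i\<close> and its guarantees \<open>g\<^sub>l\<^sub>,\<^sub>j\<close>.\<close>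

type_synonym grk = "(form list \<times> form list) list"

definition separated_grk :: "game_structure \<Rightarrow> grk \<Rightarrow> bool" where
  "separated_grk G \<phi> \<longleftrightarrow>
     (\<forall>(as, gs) \<in> set \<phi>.
        (\<forall>a \<in> set as. form_vars a \<subseteq> Unp ` ins G) \<and>
        (\<forall>g \<in> set gs. form_vars g \<subseteq> Unp ` outs G))"

definition separated_grk_game :: "game_structure \<Rightarrow> grk \<Rightarrow> bool" where
  "separated_grk_game G \<phi> \<longleftrightarrow> separated_game_structure G \<and> separated_grk G \<phi>"

definition GF :: "form \<Rightarrow> (nat \<Rightarrow> nat set) \<Rightarrow> bool" where
  "GF p w \<longleftrightarrow> infinite {j. sat (Unp ` w j) p}"

definition grk_holds :: "grk \<Rightarrow> (nat \<Rightarrow> nat set) \<Rightarrow> bool" where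
  "grk_holds \<phi> w \<longleftrightarrow>
     (\<forall>(as, gs) \<in> set \<phi>. (\<forall>a \<in> set as. GF a w) \<longrightarrow> (\<forall>g \<in> set gs. GF g w))"

text \<open>Length of a conjunction whose conjuncts have the given lengths: there is a connective between
  neighbouring conjuncts, and the empty conjunction is the constant true, of length 1.
  Each \<open>GF\<close> contributes its two temporal operators.\<close>

definition conj_length :: "nat list \<Rightarrow> nat" where
  "conj_length ls = (if ls = [] then 1 else sum_list ls + (length ls - 1))"

definition gfs_length :: "form list \<Rightarrow> nat" where
  "gfs_length ps = conj_length (map (\<lambda>p. 2 + form_length p) ps)"

definition grk_length :: "grk \<Rightarrow> nat" where
  "grk_length \<phi> = conj_length (map (\<lambda>(as, gs). gfs_length as + 1 + gfs_length gs) \<phi>)"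

definition num_states :: "game_structure \<Rightarrow> nat" where
  "num_states G = card (Pow (ins G \<union> outs G))"


section \<open>Plays and strategies\<close>

definition play :: "game_structure \<Rightarrow> nat set \<Rightarrow> (nat \<Rightarrow> nat set) \<Rightarrow> bool" where
  "play G s0 w \<longleftrightarrow>
     w 0 = s0 \<and> (\<forall>j. w j \<subseteq> ins G \<union> outs G) \<and>
     (\<forall>j. sat (step_val (w j) (w (Suc j))) (trans_in G) \<and>
          sat (step_val (w j) (w (Suc j))) (trans_out G))"

definition history :: "game_structure \<Rightarrow> nat set list \<Rightarrow> bool" where
  "history G h \<longleftrightarrow> h \<noteq> [] \<and> (\<forall>s \<in> set h. s \<subseteq> ins G \<union> outs G)"

type_synonym strategy = "nat set list \<Rightarrow> nat set \<Rightarrow> nat set"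

definition is_strategy :: "game_structure \<Rightarrow> strategy \<Rightarrow> bool" where
  "is_strategy G f \<longleftrightarrow>
     (\<forall>h i. history G h \<longrightarrow> i \<subseteq> ins G \<longrightarrow> f h i \<subseteq> outs G) \<and>
     (\<forall>s0 w m i. play G s0 w \<longrightarrow> i \<subseteq> ins G \<longrightarrow> sat (step_val (w m) i) (trans_in G) \<longrightarrow>
        sat (step_val (w m) (i \<union> f (map w [0..<Suc m]) i)) (trans_out G))"

definition consistent :: "game_structure \<Rightarrow> strategy \<Rightarrow> (nat \<Rightarrow> nat set) \<Rightarrow> bool" where
  "consistent G f w \<longleftrightarrow>
     (\<forall>j. w (Suc j) \<inter> outs G = f (map w [0..<Suc j]) (w (Suc j) \<inter> ins G))"

definition wins_from :: "game_structure \<Rightarrow> grk \<Rightarrow> strategy \<Rightarrow> nat set \<Rightarrow> bool" where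
  "wins_from G \<phi> f s \<longleftrightarrow> (\<forall>w. play G s w \<longrightarrow> consistent G f w \<longrightarrow> grk_holds \<phi> w)"

definition winning_strategy :: "game_structure \<Rightarrow> grk \<Rightarrow> strategy \<Rightarrow> bool" where
  "winning_strategy G \<phi> f \<longleftrightarrow> is_strategy G f \<and>
     (\<forall>i \<subseteq> ins G. sat (Unp ` i) (init_in G) \<longrightarrow>
        (\<exists>out \<subseteq> outs G. sat (Unp ` (i \<union> out)) (init_out G) \<and> wins_from G \<phi> f (i \<union> out)))"

definition realizable :: "game_structure \<Rightarrow> grk \<Rightarrow> bool" where
  "realizable G \<phi> \<longleftrightarrow> (\<exists>f. winning_strategy G \<phi> f)"


section \<open>BDDs and symbolic operations\<close>

text \<open>BDDs are canonical, so a BDD is identified with the Boolean function it represents, given as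
  its set of satisfying valuations.\<close>

type_synonym bdd = "bvar set set"

definition bdd_of :: "form \<Rightarrow> bdd" where
  "bdd_of p = {\<sigma>. sat \<sigma> p}"

definition bdd_ex :: "bvar set \<Rightarrow> bdd \<Rightarrow> bdd" where
  "bdd_ex V B = {\<sigma>. \<exists>\<tau>. \<tau> - V = \<sigma> - V \<and> \<tau> \<in> B}"

definition bdd_all :: "bvar set \<Rightarrow> bdd \<Rightarrow> bdd" where
  "bdd_all V B = {\<sigma>. \<forall>\<tau>. \<tau> - V = \<sigma> - V \<longrightarrow> \<tau> \<in> B}"

text \<open>Renaming exchanges the two copies of the given variables, so that it is well defined also
  on BDDs that depend on both copies.\<close>

primrec swap_copies :: "nat set \<Rightarrow> bvar \<Rightarrow> bvar" where
  "swap_copies X (Unp x) = (if x \<in> X then Pri x else Unp x)"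
| "swap_copies X (Pri x) = (if x \<in> X then Unp x else Pri x)"

definition bdd_rename :: "nat set \<Rightarrow> bdd \<Rightarrow> bdd" where
  "bdd_rename X B = {\<sigma>. swap_copies X ` \<sigma> \<in> B}"


section \<open>Symbolic algorithms\<close>

text \<open>A symbolic algorithm is a while program. Its memory has arrays of natural numbers and arrays
  of BDDs; \<open>nums st a j\<close> is cell \<open>j\<close> of number array \<open>a\<close>, and likewise for \<open>bdds\<close>. Programs have
  no access to a BDD other than through the instructions below.\<close>

record store =
  nums :: "nat \<Rightarrow> nat \<Rightarrow> nat"
  bdds :: "nat \<Rightarrow> nat \<Rightarrow> bdd"

datatype aexp = Num nat | Cell nat aexp | Plus aexp aexp | Minus aexp aexp | Times aexp aexp

primrec aval :: "aexp \<Rightarrow> store \<Rightarrow> nat" where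
  "aval (Num n) st = n"
| "aval (Cell a e) st = nums st a (aval e st)"
| "aval (Plus d e) st = aval d st + aval e st"
| "aval (Minus d e) st = aval d st - aval e st"
| "aval (Times d e) st = aval d st * aval e st"

datatype cond = Less aexp aexp | Negate cond | Both cond cond

primrec cval :: "cond \<Rightarrow> store \<Rightarrow> bool" where
  "cval (Less d e) st = (aval d st < aval e st)"
| "cval (Negate b) st = (\<not> cval b st)"
| "cval (Both b c) st = (cval b st \<and> cval c st)"

datatype reg = Reg nat aexp

primrec rval :: "reg \<Rightarrow> store \<Rightarrow> bdd" where
  "rval (Reg a e) st = bdds st a (aval e st)"

text \<open>Sets of variables are described by slices of number arrays: \<open>Slice a e\<close> is the set of the
  numbers stored in the first \<open>e\<close> cells of array \<open>a\<close>.\<close>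

datatype slice = Slice nat aexp

primrec slice_val :: "slice \<Rightarrow> store \<Rightarrow> nat set" where
  "slice_val (Slice a e) st = nums st a ` {..<aval e st}"

datatype varset = Unprimed slice | Primed slice | Join varset varset

primrec vval :: "varset \<Rightarrow> store \<Rightarrow> bvar set" where
  "vval (Unprimed r) st = Unp ` slice_val r st"
| "vval (Primed r) st = Pri ` slice_val r st"
| "vval (Join u v) st = vval u st \<union> vval v st"

datatype symop =
    Const bool | Copy reg
  | Compl reg | Disj reg reg | Conj reg reg | Impl reg reg
  | Exists varset reg | Forall varset reg | Rename slice reg

primrec sval :: "symop \<Rightarrow> store \<Rightarrow> bdd" where
  "sval (Const b) st = (if b then UNIV else {})"
| "sval (Copy r) st = rval r st"
| "sval (Compl r) st = - rval r st"
| "sval (Disj r q) st = rval r st \<union> rval q st"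
| "sval (Conj r q) st = rval r st \<inter> rval q st"
| "sval (Impl r q) st = - rval r st \<union> rval q st"
| "sval (Exists v r) st = bdd_ex (vval v st) (rval r st)"
| "sval (Forall v r) st = bdd_all (vval v st) (rval r st)"
| "sval (Rename x r) st = bdd_rename (slice_val x st) (rval r st)"

definition set_num :: "nat \<Rightarrow> nat \<Rightarrow> nat \<Rightarrow> store \<Rightarrow> store" where
  "set_num a j n st = st\<lparr>nums := (nums st)(a := (nums st a)(j := n))\<rparr>"

definition set_bdd :: "nat \<Rightarrow> nat \<Rightarrow> bdd \<Rightarrow> store \<Rightarrow> store" where
  "set_bdd a j B st = st\<lparr>bdds := (bdds st)(a := (bdds st a)(j := B))\<rparr>"

text \<open>\<open>Assign a d e\<close> stores the value of \<open>e\<close> in cell \<open>d\<close> of number array \<open>a\<close>; \<open>Symb a d u\<close> stores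
  the result of \<open>u\<close> in cell \<open>d\<close> of BDD array \<open>a\<close>; \<open>TestEq a d r q\<close> stores 1 or 0 in cell \<open>d\<close> of
  number array \<open>a\<close>, depending on whether the two BDDs are equal.\<close>

datatype prog =
    Skip
  | Assign nat aexp aexp
  | Symb nat aexp symop
  | TestEq nat aexp reg reg
  | Seq prog prog
  | Cond cond prog prog
  | Loop cond prog

text \<open>\<open>exec P st t st'\<close>: started in \<open>st\<close>, the program \<open>P\<close> halts in \<open>st'\<close> after \<open>t\<close> symbolic
  operations. Every instruction that involves BDDs is charged, including equality tests, constants
  and copies, so \<open>t\<close> is never below the number of Boolean operations, quantifications and
  renamings. Computation on numbers is not symbolic and is free.\<close>

inductive exec :: "prog \<Rightarrow> store \<Rightarrow> nat \<Rightarrow> store \<Rightarrow> bool" where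
  Skip: "exec Skip st 0 st"
| Assign: "exec (Assign a d e) st 0 (set_num a (aval d st) (aval e st) st)"
| Symb: "exec (Symb a d u) st 1 (set_bdd a (aval d st) (sval u st) st)"
| TestEq: "exec (TestEq a d r q) st 1
             (set_num a (aval d st) (if rval r st = rval q st then 1 else 0) st)"
| Seq: "exec P st t st' \<Longrightarrow> exec Q st' u st'' \<Longrightarrow> exec (Seq P Q) st (t + u) st''"
| CondTrue: "cval b st \<Longrightarrow> exec P st t st' \<Longrightarrow> exec (Cond b P Q) st t st'"
| CondFalse: "\<not> cval b st \<Longrightarrow> exec Q st t st' \<Longrightarrow> exec (Cond b P Q) st t st'"
| LoopFalse: "\<not> cval b st \<Longrightarrow> exec (Loop b P) st 0 st"
| LoopTrue: "cval b st \<Longrightarrow> exec P st t st' \<Longrightarrow> exec (Loop b P) st' u st'' \<Longrightarrow>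
             exec (Loop b P) st (t + u) st''"

inductive_cases exec_SkipE: "exec Skip st t st'"
  and exec_AssignE: "exec (Assign a d e) st t st'"
  and exec_SymbE: "exec (Symb a d u) st t st'"
  and exec_TestEqE: "exec (TestEq a d r q) st t st'"
  and exec_SeqE: "exec (Seq P Q) st t st'"
  and exec_CondE: "exec (Cond b P Q) st t st'"
  and exec_LoopE: "exec (Loop b P) st t st'"

lemma exec_deterministic:
  assumes "exec P st t st1" and "exec P st u st2"
  shows "t = u \<and> st1 = st2"
  using assms
proof (induction arbitrary: u st2 rule: exec.induct)
  case (Skip st)
  then show ?case by (rule exec_SkipE) simp
next
  case (Assign a d e st)
  then show ?case by (rule exec_AssignE) simp
next
  case (Symb a d v st)
  then show ?case by (rule exec_SymbE) simp
next
  case (TestEq a d r q st)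
  then show ?case by (rule exec_TestEqE) simp
next
  case (Seq P st t1 st' Q t2 st'')
  from Seq.prems obtain u1 u2 st0 where
    *: "exec P st u1 st0" "exec Q st0 u2 st2" "u = u1 + u2"
    by (rule exec_SeqE) simp
  with Seq.IH(1)[OF *(1)] Seq.IH(2) show ?case by simp
next
  case (CondTrue b st P t st' Q)
  from CondTrue.prems have "exec P st u st2"
    by (rule exec_CondE) (use CondTrue.hyps in simp_all)
  then show ?case by (rule CondTrue.IH)
next
  case (CondFalse b st Q t st' P)
  from CondFalse.prems have "exec Q st u st2"
    by (rule exec_CondE) (use CondFalse.hyps in simp_all)
  then show ?case by (rule CondFalse.IH)
next
  case (LoopFalse b st P)
  from LoopFalse.prems show ?case
    by (rule exec_LoopE) (use LoopFalse.hyps in simp_all)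
next
  case (LoopTrue b st P t1 st' t2 st'')
  from LoopTrue.prems obtain u1 u2 st0 where
    *: "exec P st u1 st0" "exec (Loop b P) st0 u2 st2" "u = u1 + u2"
    by (rule exec_LoopE) (use LoopTrue.hyps in simp_all)
  with LoopTrue.IH(1)[OF *(1)] LoopTrue.IH(2) show ?case by simp
qed


section \<open>Input and output\<close>

definition table :: "'a \<Rightarrow> 'a list list \<Rightarrow> nat \<Rightarrow> nat \<Rightarrow> 'a" where
  "table d xss a j = (if a < length xss \<and> j < length (xss ! a) then xss ! a ! j else d)"

text \<open>The input consists of the variables and the numbers \<open>k\<close>, \<open>n\<^sub>l\<close>, \<open>m\<^sub>l\<close> (number arrays 0-4),
  and of the BDDs of the game structure, of all \<open>a\<^sub>l\<^sub>,\<^sub>i\<close>, of all \<open>g\<^sub>l\<^sub>,\<^sub>j\<close>, and of the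
  unprimed variables (BDD arrays 0-4). All other cells hold 0 and the BDD of false.
  There is no instruction that creates a variable, so all BDDs in a run are over the variables of
  the game and their primed copies.\<close>

definition input_store :: "game_structure \<Rightarrow> grk \<Rightarrow> store" where
  "input_store G \<phi> =
     (let xs = sorted_list_of_set (ins G); ys = sorted_list_of_set (outs G) in
      \<lparr>nums = table 0
         [[length xs, length ys, length \<phi>],
          xs,
          ys,
          map (\<lambda>(as, gs). length as) \<phi>,
          map (\<lambda>(as, gs). length gs) \<phi>],
       bdds = table {}
         [map bdd_of [init_in G, init_out G, trans_in G, trans_out G],
          map bdd_of (concat (map fst \<phi>)),
          map bdd_of (concat (map snd \<phi>)),
          map (\<lambda>x. bdd_of (Atom (Unp x))) xs,
          map (\<lambda>y. bdd_of (Atom (Unp y))) ys]\<rparr>)"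

text \<open>The yes/no answer is cell 0 of number array 5.\<close>

definition answer :: "store \<Rightarrow> bool" where
  "answer st \<longleftrightarrow> nums st 5 0 = 1"

text \<open>A strategy with a memory variable ranging over \<open>{..<mem_size}\<close>: \<open>move q\<close> is the BDD of the
  strategy at memory value \<open>q\<close>. The rule for updating the memory is a list of edges
  \<open>(q, C, q')\<close>: on a step \<open>(s, t')\<close> taken at memory value \<open>q\<close>, the first edge that leaves \<open>q\<close> and
  whose BDD \<open>C\<close> holds determines the new value; if there is none, the value is kept.
  Memoryless strategies are the case \<open>mem_size = 1\<close>.\<close>

record sym_strategy =
  mem_size :: nat
  mem_init :: nat
  move :: "nat \<Rightarrow> bdd"
  edges :: "(nat \<times> bdd \<times> nat) list"

definition wf_sym_strategy :: "sym_strategy \<Rightarrow> bool" where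
  "wf_sym_strategy S \<longleftrightarrow> mem_init S < mem_size S \<and>
     (\<forall>(q, C, q') \<in> set (edges S). q < mem_size S \<and> q' < mem_size S)"

definition mem_step :: "sym_strategy \<Rightarrow> nat \<Rightarrow> nat set \<Rightarrow> nat set \<Rightarrow> nat" where
  "mem_step S q s t =
     (case find (\<lambda>(p, C, r). p = q \<and> step_val s t \<in> C) (edges S) of
        None \<Rightarrow> q
      | Some (p, C, r) \<Rightarrow> r)"

fun mem_run :: "sym_strategy \<Rightarrow> nat \<Rightarrow> nat set list \<Rightarrow> nat" where
  "mem_run S q (s # t # h) = mem_run S (mem_step S q s t) (t # h)"
| "mem_run S q h = q"

definition represents :: "game_structure \<Rightarrow> sym_strategy \<Rightarrow> strategy \<Rightarrow> bool" where
  "represents G S f \<longleftrightarrow> wf_sym_strategy S \<and>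
     (\<forall>h i out. history G h \<longrightarrow> i \<subseteq> ins G \<longrightarrow> out \<subseteq> outs G \<longrightarrow>
        (step_val (last h) (i \<union> out) \<in> move S (mem_run S (mem_init S) h) \<longleftrightarrow> f h i = out))"

text \<open>Besides the answer, number array 5 holds the memory size, the initial memory value and the
  number of edges; edges are stored in number arrays 6 and 7 and BDD array 6.\<close>

definition output_strategy :: "store \<Rightarrow> sym_strategy" where
  "output_strategy st =
     \<lparr>mem_size = nums st 5 1,
      mem_init = nums st 5 2,
      move = bdds st 5,
      edges = map (\<lambda>e. (nums st 6 e, bdds st 6 e, nums st 7 e)) [0..<nums st 5 3]\<rparr>"

definition realizability_output :: "game_structure \<Rightarrow> grk \<Rightarrow> store \<Rightarrow> bool" where
  "realizability_output G \<phi> st \<longleftrightarrow> (answer st \<longleftrightarrow> realizable G \<phi>)"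

definition synthesis_output :: "game_structure \<Rightarrow> grk \<Rightarrow> store \<Rightarrow> bool" where
  "synthesis_output G \<phi> st \<longleftrightarrow>
     (answer st \<longleftrightarrow> realizable G \<phi>) \<and>
     (realizable G \<phi> \<longrightarrow>
        (\<exists>f. winning_strategy G \<phi> f \<and> represents G (output_strategy st) f))"

end

theory Submission
  imports Defs "HOL-Library.Infinite_Set"
begin

text \<open>Inputs and outputs evolve independently, so a play eventually stays in one strongly connected
  component of the input graph and one of the output graph, and this pair of components decides
  whether the system can satisfy the condition while both stay there. A state is winning iff the system can
  answer every input move and, when the input lies on a cycle, can reach an output component that is
  good against the component of the input, staying among winning states. The winning region is
  therefore the greatest fixpoint of one predicate transformer and is reached after at most \<open>N\<close>
  symbolic iterations. The strategy walks to a good output component by decreasing distance and then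
  visits the guarantees of that component in turn; the memory is the index of the next guarantee.

  The components are found by Warshall's algorithm. With only two copies of the variables, relations
  cannot be composed in one symbolic step, but pivoting on a single state takes a constant number of
  operations, and all singletons together are built in linear time by doubling.\<close>

section \<open>Cost of symbolic programs\<close>

text \<open>The condition enters the computation once, through the relation \<open>good\<close>, at
  a cost linear in its length; after that the fixpoint iterates an expression of constant size.
  Hence the sum in the realizability bound. The synthesis bound is a product because each guarantee
  gets its own attractor, computed in \<open>N\<close> rounds.

  The second conjunct of \<open>win_step\<close> speaks of bare reachability in the output graph and
  ignores that the input moves meanwhile. Two monotonicity facts about the winning region make this
  harmless: it is closed backwards along output paths, since the system may lag behind an imagined
  play, and forwards along input paths with the output kept. So while the input stays in its
  component it may be treated as constant.

  Timing needs care: the system answers the next input from the current output. Strategy relations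
  are computed with the input unprimed, and the input is moved to the primed copy only at the end.

  The constants in the cost lemmas add up \<open>bcost\<close> of fixed expressions; left-over
  summands are absorbed using that \<open>N\<close> is at least 1.\<close>

lemma nums_set_num [simp]: "nums (set_num a j n st) b k = (if b = a \<and> k = j then n else nums st b k)"
  and nums_set_bdd [simp]: "nums (set_bdd a j B st) = nums st"
  and bdds_set_num [simp]: "bdds (set_num a j n st) = bdds st"
  and bdds_set_bdd [simp]: "bdds (set_bdd a j B st) b k = (if b = a \<and> k = j then B else bdds st b k)"
  by (simp_all add: set_num_def set_bdd_def)

section \<open>Compiling BDD expressions to symbolic operations\<close>

datatype bexp =
    BConst bool | BCell nat aexp
  | BNot bexp | BAnd bexp bexp | BOr bexp bexp | BImp bexp bexp
  | BEx varset bexp | BAll varset bexp | BRen slice bexp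

primrec bval :: "bexp \<Rightarrow> store \<Rightarrow> bdd" where
  "bval (BConst b) st = (if b then UNIV else {})"
| "bval (BCell a e) st = bdds st a (aval e st)"
| "bval (BNot p) st = - bval p st"
| "bval (BAnd p q) st = bval p st \<inter> bval q st"
| "bval (BOr p q) st = bval p st \<union> bval q st"
| "bval (BImp p q) st = - bval p st \<union> bval q st"
| "bval (BEx v p) st = bdd_ex (vval v st) (bval p st)"
| "bval (BAll v p) st = bdd_all (vval v st) (bval p st)"
| "bval (BRen x p) st = bdd_rename (slice_val x st) (bval p st)"

text \<open>Even reading a cell costs one operation, because compiled code first copies every
  operand to scratch.\<close>

primrec bcost :: "bexp \<Rightarrow> nat" where
  "bcost (BConst b) = 1"
| "bcost (BCell a e) = 1"
| "bcost (BNot p) = Suc (bcost p)"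
| "bcost (BAnd p q) = Suc (bcost p + bcost q)"
| "bcost (BOr p q) = Suc (bcost p + bcost q)"
| "bcost (BImp p q) = Suc (bcost p + bcost q)"
| "bcost (BEx v p) = Suc (bcost p)"
| "bcost (BAll v p) = Suc (bcost p)"
| "bcost (BRen x p) = Suc (bcost p)"

text \<open>BDD array 9 holds the intermediate results of compiled expressions.\<close>

primrec scratch_free :: "bexp \<Rightarrow> bool" where
  "scratch_free (BConst b) = True"
| "scratch_free (BCell a e) = (a \<noteq> 9)"
| "scratch_free (BNot p) = scratch_free p"
| "scratch_free (BAnd p q) = (scratch_free p \<and> scratch_free q)"
| "scratch_free (BOr p q) = (scratch_free p \<and> scratch_free q)"
| "scratch_free (BImp p q) = (scratch_free p \<and> scratch_free q)"
| "scratch_free (BEx v p) = scratch_free p"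
| "scratch_free (BAll v p) = scratch_free p"
| "scratch_free (BRen x p) = scratch_free p"

abbreviation scratch :: "nat \<Rightarrow> reg" where "scratch k \<equiv> Reg 9 (Num k)"

text \<open>Array 9 serves as a stack: the result goes to cell \<open>k\<close>, and a second
  operand is computed from cell \<open>Suc k\<close> upwards so that the first one survives.\<close>

primrec compile :: "bexp \<Rightarrow> nat \<Rightarrow> prog" where
  "compile (BConst b) k = Symb 9 (Num k) (Const b)"
| "compile (BCell a e) k = Symb 9 (Num k) (Copy (Reg a e))"
| "compile (BNot p) k = Seq (compile p k) (Symb 9 (Num k) (Compl (scratch k)))"
| "compile (BAnd p q) k = Seq (compile p k) (Seq (compile q (Suc k))
     (Symb 9 (Num k) (Conj (scratch k) (scratch (Suc k)))))"
| "compile (BOr p q) k = Seq (compile p k) (Seq (compile q (Suc k))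
     (Symb 9 (Num k) (Disj (scratch k) (scratch (Suc k)))))"
| "compile (BImp p q) k = Seq (compile p k) (Seq (compile q (Suc k))
     (Symb 9 (Num k) (Impl (scratch k) (scratch (Suc k)))))"
| "compile (BEx v p) k = Seq (compile p k) (Symb 9 (Num k) (Exists v (scratch k)))"
| "compile (BAll v p) k = Seq (compile p k) (Symb 9 (Num k) (Forall v (scratch k)))"
| "compile (BRen x p) k = Seq (compile p k) (Symb 9 (Num k) (Rename x (scratch k)))"

text \<open>Stores are compared up to scratch, so that invariants never mention leftovers of
  compiled expressions.\<close>

definition teq :: "store \<Rightarrow> store \<Rightarrow> bool" where
  "teq st st' \<longleftrightarrow> nums st = nums st' \<and> (\<forall>a. a \<noteq> 9 \<longrightarrow> bdds st a = bdds st' a)"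

lemma aval_teq: "nums st = nums st' \<Longrightarrow> aval e st = aval e st'"
  by (induction e) simp_all

lemma cval_teq: "nums st = nums st' \<Longrightarrow> cval b st = cval b st'"
  by (induction b) (simp_all add: aval_teq[of st st'])

lemma slice_val_teq: "nums st = nums st' \<Longrightarrow> slice_val x st = slice_val x st'"
  by (cases x) (simp add: aval_teq[of st st'])

lemma vval_teq: "nums st = nums st' \<Longrightarrow> vval v st = vval v st'"
  by (induction v) (simp_all add: slice_val_teq[of st st'])

lemma bval_teq: "teq st st' \<Longrightarrow> scratch_free e \<Longrightarrow> bval e st = bval e st'"
  by (induction e)
    (simp_all add: teq_def aval_teq[of st st'] vval_teq[of st st'] slice_val_teq[of st st'])

lemma teq_refl: "teq st st"
  by (simp add: teq_def)

lemma teq_set: "teq s t \<Longrightarrow> teq (set_num a j n s) (set_num a j n t)"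
  "teq s t \<Longrightarrow> teq (set_bdd a j B s) (set_bdd a j B t)"
  by (simp_all add: teq_def set_num_def set_bdd_def)

lemma exec_Symb_scratch:
  assumes "nums s1 = nums s" "\<And>a. a \<noteq> 9 \<Longrightarrow> bdds s1 a = bdds s a"
    "\<And>j. j < k \<Longrightarrow> bdds s1 9 j = bdds s 9 j" "sval u s1 = B"
  obtains s2 where "exec (Symb 9 (Num k) u) s1 1 s2" "nums s2 = nums s"
    "\<And>a. a \<noteq> 9 \<Longrightarrow> bdds s2 a = bdds s a" "\<And>j. j < k \<Longrightarrow> bdds s2 9 j = bdds s 9 j" "bdds s2 9 k = B"
proof (rule that)
  show "exec (Symb 9 (Num k) u) s1 1 (set_bdd 9 k B s1)"
    using exec.Symb[of 9 "Num k" u s1] assms(4) by simp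
qed (use assms in \<open>auto simp: set_bdd_def\<close>)

text \<open>The stack discipline is part of the induction claim: cells below \<open>k\<close>
  survive, which protects the first operand while the second is evaluated. That evaluation starts in
  a changed store, but only array 9 differs, and a \<open>scratch_free\<close> expression does not
  read it.\<close>

lemma compile_correct:
  "scratch_free e \<Longrightarrow> \<exists>s'. exec (compile e k) s (bcost e) s' \<and> nums s' = nums s \<and>
     (\<forall>a. a \<noteq> 9 \<longrightarrow> bdds s' a = bdds s a) \<and> (\<forall>j<k. bdds s' 9 j = bdds s 9 j) \<and>
     bdds s' 9 k = bval e s"
proof -
  let ?R = "\<lambda>P c B k s. \<exists>s'. exec P s c s' \<and> nums s' = nums s \<and>
     (\<forall>a. a \<noteq> 9 \<longrightarrow> bdds s' a = bdds s a) \<and> (\<forall>j<k. bdds s' 9 j = bdds s 9 j) \<and> bdds s' 9 k = B"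
  have const: "?R (Symb 9 (Num k) u) 1 (sval u s) k s" for u k s
    using exec_Symb_scratch[of s s k u "sval u s"] by metis
  have un: "?R (Seq P (Symb 9 (Num k) u)) (Suc c) B' k s"
    if P: "?R P c B k s"
      and u: "\<And>s1. nums s1 = nums s \<Longrightarrow> bdds s1 9 k = B \<Longrightarrow> sval u s1 = B'" for P u c B B' k s
  proof -
    obtain s1 where s1: "exec P s c s1" "nums s1 = nums s" "\<And>a. a \<noteq> 9 \<Longrightarrow> bdds s1 a = bdds s a"
      "\<And>j. j < k \<Longrightarrow> bdds s1 9 j = bdds s 9 j" "bdds s1 9 k = B" using P by blast
    obtain s2 where s2: "exec (Symb 9 (Num k) u) s1 1 s2" "nums s2 = nums s"
      "\<And>a. a \<noteq> 9 \<Longrightarrow> bdds s2 a = bdds s a" "\<And>j. j < k \<Longrightarrow> bdds s2 9 j = bdds s 9 j" "bdds s2 9 k = B'"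
      using exec_Symb_scratch[OF s1(2,3,4) u[OF s1(2,5)]] by blast
    then show ?thesis using exec.Seq[OF s1(1) s2(1)] by (intro exI[of _ s2]) simp
  qed
  have bin: "?R (Seq (compile p k) (Seq (compile q (Suc k)) (Symb 9 (Num k) u)))
      (Suc (bcost p + bcost q)) B k s"
    if P: "?R (compile p k) (bcost p) (bval p s) k s"
      and Q: "\<And>k s. ?R (compile q k) (bcost q) (bval q s) k s" and q: "scratch_free q"
      and u: "\<And>s1. bdds s1 9 k = bval p s \<Longrightarrow> bdds s1 9 (Suc k) = bval q s \<Longrightarrow> sval u s1 = B"
    for p q u B k s
  proof -
    obtain s1 where s1: "exec (compile p k) s (bcost p) s1" "nums s1 = nums s"
      "\<And>a. a \<noteq> 9 \<Longrightarrow> bdds s1 a = bdds s a"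
      "\<And>j. j < k \<Longrightarrow> bdds s1 9 j = bdds s 9 j" "bdds s1 9 k = bval p s" using P by blast
    obtain s2 where s2: "exec (compile q (Suc k)) s1 (bcost q) s2" "nums s2 = nums s1"
      "\<And>a. a \<noteq> 9 \<Longrightarrow> bdds s2 a = bdds s1 a"
      "\<And>j. j < Suc k \<Longrightarrow> bdds s2 9 j = bdds s1 9 j" "bdds s2 9 (Suc k) = bval q s1"
      using Q[of "Suc k" s1] by blast
    have "bval q s1 = bval q s" using s1(2,3) q by (intro bval_teq) (simp_all add: teq_def)
    then have "nums s2 = nums s" "\<And>a. a \<noteq> 9 \<Longrightarrow> bdds s2 a = bdds s a"
      "\<And>j. j < k \<Longrightarrow> bdds s2 9 j = bdds s 9 j" "sval u s2 = B"
      using s1 s2 u by simp_all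
    then obtain s3 where "exec (Symb 9 (Num k) u) s2 1 s3" "nums s3 = nums s"
      "\<And>a. a \<noteq> 9 \<Longrightarrow> bdds s3 a = bdds s a" "\<And>j. j < k \<Longrightarrow> bdds s3 9 j = bdds s 9 j" "bdds s3 9 k = B"
      using exec_Symb_scratch[of s2 s k u B] by blast
    moreover from this have "exec (Seq (compile p k) (Seq (compile q (Suc k)) (Symb 9 (Num k) u))) s (bcost p + (bcost q + 1)) s3"
      using s1(1) s2(1) by (blast intro: exec.Seq)
    ultimately show ?thesis by (intro exI[of _ s3]) simp
  qed
  show "scratch_free e \<Longrightarrow> ?R (compile e k) (bcost e) (bval e s) k s"
  proof (induction e arbitrary: k s)
    case (BConst b)
    then show ?case using const[of k "Const b" s] by simp
  next
    case (BCell a e)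
    then show ?case using const[of k "Copy (Reg a e)" s] by simp
  next
    case (BNot e)
    show ?case
      unfolding compile.simps bcost.simps bval.simps
      by (rule un[where B = "bval e s"], rule BNot.IH) (use BNot.prems in simp_all)
  next
    case (BEx v e)
    show ?case
      unfolding compile.simps bcost.simps bval.simps
      by (rule un[where B = "bval e s"], rule BEx.IH) (use BEx.prems in \<open>auto dest!: vval_teq[of _ s v]\<close>)
  next
    case (BAll v e)
    show ?case
      unfolding compile.simps bcost.simps bval.simps
      by (rule un[where B = "bval e s"], rule BAll.IH) (use BAll.prems in \<open>auto dest!: vval_teq[of _ s v]\<close>)
  next
    case (BRen x e)
    show ?case
      unfolding compile.simps bcost.simps bval.simps
      by (rule un[where B = "bval e s"], rule BRen.IH) (use BRen.prems in \<open>auto dest!: slice_val_teq[of _ s x]\<close>)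
  next
    case (BAnd p q)
    show ?case
      unfolding compile.simps bcost.simps bval.simps
      by (intro bin BAnd.IH) (use BAnd.prems in simp_all)
  next
    case (BOr p q)
    show ?case
      unfolding compile.simps bcost.simps bval.simps
      by (intro bin BOr.IH) (use BOr.prems in simp_all)
  next
    case (BImp p q)
    show ?case
      unfolding compile.simps bcost.simps bval.simps
      by (intro bin BImp.IH) (use BImp.prems in simp_all)
  qed
qed

section \<open>Total correctness with cost bounds\<close>

definition Put :: "nat \<Rightarrow> aexp \<Rightarrow> bexp \<Rightarrow> prog" where
  "Put a d e = Seq (compile e 0) (Symb a d (Copy (scratch 0)))"

definition Test_Valid :: "nat \<Rightarrow> aexp \<Rightarrow> bexp \<Rightarrow> prog" where
  "Test_Valid a d e = Seq (compile e 0) (Seq (Symb 9 (Num 1) (Const True)) (TestEq a d (scratch 0) (scratch 1)))"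

text \<open>The store \<open>st\<close> stands for all stores that agree with it up to scratch, and
  so does the final store that satisfies \<open>Q\<close>. Each rule can therefore describe a single
  clean update of \<open>st\<close> instead of the real execution.\<close>

definition runs :: "prog \<Rightarrow> store \<Rightarrow> nat \<Rightarrow> (store \<Rightarrow> bool) \<Rightarrow> bool" where
  "runs P st c Q \<longleftrightarrow> (\<forall>s. teq st s \<longrightarrow> (\<exists>t s' st'. exec P s t s' \<and> t \<le> c \<and> teq st' s' \<and> Q st'))"

lemma runs_weaken: "runs P st c Q \<Longrightarrow> c \<le> c' \<Longrightarrow> (\<And>s. Q s \<Longrightarrow> Q' s) \<Longrightarrow> runs P st c' Q'"
  unfolding runs_def by (meson le_trans)

lemma runs_cost: "runs P st c Q \<Longrightarrow> c \<le> c' \<Longrightarrow> runs P st c' Q"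
  by (rule runs_weaken)

lemma runs_Assign: "Q (set_num a (aval d st) (aval e st) st) \<Longrightarrow> runs (Assign a d e) st 0 Q"
  unfolding runs_def
proof (intro allI impI)
  fix s assume Q: "Q (set_num a (aval d st) (aval e st) st)" and t: "teq st s"
  from t have [simp]: "aval e s = aval e st" for e by (intro aval_teq) (simp add: teq_def)
  have "exec (Assign a d e) s 0 (set_num a (aval d st) (aval e st) s)"
    using exec.Assign[of a d e s] by simp
  then show "\<exists>t s' st'. exec (Assign a d e) s t s' \<and> t \<le> 0 \<and> teq st' s' \<and> Q st'"
    using Q teq_set(1)[OF t] by blast
qed

lemma runs_Put:
  assumes "Q (set_bdd a (aval d st) (bval e st) st)" "scratch_free e" "a \<noteq> 9"
  shows "runs (Put a d e) st (Suc (bcost e)) Q"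
  unfolding runs_def
proof (intro allI impI)
  fix s assume t: "teq st s"
  obtain s1 where s1: "exec (compile e 0) s (bcost e) s1" "nums s1 = nums s"
    "\<forall>a. a \<noteq> 9 \<longrightarrow> bdds s1 a = bdds s a" "bdds s1 9 0 = bval e s"
    using compile_correct[OF assms(2)] by blast
  then have t1: "teq st s1" using t by (simp add: teq_def)
  have "bval e s = bval e st" using bval_teq[OF t assms(2)] by simp
  moreover have "aval d s1 = aval d st" using t1 by (intro aval_teq) (simp add: teq_def)
  ultimately have "exec (Put a d e) s (bcost e + 1) (set_bdd a (aval d st) (bval e st) s1)"
    unfolding Put_def using exec.Seq[OF s1(1) exec.Symb[of a d "Copy (scratch 0)"]] s1(4) by simp
  then show "\<exists>t s' st'. exec (Put a d e) s t s' \<and> t \<le> Suc (bcost e) \<and> teq st' s' \<and> Q st'"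
    using assms(1) teq_set(2)[OF t1] by (metis Suc_eq_plus1 order_refl)
qed

lemma runs_Put_eq:
  assumes "bval e st = B" "aval d st = j" "Q (set_bdd a j B st)" "scratch_free e" "a \<noteq> 9"
  shows "runs (Put a d e) st (Suc (bcost e)) Q"
  using assms by (intro runs_Put) simp_all

lemma runs_Test_Valid:
  assumes "Q (set_num a (aval d st) (if bval e st = UNIV then 1 else 0) st)" "scratch_free e"
  shows "runs (Test_Valid a d e) st (bcost e + 2) Q"
  unfolding runs_def
proof (intro allI impI)
  fix s assume t: "teq st s"
  obtain s1 where s1: "exec (compile e 0) s (bcost e) s1" "nums s1 = nums s"
    "\<forall>a. a \<noteq> 9 \<longrightarrow> bdds s1 a = bdds s a" "bdds s1 9 0 = bval e s"
    using compile_correct[OF assms(2)] by blast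
  define s2 where "s2 = set_bdd 9 1 UNIV s1"
  have s2: "exec (Symb 9 (Num 1) (Const True)) s1 1 s2"
    using exec.Symb[of 9 "Num 1" "Const True" s1] by (simp add: s2_def)
  have t2: "teq st s2" using t s1 by (simp add: teq_def s2_def set_bdd_def)
  have "bval e s = bval e st" using bval_teq[OF t assms(2)] by simp
  then have "bdds s2 9 0 = bval e st" "bdds s2 9 1 = UNIV" using s1(4) by (simp_all add: s2_def)
  moreover have "aval d s2 = aval d st" using t2 by (intro aval_teq) (simp add: teq_def)
  ultimately have "exec (Test_Valid a d e) s (bcost e + (1 + 1))
      (set_num a (aval d st) (if bval e st = UNIV then 1 else 0) s2)"
    unfolding Test_Valid_def
    using exec.Seq[OF s1(1) exec.Seq[OF s2 exec.TestEq[of a d "scratch 0" "scratch 1"]]] by simp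
  then show "\<exists>t s' st'. exec (Test_Valid a d e) s t s' \<and> t \<le> bcost e + 2 \<and> teq st' s' \<and> Q st'"
    using assms(1) teq_set(1)[OF t2] by (metis nat_1_add_1 order_refl)
qed

lemma runs_Seq:
  assumes "runs P st c (\<lambda>s. runs R s d Q)" shows "runs (Seq P R) st (c + d) Q"
  unfolding runs_def
proof (intro allI impI)
  fix s assume "teq st s"
  then obtain t s' st' where 1: "exec P s t s'" "t \<le> c" "teq st' s'" "runs R st' d Q"
    using assms unfolding runs_def by blast
  then obtain u s'' st'' where "exec R s' u s''" "u \<le> d" "teq st'' s''" "Q st''"
    unfolding runs_def by blast
  then show "\<exists>t s' st'. exec (Seq P R) s t s' \<and> t \<le> c + d \<and> teq st' s' \<and> Q st'"
    using 1 exec.Seq add_mono by blast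
qed

lemma runs_SeqI:
  assumes "runs P st c Q'" and "\<And>s. Q' s \<Longrightarrow> runs R s d Q"
  shows "runs (Seq P R) st (c + d) Q"
  by (rule runs_Seq, rule runs_weaken[OF assms(1) order_refl], rule assms(2))

text \<open>Loop counters are cells of number array 8.\<close>

abbreviation var :: "nat \<Rightarrow> aexp" where "var c \<equiv> Cell 8 (Num c)"

definition For :: "nat \<Rightarrow> aexp \<Rightarrow> prog \<Rightarrow> prog" where
  "For c bound P = Seq (Assign 8 (Num c) (Num 0))
     (Loop (Less (var c) bound) (Seq P (Assign 8 (Num c) (Plus (var c) (Num 1)))))"

text \<open>The invariant is taken at the loop test, so the body must establish it after the counter
  update. The cost may depend on the round, as the doubling loop requires. The bound expression is
  evaluated anew in every round, hence the invariant has to fix its value.\<close>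

lemma runs_For:
  assumes init: "I 0 (set_num 8 c 0 st)"
    and body: "\<And>j s. j < n \<Longrightarrow> I j s \<Longrightarrow>
      runs P s (C j) (\<lambda>s'. I (Suc j) (set_num 8 c (Suc (nums s' 8 c)) s'))"
    and bound: "\<And>j s. j \<le> n \<Longrightarrow> I j s \<Longrightarrow> nums s 8 c = j \<and> aval e s = n"
    and post: "\<And>s. I n s \<Longrightarrow> Q s"
  shows "runs (For c e P) st (\<Sum>j<n. C j) Q"
proof -
  let ?b = "Less (var c) e" and ?P = "Seq P (Assign 8 (Num c) (Plus (var c) (Num 1)))"
  \<comment> \<open>Induction on the number \<open>k\<close> of remaining rounds; the counter is
    then at \<open>n - k\<close>.\<close>
  have loop: "runs (Loop ?b ?P) s (\<Sum>j = n - k..<n. C j) Q" if "k \<le> n" "I (n - k) s" for k s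
    using that
  proof (induction k arbitrary: s)
    case 0
    show ?case
      unfolding runs_def
    proof (intro allI impI)
      fix s1 assume t: "teq s s1"
      have "\<not> cval ?b s" using bound[of n s] 0 by simp
      then have "\<not> cval ?b s1" using t cval_teq[of s s1 ?b] unfolding teq_def by blast
      then have "exec (Loop ?b ?P) s1 0 s1" by (rule exec.LoopFalse)
      then show "\<exists>t s' st'. exec (Loop ?b ?P) s1 t s' \<and> t \<le> (\<Sum>j = n - 0..<n. C j) \<and> teq st' s' \<and> Q st'"
        using t post 0 by auto
    qed
  next
    case (Suc k)
    define j where "j = n - Suc k"
    have j: "j < n" "n - k = Suc j" using Suc.prems by (auto simp: j_def)
    have "runs ?P s (C j + 0) (I (Suc j))"
      by (rule runs_Seq[OF runs_weaken[OF body[OF j(1)] order_refl runs_Assign]])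
        (use Suc.prems in \<open>simp_all add: j_def\<close>)
    moreover have "cval ?b s" using bound[of j s] Suc.prems j by (simp add: j_def)
    ultimately show ?case
      unfolding runs_def
    proof (intro allI impI)
      fix s1
      assume P: "\<forall>s1. teq s s1 \<longrightarrow> (\<exists>t s' st'. exec ?P s1 t s' \<and> t \<le> C j + 0 \<and> teq st' s' \<and> I (Suc j) st')"
        and "cval ?b s" and t: "teq s s1"
      then have b: "cval ?b s1" using cval_teq[of s s1 ?b] unfolding teq_def by blast
      obtain t1 s2 st2 where 1: "exec ?P s1 t1 s2" "t1 \<le> C j" "teq st2 s2" "I (Suc j) st2"
        using P t by auto
      then obtain t2 s3 st3 where 2: "exec (Loop ?b ?P) s2 t2 s3"
        "t2 \<le> (\<Sum>j = n - k..<n. C j)" "teq st3 s3" "Q st3"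
        using Suc.IH[of st2] Suc.prems j(2) unfolding runs_def by auto
      have "exec (Loop ?b ?P) s1 (t1 + t2) s3" by (rule exec.LoopTrue[OF b 1(1) 2(1)])
      moreover have "(\<Sum>j = n - Suc k..<n. C j) = C j + (\<Sum>j = n - k..<n. C j)"
        using j unfolding j_def by (simp add: sum.atLeast_Suc_lessThan)
      then have "t1 + t2 \<le> (\<Sum>j = n - Suc k..<n. C j)" using 1(2) 2(2) by simp
      ultimately show "\<exists>t s' st'. exec (Loop ?b ?P) s1 t s' \<and> t \<le> (\<Sum>j = n - Suc k..<n. C j)
          \<and> teq st' s' \<and> Q st'"
        using 2(3,4) by blast
    qed
  qed
  have "runs (For c e P) st (0 + (\<Sum>j<n. C j)) Q"
    unfolding For_def
  proof (rule runs_Seq, rule runs_Assign)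
    show "runs (Loop ?b ?P) (set_num 8 (aval (Num c) st) (aval (Num 0) st) st) (\<Sum>j<n. C j) Q"
      using loop[of n] init by (simp add: lessThan_atLeast0)
  qed
  then show ?thesis by simp
qed

text \<open>\<open>A\<close> and \<open>B\<close> are the number cells and the BDD cells that may
  change. Scratch cells never appear in them, because \<open>runs\<close> speaks of representatives
  up to \<open>teq\<close>.\<close>

definition frame :: "(nat \<times> nat) set \<Rightarrow> (nat \<times> nat) set \<Rightarrow> store \<Rightarrow> store \<Rightarrow> bool" where
  "frame A B s t \<longleftrightarrow> (\<forall>a j. (a, j) \<notin> A \<longrightarrow> nums t a j = nums s a j) \<and>
     (\<forall>a j. (a, j) \<notin> B \<longrightarrow> bdds t a j = bdds s a j)"

lemma frame_refl [simp]: "frame A B s s"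
  and frame_trans: "frame A B s t \<Longrightarrow> frame A B t u \<Longrightarrow> frame A B s u"
  and frame_set_num [simp]: "(a, j) \<in> A \<Longrightarrow> frame A B s (set_num a j n t) \<longleftrightarrow> frame A B s t"
  and frame_set_bdd [simp]: "(a, j) \<in> B \<Longrightarrow> frame A B s (set_bdd a j D t) \<longleftrightarrow> frame A B s t"
  and frame_nums: "frame A B s t \<Longrightarrow> (a, j) \<notin> A \<Longrightarrow> nums t a j = nums s a j"
  and frame_bdds: "frame A B s t \<Longrightarrow> (a, j) \<notin> B \<Longrightarrow> bdds t a j = bdds s a j"
  unfolding frame_def by (simp_all, metis+)

lemma frame_mono: "frame A B s t \<Longrightarrow> A \<subseteq> A' \<Longrightarrow> B \<subseteq> B' \<Longrightarrow> frame A' B' s t"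
  unfolding frame_def by blast

section \<open>Transitive closure of a symbolic relation\<close>

text \<open>For \<open>j < 2 ^ v\<close> this reads \<open>j\<close> in binary:
  \<open>xs ! u\<close> is chosen iff bit \<open>u\<close> is 1. Recursion on the top bit matches
  the doubling in \<open>singletons\<close>.\<close>

primrec nth_subset :: "'a list \<Rightarrow> nat \<Rightarrow> nat \<Rightarrow> 'a set" where
  "nth_subset xs 0 j = {}"
| "nth_subset xs (Suc v) j =
     (if j < 2 ^ v then nth_subset xs v j else insert (xs ! v) (nth_subset xs v (j - 2 ^ v)))"

lemma nth_subset_image:
  "v \<le> length xs \<Longrightarrow> nth_subset xs v ` {..<2 ^ v} = Pow (set (take v xs))"
proof (induction v)
  case (Suc v)
  let ?N = "{..<2 ^ v :: nat}"
  have split: "{..<2 ^ Suc v} = ?N \<union> (+) (2 ^ v) ` ?N"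
    by (auto simp: image_iff) (metis add_diff_inverse_nat less_diff_conv2 lessThan_iff linorder_not_less mult_2)
  have "nth_subset xs (Suc v) ` {..<2 ^ Suc v} =
      nth_subset xs v ` ?N \<union> insert (xs ! v) ` nth_subset xs v ` ?N"
    unfolding split image_Un image_image by (intro arg_cong2[of _ _ _ _ "(\<union>)"] image_cong) simp_all
  also have "\<dots> = Pow (set (take (Suc v) xs))"
    using Suc by (simp add: take_Suc_conv_app_nth Pow_insert)
  finally show ?case .
qed (simp add: lessThan_Suc)

lemma nth_subset_sub: "v \<le> length xs \<Longrightarrow> j < 2 ^ v \<Longrightarrow> nth_subset xs v j \<subseteq> set (take v xs)"
  using nth_subset_image[of v xs] by blast

section \<open>Relations between states as BDDs\<close>

definition unp_part :: "nat set \<Rightarrow> bvar set \<Rightarrow> nat set" where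
  "unp_part V \<sigma> = {v \<in> V. Unp v \<in> \<sigma>}"

definition pri_part :: "nat set \<Rightarrow> bvar set \<Rightarrow> nat set" where
  "pri_part V \<sigma> = {v \<in> V. Pri v \<in> \<sigma>}"

lemma swap_copies_swap [simp]: "swap_copies V (swap_copies V x) = x"
  by (cases x) auto

lemma mem_swap_image: "x \<in> swap_copies V ` \<sigma> \<longleftrightarrow> swap_copies V x \<in> \<sigma>"
  by (metis image_iff swap_copies_swap)

lemma unp_part_sub [simp]: "unp_part V \<sigma> \<subseteq> V" and pri_part_sub [simp]: "pri_part V \<sigma> \<subseteq> V"
  by (auto simp: unp_part_def pri_part_def)

lemma part_swap:
  "unp_part V (swap_copies V ` \<sigma>) = pri_part V \<sigma>"
  "pri_part V (swap_copies V ` \<sigma>) = unp_part V \<sigma>"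
  "V \<inter> W = {} \<Longrightarrow> unp_part V (swap_copies W ` \<sigma>) = unp_part V \<sigma>"
  "V \<inter> W = {} \<Longrightarrow> pri_part V (swap_copies W ` \<sigma>) = pri_part V \<sigma>"
  by (auto simp: unp_part_def pri_part_def mem_swap_image)

lemma ex_agree:
  "(\<exists>\<tau>. \<tau> - U = \<sigma> - U \<and> P \<tau>) \<longleftrightarrow> (\<exists>\<rho> \<subseteq> U. P (\<sigma> - U \<union> \<rho>))"
proof
  assume "\<exists>\<tau>. \<tau> - U = \<sigma> - U \<and> P \<tau>"
  then obtain \<tau> where "\<tau> - U = \<sigma> - U" "P \<tau>" by blast
  moreover from this have "\<tau> = \<sigma> - U \<union> (\<tau> \<inter> U)" by blast
  ultimately show "\<exists>\<rho> \<subseteq> U. P (\<sigma> - U \<union> \<rho>)" by (metis Int_lower2)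
next
  assume "\<exists>\<rho> \<subseteq> U. P (\<sigma> - U \<union> \<rho>)"
  then show "\<exists>\<tau>. \<tau> - U = \<sigma> - U \<and> P \<tau>" by (metis Diff_subset_conv Un_Diff Diff_idemp Un_empty_right Diff_eq_empty_iff)
qed

lemma bdd_ex_unp: "\<sigma> \<in> bdd_ex (Unp ` V) B \<longleftrightarrow> (\<exists>x \<subseteq> V. \<sigma> - Unp ` V \<union> Unp ` x \<in> B)"
  and bdd_ex_pri: "\<sigma> \<in> bdd_ex (Pri ` V) B \<longleftrightarrow> (\<exists>x \<subseteq> V. \<sigma> - Pri ` V \<union> Pri ` x \<in> B)"
  by (auto simp: bdd_ex_def ex_agree subset_image_iff)

lemma bdd_all_ex: "bdd_all V B = - bdd_ex V (- B)"
  by (auto simp: bdd_all_def bdd_ex_def)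

lemma part_update:
  "unp_part V (\<sigma> - Pri ` W \<union> Pri ` x) = unp_part V \<sigma>"
  "pri_part V (\<sigma> - Unp ` W \<union> Unp ` x) = pri_part V \<sigma>"
  "x \<subseteq> V \<Longrightarrow> unp_part V (\<sigma> - Unp ` V \<union> Unp ` x) = x"
  "x \<subseteq> V \<Longrightarrow> pri_part V (\<sigma> - Pri ` V \<union> Pri ` x) = x"
  "V \<inter> W = {} \<Longrightarrow> x \<subseteq> W \<Longrightarrow> unp_part V (\<sigma> - Unp ` W \<union> Unp ` x) = unp_part V \<sigma>"
  "V \<inter> W = {} \<Longrightarrow> x \<subseteq> W \<Longrightarrow> pri_part V (\<sigma> - Pri ` W \<union> Pri ` x) = pri_part V \<sigma>"
  by (auto simp: unp_part_def pri_part_def)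

text \<open>Valuations range over all variable names. Looking only at the two copies of
  \<open>V\<close> gives a BDD over these variables. A set of states is coded as a relation that
  ignores its second argument.\<close>

definition rel_bdd :: "nat set \<Rightarrow> (nat set \<Rightarrow> nat set \<Rightarrow> bool) \<Rightarrow> bdd" where
  "rel_bdd V R = {\<sigma>. R (unp_part V \<sigma>) (pri_part V \<sigma>)}"

lemma rel_bdd_simps:
  "rel_bdd V R \<inter> rel_bdd V R' = rel_bdd V (\<lambda>x y. R x y \<and> R' x y)"
  "rel_bdd V R \<union> rel_bdd V R' = rel_bdd V (\<lambda>x y. R x y \<or> R' x y)"
  "bdd_ex (Unp ` V) (rel_bdd V R) = rel_bdd V (\<lambda>_ y. \<exists>x \<subseteq> V. R x y)"
  "bdd_ex (Pri ` V) (rel_bdd V R) = rel_bdd V (\<lambda>x _. \<exists>y \<subseteq> V. R x y)"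
  "bdd_rename V (rel_bdd V R) = rel_bdd V (\<lambda>x y. R y x)"
  by (intro set_eqI; simp add: rel_bdd_def bdd_rename_def bdd_ex_unp bdd_ex_pri part_update part_swap
      cong: conj_cong)+

lemma rel_bdd_cong:
  "(\<And>x y. x \<subseteq> V \<Longrightarrow> y \<subseteq> V \<Longrightarrow> R x y \<longleftrightarrow> R' x y) \<Longrightarrow> rel_bdd V R = rel_bdd V R'"
  by (simp add: rel_bdd_def)

definition vars_slice :: "nat \<Rightarrow> slice" where
  "vars_slice a = Slice (Suc a) (Cell 0 (Num a))"

text \<open>The parameter \<open>a\<close> selects inputs (0) or outputs (1) by shifting indices, as
  in the later programs. Each variable splits every BDD built so far into its states with and
  without that variable. The new half is written first, because the split then overwrites its
  source.\<close>

definition singletons :: "nat \<Rightarrow> prog" where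
  "singletons a =
     Seq (Put (11 + a) (Num 0) (BConst True)) (Seq (Assign 8 (Num (Suc a)) (Num 1))
     (For 3 (Cell 0 (Num a)) (Seq
       (For 4 (var (Suc a)) (Seq
         (Put (11 + a) (Plus (var (Suc a)) (var 4)) (BAnd (BCell (11 + a) (var 4)) (BCell (3 + a) (var 3))))
         (Put (11 + a) (var 4) (BAnd (BCell (11 + a) (var 4)) (BNot (BCell (3 + a) (var 3)))))))
       (Assign 8 (Num (Suc a)) (Plus (var (Suc a)) (var (Suc a)))))))"

text \<open>Round \<open>v\<close> costs \<open>9 * 2 ^ v\<close>, so the rounds form a geometric
  sum. Building every singleton separately from its literals would bring in the number of variables
  as a factor.\<close>

lemma singletons_runs:
  assumes a: "a < 2" and len: "nums st 0 a = length xs" and "distinct xs"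
    and atoms: "\<And>v. v < length xs \<Longrightarrow> bdds st (3 + a) v = bdd_of (Atom (Unp (xs ! v)))"
  shows "runs (singletons a) st (11 * 2 ^ length xs) (\<lambda>s.
    frame {(8, Suc a), (8, 3), (8, 4)} ({11 + a} \<times> UNIV) st s \<and> nums s 8 (Suc a) = 2 ^ length xs \<and>
    (\<forall>j < 2 ^ length xs. bdds s (11 + a) j = {\<sigma>. unp_part (set xs) \<sigma> = nth_subset xs (length xs) j}))"
    (is "runs _ _ _ (\<lambda>s. ?F s \<and> _)")
proof -
  define sg where "sg v j = {\<sigma>. unp_part (set (take v xs)) \<sigma> = nth_subset xs v j}" for v j
  \<comment> \<open>Distinctness makes the new variable fresh, so testing it is independent of
    comparing the earlier ones.\<close>
  have sg: "sg (Suc v) j = sg v j \<inter> - bdd_of (Atom (Unp (xs ! v)))"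
    "sg (Suc v) (2 ^ v + j) = sg v j \<inter> bdd_of (Atom (Unp (xs ! v)))"
    if v: "v < length xs" and j: "j < 2 ^ v" for v j
  proof -
    let ?x = "xs ! v" and ?V = "set (take v xs)"
    have x: "?x \<notin> ?V"
      using \<open>distinct xs\<close> v by (metis distinct_take take_Suc_conv_app_nth not_distinct_conv_prefix)
    have sub: "nth_subset xs v j \<subseteq> ?V" using nth_subset_sub[of v xs j] v j by simp
    have part: "unp_part (set (take (Suc v) xs)) \<sigma> =
        (if Unp ?x \<in> \<sigma> then insert ?x (unp_part ?V \<sigma>) else unp_part ?V \<sigma>)" for \<sigma>
      using v by (auto simp: take_Suc_conv_app_nth unp_part_def)
    have notin: "?x \<notin> nth_subset xs v j" "?x \<notin> unp_part ?V \<sigma>" for \<sigma>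
      using x sub by (auto simp: unp_part_def)
    then have "insert ?x (unp_part ?V \<sigma>) \<noteq> nth_subset xs v j"
      "unp_part ?V \<sigma> \<noteq> insert ?x (nth_subset xs v j)" for \<sigma>
      by blast+
    then show "sg (Suc v) j = sg v j \<inter> - bdd_of (Atom (Unp (xs ! v)))"
      "sg (Suc v) (2 ^ v + j) = sg v j \<inter> bdd_of (Atom (Unp (xs ! v)))"
      using j insert_ident[OF notin(2) notin(1)]
      by (auto simp: sg_def part bdd_of_def split: if_splits)
  qed
  let ?I = "\<lambda>v s. ?F s \<and> nums s 8 3 = v \<and> nums s 8 (Suc a) = 2 ^ v \<and>
    (\<forall>j < 2 ^ v. bdds s (11 + a) j = sg v j)"
  \<comment> \<open>Within a round, the cells below \<open>j\<close> and their partners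
    \<open>2 ^ v\<close> places up are already at level \<open>Suc v\<close>; the rest of the lower
    half is still at level \<open>v\<close>.\<close>
  let ?J = "\<lambda>v j s. ?F s \<and> nums s 8 3 = v \<and> nums s 8 4 = j \<and> nums s 8 (Suc a) = 2 ^ v \<and>
    (\<forall>j' < j. bdds s (11 + a) j' = sg (Suc v) j' \<and> bdds s (11 + a) (2 ^ v + j') = sg (Suc v) (2 ^ v + j')) \<and>
    (\<forall>j' < 2 ^ v. j \<le> j' \<longrightarrow> bdds s (11 + a) j' = sg v j')"
  have inner: "runs (Seq
         (Put (11 + a) (Plus (var (Suc a)) (var 4)) (BAnd (BCell (11 + a) (var 4)) (BCell (3 + a) (var 3))))
         (Put (11 + a) (var 4) (BAnd (BCell (11 + a) (var 4)) (BNot (BCell (3 + a) (var 3)))))) s 9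
       (\<lambda>s'. ?J v (Suc j) (set_num 8 4 (Suc (nums s' 8 4)) s'))"
    if v: "v < length xs" and j: "j < 2 ^ v" and J: "?J v j s" for v j s
  proof -
    have F: "?F s" using J by blast
    have "bdds s (3 + a) v = bdd_of (Atom (Unp (xs ! v)))"
      using frame_bdds[OF F, of "3 + a" v] atoms[OF v] by simp
    then show ?thesis
      by (intro runs_cost[OF runs_Seq[OF runs_Put[OF runs_Put]]])
        (use J j a sg[OF v j] in \<open>auto simp: less_Suc_eq\<close>)
  qed
  show ?thesis
    unfolding singletons_def
  proof (rule runs_cost[OF runs_Seq[OF runs_Put[OF runs_Seq[OF runs_Assign[OF
      runs_For[where n = "length xs" and I = ?I and C = "\<lambda>v. 9 * 2 ^ v"]]]]]])
    fix v s assume v: "v < length xs" and I: "?I v s"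
    show "runs (Seq
       (For 4 (var (Suc a)) (Seq
         (Put (11 + a) (Plus (var (Suc a)) (var 4)) (BAnd (BCell (11 + a) (var 4)) (BCell (3 + a) (var 3))))
         (Put (11 + a) (var 4) (BAnd (BCell (11 + a) (var 4)) (BNot (BCell (3 + a) (var 3)))))))
       (Assign 8 (Num (Suc a)) (Plus (var (Suc a)) (var (Suc a))))) s (9 * 2 ^ v)
       (\<lambda>s'. ?I (Suc v) (set_num 8 3 (Suc (nums s' 8 3)) s'))"
    proof (rule runs_cost[OF runs_Seq[OF runs_For[where n = "2 ^ v" and I = "?J v" and C = "\<lambda>_. 9",
          OF _ inner[OF v]]]])
      fix s1 assume J: "?J v (2 ^ v) s1"
      have "bdds s1 (11 + a) j = sg (Suc v) j" if "j < 2 ^ Suc v" for j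
      proof (cases "j < 2 ^ v")
        case False
        then show ?thesis using J that by (metis le_add_diff_inverse linorder_not_less mult_2 nat_add_left_cancel_less power_Suc)
      qed (use J in simp)
      then show "runs (Assign 8 (Num (Suc a)) (Plus (var (Suc a)) (var (Suc a)))) s1 0
        (\<lambda>s'. ?I (Suc v) (set_num 8 3 (Suc (nums s' 8 3)) s'))"
        by (intro runs_Assign) (use J a in auto)
    qed (use I a in auto)
  next
    show "?I 0 (set_num 8 3 0
       (set_num 8 (aval (Num (Suc a)) (set_bdd (11 + a) (aval (Num 0) st) (bval (BConst True) st) st))
         (aval (Num 1) (set_bdd (11 + a) (aval (Num 0) st) (bval (BConst True) st) st))
         (set_bdd (11 + a) (aval (Num 0) st) (bval (BConst True) st) st)))"
      using a by (auto simp: sg_def unp_part_def)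
  next
    have sum: "(\<Sum>v<n. 9 * 2 ^ v) = 9 * (2 ^ n - 1 :: nat)" for n
      by (induction n) auto
    have "(1 :: nat) \<le> 2 ^ length xs" by simp
    then show "Suc (bcost (BConst True)) + (0 + (\<Sum>v<length xs. 9 * 2 ^ v)) \<le> 11 * 2 ^ length xs"
      unfolding sum bcost.simps by linarith
  next
    fix v s assume "?I v s"
    moreover from this have "?F s" by blast
    ultimately show "nums s 8 3 = v \<and> aval (Cell 0 (Num a)) s = length xs"
      using len frame_nums[OF \<open>?F s\<close>, of 0 a] by simp
  next
    fix s assume "?I (length xs) s"
    then show "?F s \<and> nums s 8 (Suc a) = 2 ^ length xs \<and>
      (\<forall>j < 2 ^ length xs. bdds s (11 + a) j = {\<sigma>. unp_part (set xs) \<sigma> = nth_subset xs (length xs) j})"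
      by (simp add: sg_def)
  qed simp_all
qed

text \<open>Composition through one fixed state needs no third copy of the variables: quantifying
  the pivot away yields the set of its predecessors and the set of its successors, and their
  conjunction is the product of the two. Cell \<open>3 + a\<close> gets mutual reachability.\<close>

definition closure :: "nat \<Rightarrow> prog" where
  "closure a = (let T = BCell 10 (Num (Suc a)); S = BCell (11 + a) (var 3); V = vars_slice a in
     Seq (Put 10 (Num (Suc a)) (BCell 0 (Num (2 + a)))) (Seq
     (For 3 (var (Suc a)) (Put 10 (Num (Suc a))
       (BOr T (BAnd (BEx (Primed V) (BAnd T (BRen V S))) (BEx (Unprimed V) (BAnd T S))))))
     (Put 10 (Num (3 + a)) (BAnd T (BRen V T)))))"

lemma transp_closed_tranclp:
  assumes "\<And>x y. r x y \<Longrightarrow> t x y" "\<And>x y. t x y \<Longrightarrow> r\<^sup>+\<^sup>+ x y"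
    and "\<And>x y z. t x y \<Longrightarrow> t y z \<Longrightarrow> t x z"
  shows "t = r\<^sup>+\<^sup>+"
proof (intro ext iffI)
  fix x y assume "r\<^sup>+\<^sup>+ x y"
  then show "t x y"
    by (induction rule: tranclp_induct) (auto intro: assms)
qed (rule assms)

text \<open>Warshall's algorithm with the singletons as pivots.\<close>

lemma closure_runs:
  fixes r :: "nat set \<Rightarrow> nat set \<Rightarrow> bool"
  assumes a: "a < 2" and slice: "nums st (Suc a) ` {..<nums st 0 a} = V"
    and trans: "bdds st 0 (2 + a) = rel_bdd V r" and r: "\<And>x y. r x y \<Longrightarrow> x \<subseteq> V \<and> y \<subseteq> V"
    and num: "nums st 8 (Suc a) = n" and z: "z ` {..<n} = Pow V"
    and S: "\<And>j. j < n \<Longrightarrow> bdds st (11 + a) j = {\<sigma>. unp_part V \<sigma> = z j}"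
  shows "runs (closure a) st (7 + 13 * n) (\<lambda>s. frame {(8, 3)} {(10, Suc a), (10, 3 + a)} st s \<and>
    bdds s 10 (Suc a) = rel_bdd V r\<^sup>+\<^sup>+ \<and> bdds s 10 (3 + a) = rel_bdd V (\<lambda>x y. r\<^sup>+\<^sup>+ x y \<and> r\<^sup>+\<^sup>+ y x))"
proof -
  let ?F = "frame {(8, 3)} {(10, Suc a), (10, 3 + a)} st"
  have S': "bdds st (11 + a) j = rel_bdd V (\<lambda>x _. x = z j)" if "j < n" for j
    using S[OF that] by (simp add: rel_bdd_def)
  have zsub: "z j \<subseteq> V" if "j < n" for j using z that by blast
  \<comment> \<open>Instead of paths through the first pivots, the invariant uses a local property:
    \<open>t\<close> is closed under composition at each processed pivot. A later pivot preserves
    this, and once every state has been a pivot it is transitivity.\<close>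
  let ?good = "\<lambda>j t. (\<forall>x y. r x y \<longrightarrow> t x y) \<and> (\<forall>x y. t x y \<longrightarrow> r\<^sup>+\<^sup>+ x y) \<and>
    (\<forall>i<j. \<forall>x y. t x (z i) \<longrightarrow> t (z i) y \<longrightarrow> t x y)"
  let ?I = "\<lambda>j s. ?F s \<and> nums s 8 3 = j \<and> (\<exists>t. ?good j t \<and> bdds s 10 (Suc a) = rel_bdd V t)"
  have sub: "x \<subseteq> V \<and> y \<subseteq> V" if "r\<^sup>+\<^sup>+ x y" for x y
    using that by (induction rule: tranclp_induct) (auto dest: r)
  have slice': "slice_val (vars_slice a) s = V" if F: "?F s" for s
    using slice frame_nums[OF F] a by (simp add: vars_slice_def)
  show ?thesis
    unfolding closure_def Let_def
  proof (rule runs_cost[OF runs_Seq[OF runs_Put[OF runs_Seq[OF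
      runs_For[where n = n and I = ?I and C = "\<lambda>_. 13"]]]]])
    show "?I 0 (set_num 8 3 0 (set_bdd 10 (aval (Num (Suc a)) st) (bval (BCell 0 (Num (2 + a))) st) st))"
      using trans by (auto intro!: exI[of _ r])
  next
    fix j s assume j: "j < n" and I: "?I j s"
    then obtain t where t: "?good j t" "bdds s 10 (Suc a) = rel_bdd V t" by blast
    have F: "?F s" using I by blast
    have Sj: "bdds s (11 + a) j = rel_bdd V (\<lambda>x _. x = z j)"
      using frame_bdds[OF F, of "11 + a" j] S'[OF j] by simp
    let ?e = "BOr (BCell 10 (Num (Suc a))) (BAnd
        (BEx (Primed (vars_slice a)) (BAnd (BCell 10 (Num (Suc a))) (BRen (vars_slice a) (BCell (11 + a) (var 3)))))
        (BEx (Unprimed (vars_slice a)) (BAnd (BCell 10 (Num (Suc a))) (BCell (11 + a) (var 3)))))"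
    let ?t = "\<lambda>x y. t x y \<or> t x (z j) \<and> t (z j) y"
    have "bval ?e s
      = rel_bdd V (\<lambda>x y. t x y \<or> (\<exists>y' \<subseteq> V. t x y' \<and> y' = z j) \<and> (\<exists>x' \<subseteq> V. t x' y \<and> x' = z j))"
      using t(2) Sj I slice'[OF F] by (simp add: rel_bdd_simps)
    also have "\<dots> = rel_bdd V ?t"
      using zsub[OF j] by (intro rel_bdd_cong) blast
    finally have val: "bval ?e s
      = rel_bdd V ?t" .
    have good': "?good (Suc j) ?t"
    proof (intro conjI allI impI)
      show "r\<^sup>+\<^sup>+ x y" if "?t x y" for x y using that t(1) by (meson tranclp_trans)
      show "?t x y" if "i < Suc j" "?t x (z i)" "?t (z i) y" for i x y
        using that t(1) less_Suc_eq by metis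
    qed (use t(1) in blast)
    have I': "?I (Suc j) (set_num 8 3 (Suc j) (set_bdd 10 (Suc a) (rel_bdd V ?t) s))"
    proof (intro conjI exI[of _ ?t])
      show "\<forall>x y. r x y \<longrightarrow> ?t x y" "\<forall>x y. ?t x y \<longrightarrow> r\<^sup>+\<^sup>+ x y"
        "\<forall>i<Suc j. \<forall>x y. ?t x (z i) \<longrightarrow> ?t (z i) y \<longrightarrow> ?t x y"
        using good' by blast+
    qed (use F in simp_all)
    show "runs (Put 10 (Num (Suc a)) ?e) s 13
      (\<lambda>s'. ?I (Suc j) (set_num 8 3 (Suc (nums s' 8 3)) s'))"
    proof (rule runs_cost[OF runs_Put])
      show "?I (Suc j) (set_num 8 3 (Suc (nums (set_bdd 10 (aval (Num (Suc a)) s) (bval ?e s) s) 8 3))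
          (set_bdd 10 (aval (Num (Suc a)) s) (bval ?e s) s))"
        unfolding val using I' I by simp
    qed (use a in simp_all)
  next
    fix s assume I: "?I n s"
    then obtain t where t: "?good n t" "bdds s 10 (Suc a) = rel_bdd V t" by blast
    have "t = r\<^sup>+\<^sup>+"
    proof (rule transp_closed_tranclp)
      fix x y u assume xy: "t x y" "t y u"
      then have "r\<^sup>+\<^sup>+ x y" using t(1) by simp
      then have "y \<in> z ` {..<n}" using sub[of x y] z by simp
      then obtain i where "i < n" "y = z i" by blast
      then show "t x u" using t(1) xy by simp
    qed (use t(1) in simp_all)
    moreover have F: "?F s" using I by blast
    ultimately show "runs (Put 10 (Num (3 + a)) (BAnd (BCell 10 (Num (Suc a)))
        (BRen (vars_slice a) (BCell 10 (Num (Suc a)))))) s 5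
      (\<lambda>s. ?F s \<and> bdds s 10 (Suc a) = rel_bdd V r\<^sup>+\<^sup>+ \<and>
        bdds s 10 (3 + a) = rel_bdd V (\<lambda>x y. r\<^sup>+\<^sup>+ x y \<and> r\<^sup>+\<^sup>+ y x))"
      using t(2) slice'[OF F] by (intro runs_cost[OF runs_Put]) (auto simp: rel_bdd_simps)
  next
    fix j s assume I: "?I j s"
    then have "?F s" by blast
    then show "nums s 8 3 = j \<and> aval (var (Suc a)) s = n"
      using I frame_nums[OF \<open>?F s\<close>, of 8 "Suc a"] num a by simp
  qed (simp_all add: algebra_simps)
qed

text \<open>All assumptions lie in one flat array, and so do all guarantees;
  \<open>var (5 + a)\<close> is the offset of conjunct \<open>var 3\<close> and is advanced at the
  end. Cell \<open>6 + a\<close> collects the states whose component contains, for each formula of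
  the conjunct, a state satisfying it.\<close>

definition accumulate :: "nat \<Rightarrow> prog" where
  "accumulate a = Seq (Put 10 (Num (6 + a)) (BConst True)) (Seq
     (For 4 (Cell (3 + a) (var 3)) (Put 10 (Num (6 + a)) (BAnd (BCell 10 (Num (6 + a)))
       (BEx (Primed (vars_slice a)) (BAnd (BCell 10 (Num (3 + a)))
         (BRen (vars_slice a) (BCell (Suc a) (Plus (var (5 + a)) (var 4)))))))))
     (Assign 8 (Num (5 + a)) (Plus (var (5 + a)) (Cell (3 + a) (var 3)))))"

lemma accumulate_runs:
  assumes a: "a < 2" and slice: "nums st (Suc a) ` {..<nums st 0 a} = V"
    and num: "nums st 8 3 = l" "nums st 8 (5 + a) = p" "nums st (3 + a) l = n"
    and E: "bdds st 10 (3 + a) = rel_bdd V e"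
    and P: "\<And>j. j < n \<Longrightarrow> bdds st (Suc a) (p + j) = rel_bdd V (\<lambda>x _. P j x)"
  shows "runs (accumulate a) st (2 + 8 * n) (\<lambda>s. frame {(8, 4), (8, 5 + a)} {(10, 6 + a)} st s \<and>
    nums s 8 (5 + a) = p + n \<and>
    bdds s 10 (6 + a) = rel_bdd V (\<lambda>x _. \<forall>j<n. \<exists>y \<subseteq> V. e x y \<and> P j y))"
proof -
  let ?F = "frame {(8, 4), (8, 5 + a)} {(10, 6 + a)} st"
  let ?R = "\<lambda>j. rel_bdd V (\<lambda>x _. \<forall>i<j. \<exists>y \<subseteq> V. e x y \<and> P i y)"
  let ?I = "\<lambda>j s. ?F s \<and> nums s 8 4 = j \<and> nums s 8 (5 + a) = p \<and> bdds s 10 (6 + a) = ?R j"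
  have keep: "nums s 8 3 = l" "nums s (3 + a) l = n" "slice_val (vars_slice a) s = V"
    "bdds s 10 (3 + a) = rel_bdd V e" "j < n \<Longrightarrow> bdds s (Suc a) (p + j) = rel_bdd V (\<lambda>x _. P j x)"
    if F: "?F s" for s j
    using slice num E P[of j] frame_nums[OF F] frame_bdds[OF F] a by (simp_all add: vars_slice_def)
  show ?thesis
    unfolding accumulate_def
  proof (rule runs_cost[OF runs_Seq[OF runs_Put[OF runs_Seq[OF
      runs_For[where n = n and I = ?I and C = "\<lambda>_. 8"]]]]])
    show "?I 0 (set_num 8 4 0 (set_bdd 10 (aval (Num (6 + a)) st) (bval (BConst True) st) st))"
      using num a by (simp add: rel_bdd_def)
  next
    fix j s assume j: "j < n" and I: "?I j s"
    have F: "?F s" using I by blast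
    let ?e = "BAnd (BCell 10 (Num (6 + a)))
       (BEx (Primed (vars_slice a)) (BAnd (BCell 10 (Num (3 + a)))
         (BRen (vars_slice a) (BCell (Suc a) (Plus (var (5 + a)) (var 4))))))"
    have "bval ?e s = rel_bdd V (\<lambda>x _. (\<forall>i<j. \<exists>y \<subseteq> V. e x y \<and> P i y) \<and> (\<exists>y \<subseteq> V. e x y \<and> P j y))"
      using I keep[OF F] j by (simp add: rel_bdd_simps)
    also have "\<dots> = ?R (Suc j)"
      by (rule rel_bdd_cong) (auto simp: less_Suc_eq)
    finally have val: "bval ?e s = ?R (Suc j)" .
    show "runs (Put 10 (Num (6 + a)) ?e) s 8
      (\<lambda>s'. ?I (Suc j) (set_num 8 4 (Suc (nums s' 8 4)) s'))"
    proof (rule runs_cost[OF runs_Put])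
      show "?I (Suc j) (set_num 8 4 (Suc (nums (set_bdd 10 (aval (Num (6 + a)) s) (bval ?e s) s) 8 4))
          (set_bdd 10 (aval (Num (6 + a)) s) (bval ?e s) s))"
        unfolding val using I by simp
    qed (use a in simp_all)
  next
    fix j s assume I: "?I j s"
    then have "?F s" by blast
    then show "nums s 8 4 = j \<and> aval (Cell (3 + a) (var 3)) s = n"
      using I keep by simp
  next
    fix s assume I: "?I n s"
    then have F: "?F s" by blast
    show "runs (Assign 8 (Num (5 + a)) (Plus (var (5 + a)) (Cell (3 + a) (var 3)))) s 0
      (\<lambda>s. ?F s \<and> nums s 8 (5 + a) = p + n \<and> bdds s 10 (6 + a) = ?R n)"
      by (rule runs_Assign) (use I keep[OF F] in simp)
  qed simp_all
qed

section \<open>Infinite paths in finite graphs\<close>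

lemma tranclp_path:
  assumes "\<And>n. r (w n) (w (Suc n))" and "m < n"
  shows "r\<^sup>+\<^sup>+ (w m) (w n)"
  using \<open>m < n\<close>
proof (induction n)
  case (Suc n)
  then show ?case
    using assms(1)[of n] by (cases "m = n") (auto intro: tranclp.intros)
qed simp

text \<open>Only finitely many positions carry a state that is visited finitely often. Past them
  every state recurs, hence is reached again from any time.\<close>

lemma eventually_recurrent:
  assumes "finite (range w)" and step: "\<And>n. r (w n) (w (Suc n))"
  obtains k where "\<And>m n. m \<ge> k \<Longrightarrow> n \<ge> k \<Longrightarrow> r\<^sup>+\<^sup>+ (w m) (w n)"
proof -
  let ?B = "{x \<in> range w. finite {n. w n = x}}"
  have "finite (\<Union>x \<in> ?B. {n. w n = x})"
    using assms(1) by auto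
  then obtain k where k: "\<forall>n \<in> (\<Union>x \<in> ?B. {n. w n = x}). n < k"
    unfolding finite_nat_set_iff_bounded ..
  show thesis
  proof (rule that)
    fix m n assume "m \<ge> k" "n \<ge> k"
    then have "w n \<notin> ?B"
      using k by force
    then have "infinite {l. w l = w n}" by auto
    then obtain l where "l > m" "w l = w n"
      unfolding infinite_nat_iff_unbounded by blast
    then show "r\<^sup>+\<^sup>+ (w m) (w n)"
      using tranclp_path[of r w, OF step] by metis
  qed
qed

text \<open>The falling rank forces a hit for the current index, and hits advance the index
  cyclically. The argument serves both players: the environment touring its component and the
  strategy serving the guarantees in turn.\<close>

lemma round_robin:
  fixes q rank :: "nat \<Rightarrow> nat"
  assumes bound: "\<And>n. n \<ge> n0 \<Longrightarrow> q n < K"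
    and hit: "\<And>n. n \<ge> n0 \<Longrightarrow> hit n \<Longrightarrow> q (Suc n) = Suc (q n) mod K"
    and miss: "\<And>n. n \<ge> n0 \<Longrightarrow> \<not> hit n \<Longrightarrow> q (Suc n) = q n \<and> rank (Suc n) < rank n"
    and "k < K"
  shows "infinite {n. q n = k \<and> hit n}"
proof -
  have next_hit: "\<exists>m\<ge>n. hit m \<and> q m = q n" if "n \<ge> n0" for n
    using that
  proof (induction "rank n" arbitrary: n rule: less_induct)
    case less
    show ?case
    proof (cases "hit n")
      case False
      then obtain m where "m \<ge> Suc n" "hit m" "q m = q (Suc n)"
        using less.hyps[of "Suc n"] less.prems miss[of n] by auto
      then show ?thesis using miss[of n] False less.prems by (metis Suc_leD)
    qed auto
  qed
  \<comment> \<open>\<open>d\<close> is a number of advances that leads to index \<open>k\<close>;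
    \<open>k + (K - q n)\<close> is one, written without negative numbers.\<close>
  have "\<exists>m\<ge>n. hit m \<and> q m = k" if "n \<ge> n0" "(q n + d) mod K = k" for n d
    using that
  proof (induction d arbitrary: n)
    case 0
    then show ?case using next_hit[of n] bound[of n] by simp
  next
    case (Suc d)
    obtain m where m: "m \<ge> n" "hit m" "q m = q n" using next_hit Suc.prems by blast
    then have "q (Suc m) = Suc (q n) mod K" using hit[of m] Suc.prems by simp
    then have "(q (Suc m) + d) mod K = k" using Suc.prems by (simp add: mod_simps)
    then show ?case using Suc.IH[of "Suc m"] m Suc.prems by (meson Suc_leD le_SucI order_trans)
  qed
  moreover have "(q n + (k + (K - q n))) mod K = k" if "n \<ge> n0" for n
    using bound[OF that] \<open>k < K\<close> by simp
  ultimately have "\<exists>m\<ge>n. hit m \<and> q m = k" if "n \<ge> n0" for n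
    using that by blast
  then have "\<exists>m\<ge>l. q m = k \<and> hit m" for l
    by (meson max.boundedE max.cobounded1)
  then show ?thesis
    unfolding infinite_nat_iff_unbounded_le by simp
qed

text \<open>The members of the component are listed and chased cyclically, each by steps that
  shorten the distance to it. The steps stay inside, as a vertex between two members is itself a
  member.\<close>

lemma scc_tour:
  assumes "r\<^sup>+\<^sup>+ x x" and fin: "finite {y. r\<^sup>+\<^sup>+ x y \<and> r\<^sup>+\<^sup>+ y x}"
  obtains p where "p 0 = x" and "\<And>n. r (p n) (p (Suc n))"
    and "\<And>y. r\<^sup>+\<^sup>+ x y \<Longrightarrow> r\<^sup>+\<^sup>+ y x \<Longrightarrow> infinite {n. p n = y}"
proof -
  let ?C = "{y. r\<^sup>+\<^sup>+ x y \<and> r\<^sup>+\<^sup>+ y x}"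
  obtain cs where cs: "set cs = ?C" using fin finite_list by blast
  define K where "K = length cs"
  have "x \<in> ?C" using assms by simp
  then have K: "K > 0" unfolding K_def using cs by auto
  \<comment> \<open>One less than the length of a shortest nonempty path: the target may be the
    current vertex, which then has to be left and reached again.\<close>
  define d where "d y x = (LEAST n. (r ^^ Suc n) x y)" for y x
  have ex: "\<exists>z. r v z \<and> z \<in> ?C \<and> (z = y \<or> d y z < d y v)" if "v \<in> ?C" "y \<in> ?C" for v y
  proof -
    have "r\<^sup>+\<^sup>+ v y" using that by (auto intro: tranclp_trans)
    then obtain n where "(r ^^ Suc n) v y"
      by (metis tranclp_power gr0_conv_Suc)
    then have "(r ^^ Suc (d y v)) v y" unfolding d_def by (rule LeastI)
    then obtain z where z: "r v z" "(r ^^ d y v) z y" by (meson relpowp_Suc_D2)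
    have "r\<^sup>*\<^sup>* z y" using z by (meson rtranclp_power)
    then have "z \<in> ?C"
      using that z(1) by (auto intro: tranclp.trancl_into_trancl rtranclp_tranclp_tranclp)
    moreover have "d y z < d y v" if neq: "z \<noteq> y"
    proof -
      obtain n where n: "d y v = Suc n" using neq z(2) by (cases "d y v") auto
      then have "d y z \<le> n" using z(2) unfolding d_def by (auto intro: Least_le)
      then show ?thesis using n by simp
    qed
    ultimately show ?thesis using z by blast
  qed
  define nx where "nx y v = (SOME z. r v z \<and> z \<in> ?C \<and> (z = y \<or> d y z < d y v))" for y v
  have nx: "r v (nx y v)" "nx y v \<in> ?C" "nx y v = y \<or> d y (nx y v) < d y v"
    if "v \<in> ?C" "y \<in> ?C" for v y
    using someI_ex[OF ex[OF that]] unfolding nx_def by blast+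
  define S where "S = rec_nat (x, 0::nat)
    (\<lambda>_ (v, q). (nx (cs ! q) v, if nx (cs ! q) v = cs ! q then Suc q mod K else q))"
  define p where "p n = fst (S n)" for n
  define q where "q n = snd (S n)" for n
  have S0: "p 0 = x" "q 0 = 0" by (simp_all add: p_def q_def S_def)
  have p_Suc: "p (Suc n) = nx (cs ! q n) (p n)" for n
    by (simp add: p_def q_def S_def split: prod.split)
  have q_Suc: "q (Suc n) = (if p (Suc n) = cs ! q n then Suc (q n) mod K else q n)" for n
    unfolding p_Suc by (simp add: p_def q_def S_def split: prod.split)
  have inv: "p n \<in> ?C \<and> q n < K" for n
  proof (induction n)
    case 0
    then show ?case using S0 K \<open>x \<in> ?C\<close> by simp
  next
    case (Suc n)
    then have "cs ! q n \<in> ?C" using cs K_def by (metis nth_mem)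
    then show ?case using Suc nx[of "p n" "cs ! q n"] K by (auto simp: p_Suc q_Suc)
  qed
  have tgt: "cs ! q n \<in> ?C" for n using cs K_def inv by (metis nth_mem)
  have step: "r (p n) (p (Suc n))" for n
    unfolding p_Suc using nx(1)[of "p n"] inv tgt by blast
  have visits: "infinite {n. q n = k \<and> p (Suc n) = cs ! q n}" if "k < K" for k
  proof (rule round_robin[where rank = "\<lambda>n. d (cs ! q n) (p n)" and ?n0.0 = 0])
    fix n assume "p (Suc n) \<noteq> cs ! q n"
    then show "q (Suc n) = q n \<and> d (cs ! q (Suc n)) (p (Suc n)) < d (cs ! q n) (p n)"
      using nx(3)[of "p n" "cs ! q n"] inv tgt p_Suc q_Suc by metis
  qed (use inv q_Suc that in auto)
  show thesis
  proof (rule that)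
    fix y assume "r\<^sup>+\<^sup>+ x y" "r\<^sup>+\<^sup>+ y x"
    then obtain k where k: "k < K" "cs ! k = y"
      using cs K_def by (metis (mono_tags, lifting) in_set_conv_nth mem_Collect_eq)
    have "infinite (Suc ` {n. q n = k \<and> p (Suc n) = cs ! q n})"
      using visits[OF k(1)] by (simp add: finite_image_iff)
    moreover have "Suc ` {n. q n = k \<and> p (Suc n) = cs ! q n} \<subseteq> {n. p n = y}"
      using k(2) by auto
    ultimately show "infinite {n. p n = y}" using finite_subset by blast
  qed (use S0 step in auto)
qed

text \<open>Each strict step adds an element, and growth never resumes after a pause. Applied to the
  complements of \<open>win_iter\<close> and to the attractors.\<close>

lemma incseq_sets_stable:
  fixes S :: "nat \<Rightarrow> 'a set"
  assumes "finite U" and sub: "\<And>n. S n \<subseteq> U" and inc: "\<And>n. S n \<subseteq> S (Suc n)"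
    and stable: "\<And>n. S (Suc n) = S n \<Longrightarrow> S (Suc (Suc n)) = S (Suc n)"
  shows "S (Suc (card U)) = S (card U)"
proof -
  have "mono S"
    using inc by (simp add: mono_iff_le_Suc)
  moreover have "finite (range S)"
    using assms(1) sub by (auto intro!: finite_subset[of _ "Pow U"])
  ultimately have "S (card U) = (\<Union>n. S n)"
    by (intro finite_mono_strict_prefix_implies_finite_fixpoint[OF sub assms(1)]
        finite_mono_remains_stable_implies_strict_prefix) (use stable in auto)
  then show ?thesis using inc by blast
qed

section \<open>The winning region\<close>

lemma sat_cong:
  "(\<And>x. x \<in> form_vars p \<Longrightarrow> x \<in> \<sigma> \<longleftrightarrow> x \<in> \<tau>) \<Longrightarrow> sat \<sigma> p \<longleftrightarrow> sat \<tau> p"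
  by (induction p) auto

locale separated_game =
  fixes G :: game_structure and \<phi> :: grk
  assumes game: "separated_grk_game G \<phi>"
begin

abbreviation X where "X \<equiv> ins G"
abbreviation Y where "Y \<equiv> outs G"

lemma finite_vars: "finite X" "finite Y" and disjoint_vars: "X \<inter> Y = {}"
  using game by (auto simp: separated_grk_game_def separated_game_structure_def)

lemma split_state [simp]:
  assumes "i \<subseteq> X" "out \<subseteq> Y"
  shows "(i \<union> out) \<inter> X = i" "(i \<union> out) \<inter> Y = out"
  using assms disjoint_vars by auto

definition rI :: "nat set \<Rightarrow> nat set \<Rightarrow> bool" where
  "rI i i' \<longleftrightarrow> i \<subseteq> X \<and> i' \<subseteq> X \<and> sat (step_val i i') (trans_in G)"

definition rO :: "nat set \<Rightarrow> nat set \<Rightarrow> bool" where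
  "rO out out' \<longleftrightarrow> out \<subseteq> Y \<and> out' \<subseteq> Y \<and> sat (step_val out out') (trans_out G)"

abbreviation "tI \<equiv> rI\<^sup>+\<^sup>+"
abbreviation "tO \<equiv> rO\<^sup>+\<^sup>+"

definition "eI i i' \<longleftrightarrow> tI i i' \<and> tI i' i"
definition "eO out out' \<longleftrightarrow> tO out out' \<and> tO out' out"

lemma rI_total: "i \<subseteq> X \<Longrightarrow> \<exists>i'. rI i i'"
  and rO_total: "out \<subseteq> Y \<Longrightarrow> \<exists>out'. rO out out'"
  using game by (simp_all add: separated_grk_game_def separated_game_structure_def rI_def rO_def)

lemma rI_sub: "rI i i' \<Longrightarrow> i \<subseteq> X \<and> i' \<subseteq> X"
  and rO_sub: "rO out out' \<Longrightarrow> out \<subseteq> Y \<and> out' \<subseteq> Y"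
  by (auto simp: rI_def rO_def)

lemma tI_sub: "tI i i' \<Longrightarrow> i \<subseteq> X \<and> i' \<subseteq> X"
  by (induction rule: tranclp_induct) (auto simp: rI_def)

lemma tO_sub: "tO out out' \<Longrightarrow> out \<subseteq> Y \<and> out' \<subseteq> Y"
  by (induction rule: tranclp_induct) (auto simp: rO_def)

lemma form_vars_game:
  "form_vars (init_in G) \<subseteq> Unp ` X" "form_vars (init_out G) \<subseteq> Unp ` Y"
  "form_vars (trans_in G) \<subseteq> Unp ` X \<union> Pri ` X" "form_vars (trans_out G) \<subseteq> Unp ` Y \<union> Pri ` Y"
  using game by (simp_all add: separated_grk_game_def separated_game_structure_def)

lemma sat_step_restrict:
  assumes "form_vars p \<subseteq> Unp ` V \<union> Pri ` V"
  shows "sat (step_val s t) p \<longleftrightarrow> sat (step_val (s \<inter> V) (t \<inter> V)) p"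
proof (rule sat_cong)
  fix x assume "x \<in> form_vars p"
  then obtain v where "v \<in> V" "x = Unp v \<or> x = Pri v" using assms by blast
  then show "x \<in> step_val s t \<longleftrightarrow> x \<in> step_val (s \<inter> V) (t \<inter> V)"
    by (auto simp: step_val_def)
qed

lemma sat_restrict:
  assumes "form_vars p \<subseteq> Unp ` V"
  shows "sat (Unp ` s) p \<longleftrightarrow> sat (Unp ` (s \<inter> V)) p"
proof (rule sat_cong)
  fix x assume "x \<in> form_vars p"
  then obtain v where "v \<in> V" "x = Unp v" using assms by blast
  then show "x \<in> Unp ` s \<longleftrightarrow> x \<in> Unp ` (s \<inter> V)" by auto
qed

lemmas sat_trans_in = sat_step_restrict[OF form_vars_game(3)]
  and sat_trans_out = sat_step_restrict[OF form_vars_game(4)]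

lemma form_vars_grk:
  assumes "(as, gs) \<in> set \<phi>"
  shows "a \<in> set as \<Longrightarrow> form_vars a \<subseteq> Unp ` X" "g \<in> set gs \<Longrightarrow> form_vars g \<subseteq> Unp ` Y"
  using game assms unfolding separated_grk_game_def separated_grk_def by fast+

lemma play_iff:
  "play G s0 w \<longleftrightarrow> w 0 = s0 \<and> (\<forall>j. w j \<subseteq> X \<union> Y) \<and>
    (\<forall>j. rI (w j \<inter> X) (w (Suc j) \<inter> X) \<and> rO (w j \<inter> Y) (w (Suc j) \<inter> Y))"
proof -
  have "sat (step_val s t) (trans_in G) \<longleftrightarrow> rI (s \<inter> X) (t \<inter> X)"
    and "sat (step_val s t) (trans_out G) \<longleftrightarrow> rO (s \<inter> Y) (t \<inter> Y)" for s t
    using sat_trans_in[of s t] sat_trans_out[of s t] by (simp_all add: rI_def rO_def)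
  then show ?thesis by (simp add: play_def)
qed

lemma GF_restrict:
  assumes "form_vars p \<subseteq> Unp ` V"
  shows "GF p w \<longleftrightarrow> infinite {j. sat (Unp ` (w j \<inter> V)) p}"
proof -
  have "{j. sat (Unp ` w j) p} = {j. sat (Unp ` (w j \<inter> V)) p}"
    using sat_restrict[OF assms] by (intro Collect_cong)
  then show ?thesis by (simp add: GF_def)
qed

text \<open>Mere existence inside a component replaces infinitely many visits, because the
  environment may tour its whole component and the system its own.\<close>

definition good :: "nat set \<Rightarrow> nat set \<Rightarrow> bool" where
  "good i out \<longleftrightarrow> (\<forall>(as, gs) \<in> set \<phi>.
     (\<forall>a \<in> set as. \<exists>i'. eI i i' \<and> sat (Unp ` i') a) \<longrightarrow>
     (\<forall>g \<in> set gs. \<exists>out'. eO out out' \<and> sat (Unp ` out') g))"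

text \<open>The second conjunct is the obligation against an environment that never leaves the component of
  \<open>i\<close>. It cannot be imposed on all later components at once: an input without a cycle forces the
  system to move before it sees where the environment settles, hence the first conjunct.\<close>

definition win_step :: "(nat set \<Rightarrow> nat set \<Rightarrow> bool) \<Rightarrow> nat set \<Rightarrow> nat set \<Rightarrow> bool" where
  "win_step Z i out \<longleftrightarrow>
     (\<forall>i'. rI i i' \<longrightarrow> (\<exists>out'. rO out out' \<and> Z i' out')) \<and>
     (tI i i \<longrightarrow> (\<exists>out'. tO out out' \<and> tO out' out' \<and> good i out' \<and> Z i out'))"

definition win_iter :: "nat \<Rightarrow> nat set \<Rightarrow> nat set \<Rightarrow> bool" where
  "win_iter n = (win_step ^^ n) (\<lambda>_ _. True)"

abbreviation "Win \<equiv> win_iter (num_states G)"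

lemma win_step_mono:
  assumes "win_step Z i out" "\<And>i out. i \<subseteq> X \<Longrightarrow> out \<subseteq> Y \<Longrightarrow> Z i out \<Longrightarrow> Z' i out"
  shows "win_step Z' i out"
  unfolding win_step_def
proof (intro conjI allI impI)
  fix i' assume "rI i i'"
  then obtain out' where "rO out out'" "Z i' out'"
    using assms(1) unfolding win_step_def by blast
  then show "\<exists>out'. rO out out' \<and> Z' i' out'"
    using assms(2)[of i' out'] rI_sub[OF \<open>rI i i'\<close>] rO_sub[of out out'] by auto
next
  assume "tI i i"
  then obtain out' where "tO out out'" "tO out' out'" "good i out'" "Z i out'"
    using assms(1) unfolding win_step_def by blast
  then show "\<exists>out'. tO out out' \<and> tO out' out' \<and> good i out' \<and> Z' i out'"
    using assms(2)[of i out'] tI_sub[OF \<open>tI i i\<close>] tO_sub[OF \<open>tO out out'\<close>] by auto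
qed

lemma win_iter_Suc: "win_iter (Suc n) = win_step (win_iter n)"
  by (simp add: win_iter_def)

lemma win_iter_decreasing: "win_iter (Suc n) i out \<Longrightarrow> win_iter n i out"
proof (induction n arbitrary: i out)
  case (Suc n)
  have "win_step (win_iter (Suc n)) i out"
    using Suc.prems by (simp add: win_iter_Suc)
  then have "win_step (win_iter n) i out"
    by (rule win_step_mono) (rule Suc.IH)
  then show ?case by (simp add: win_iter_Suc)
qed (simp add: win_iter_def)

lemma num_states_eq: "num_states G = card (Pow X \<times> Pow Y)"
  unfolding num_states_def using finite_vars disjoint_vars
  by (simp add: card_cartesian_product card_Pow card_Un_disjoint power_add)

text \<open>Only states over \<open>X\<close> and \<open>Y\<close> are counted, of which there are
  \<open>N\<close>; the losing ones form an increasing chain of subsets.\<close>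

lemma Win_step: 
  assumes "i \<subseteq> X" "out \<subseteq> Y" shows "Win i out \<longleftrightarrow> win_step Win i out"
proof -
  let ?S = "\<lambda>n. {(i, out). i \<subseteq> X \<and> out \<subseteq> Y \<and> \<not> win_iter n i out}"
  have "?S (Suc (card (Pow X \<times> Pow Y))) = ?S (card (Pow X \<times> Pow Y))"
  proof (rule incseq_sets_stable)
    show "?S n \<subseteq> ?S (Suc n)" for n using win_iter_decreasing by auto
    show "?S (Suc (Suc n)) = ?S (Suc n)" if "?S (Suc n) = ?S n" for n
    proof -
      have "win_step (win_iter (Suc n)) i out \<longleftrightarrow> win_step (win_iter n) i out" for i out
        using that by (auto elim!: win_step_mono)
      then show ?thesis unfolding win_iter_Suc[of "Suc n"] by (simp add: win_iter_Suc[of n])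
    qed
  qed (use finite_vars in auto)
  then show ?thesis
    using assms unfolding num_states_eq[symmetric] win_iter_Suc by blast
qed

lemma Win_coinduct:
  assumes "Z i out" and "\<And>i out. Z i out \<Longrightarrow> win_step Z i out"
  shows "Win i out"
proof -
  have "Z i out \<Longrightarrow> win_iter n i out" for n i out
  proof (induction n arbitrary: i out)
    case (Suc n)
    then show ?case unfolding win_iter_Suc using win_step_mono[OF assms(2)] by simp
  qed (simp add: win_iter_def)
  then show ?thesis using assms(1) by simp
qed

text \<open>The system at \<open>out\<close> may lag behind an imagined play from
  \<open>out'\<close>, always moving one step along a path to where that play has got. This works
  because output moves are not constrained by inputs.\<close>

lemma Win_mono_out:
  assumes "rO\<^sup>*\<^sup>* out out'" "i \<subseteq> X" "out' \<subseteq> Y" "Win i out'"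
  shows "Win i out"
proof (rule Win_coinduct[where Z = "\<lambda>i out. \<exists>out'. i \<subseteq> X \<and> out' \<subseteq> Y \<and> rO\<^sup>*\<^sup>* out out' \<and> Win i out'"])
  show "\<exists>out'. i \<subseteq> X \<and> out' \<subseteq> Y \<and> rO\<^sup>*\<^sup>* out out' \<and> Win i out'" using assms by blast
next
  fix i out
  let ?Z = "\<lambda>i out. \<exists>out'. i \<subseteq> X \<and> out' \<subseteq> Y \<and> rO\<^sup>*\<^sup>* out out' \<and> Win i out'"
  assume "?Z i out"
  then obtain u where u: "i \<subseteq> X" "u \<subseteq> Y" "rO\<^sup>*\<^sup>* out u" "Win i u" by blast
  then have w: "win_step Win i u" using Win_step by blast
  show "win_step ?Z i out"
    unfolding win_step_def
  proof (intro conjI allI impI)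
    fix i' assume i': "rI i i'"
    then obtain v where v: "rO u v" "Win i' v" using w unfolding win_step_def by blast
    \<comment> \<open>The path to the new imagined position has at least one step, so a first move
      \<open>o1\<close> exists; the rest of the path is the new lag.\<close>
    have "tO out v" using u(3) v(1) by (rule rtranclp_into_tranclp1)
    then obtain o1 where "rO out o1" "rO\<^sup>*\<^sup>* o1 v" by (meson tranclpD)
    then show "\<exists>o1. rO out o1 \<and> ?Z i' o1" using v rI_sub[OF i'] rO_sub[OF v(1)] by blast
  next
    assume "tI i i"
    then obtain v where v: "tO u v" "tO v v" "good i v" "Win i v"
      using w unfolding win_step_def by blast
    then have "tO out v" using u(3) by (meson rtranclp_tranclp_tranclp)
    then show "\<exists>v. tO out v \<and> tO v v \<and> good i v \<and> ?Z i v"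
      using v tO_sub u(1) by blast
  qed
qed

text \<open>Answering along the input path leads to some winning output reachable from
  \<open>out\<close>, and \<open>Win_mono_out\<close> pulls the win back to \<open>out\<close>
  itself. Hence mutually reachable inputs are winning with the same outputs.\<close>

lemma Win_mono_in:
  assumes "rI\<^sup>*\<^sup>* i i'" "i \<subseteq> X" "out \<subseteq> Y" "Win i out"
  shows "Win i' out"
proof -
  have "\<exists>out'. rO\<^sup>*\<^sup>* out out' \<and> out' \<subseteq> Y \<and> Win i' out'"
    using assms(1)
  proof (induction rule: rtranclp_induct)
    case (step i1 i2)
    then obtain u where u: "rO\<^sup>*\<^sup>* out u" "u \<subseteq> Y" "Win i1 u" by blast
    have "win_step Win i1 u" using Win_step rI_sub[OF step.hyps(2)] u by simp
    then obtain v where v: "rO u v" "Win i2 v" using step.hyps(2) unfolding win_step_def by blast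
    then show ?case using rO_sub[OF v(1)] rtranclp.rtrancl_into_rtrancl[OF u(1) v(1)] by blast
  qed (use assms in auto)
  moreover have "i' \<subseteq> X" using assms(1,2) by (induction rule: rtranclp_induct) (auto simp: rI_def)
  ultimately show ?thesis using Win_mono_out by blast
qed

section \<open>Plays against a fixed strategy\<close>

lemma rI_path: "i \<subseteq> X \<Longrightarrow> \<exists>p. p 0 = i \<and> (\<forall>n. rI (p n) (p (Suc n)))"
  and rO_path: "out \<subseteq> Y \<Longrightarrow> \<exists>p. p 0 = out \<and> (\<forall>n. rO (p n) (p (Suc n)))"
proof -
  have *: "\<exists>p. p 0 = x \<and> (\<forall>n. r (p n) (p (Suc n)))"
    if "P x" and ex: "\<And>x. P x \<Longrightarrow> \<exists>y. r x y \<and> P y" for x :: "nat set" and r P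
  proof -
    define p where "p = rec_nat x (\<lambda>_ y. SOME z. r y z \<and> P z)"
    have p_Suc: "r (p n) (p (Suc n)) \<and> P (p (Suc n))" if "P (p n)" for n
      using someI_ex[OF ex[OF that]] by (simp add: p_def)
    have "P (p n)" for n
    proof (induction n)
      case 0
      show ?case using \<open>P x\<close> by (simp add: p_def)
    qed (use p_Suc in blast)
    then have "p 0 = x \<and> (\<forall>n. r (p n) (p (Suc n)))"
      using p_Suc by (simp add: p_def)
    then show ?thesis by (rule exI[of _ p])
  qed
  have "\<exists>i'. rI i i' \<and> i' \<subseteq> X" if "i \<subseteq> X" for i
    using rI_total[OF that] rI_sub[of i] by blast
  then show "i \<subseteq> X \<Longrightarrow> \<exists>p. p 0 = i \<and> (\<forall>n. rI (p n) (p (Suc n)))"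
    using *[where P = "\<lambda>i. i \<subseteq> X"] by blast
  have "\<exists>out'. rO out out' \<and> out' \<subseteq> Y" if "out \<subseteq> Y" for out
    using rO_total[OF that] rO_sub[of out] by blast
  then show "out \<subseteq> Y \<Longrightarrow> \<exists>p. p 0 = out \<and> (\<forall>n. rO (p n) (p (Suc n)))"
    using *[where P = "\<lambda>out. out \<subseteq> Y"] by blast
qed

text \<open>Legality of \<open>f\<close> is promised only along infinite plays. To see that move
  \<open>n\<close> is legal, the prefix built so far is completed to a play, with the given inputs
  and an arbitrary output path, and the promise is applied to that play.\<close>

lemma strategy_outcome:
  assumes f: "is_strategy G f" and s0: "s0 \<subseteq> X \<union> Y"
    and x: "x 0 = s0 \<inter> X" "\<And>n. rI (x n) (x (Suc n))"
  obtains w where "play G s0 w" "consistent G f w" "\<And>n. w n \<inter> X = x n"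
proof -
  have xsub: "x n \<subseteq> X" for n using x(2) rI_sub by blast
  define H where "H = rec_nat [s0] (\<lambda>n h. h @ [x (Suc n) \<union> f h (x (Suc n))])"
  define w where "w n = last (H n)" for n
  have w0: "w 0 = s0" by (simp add: w_def H_def)
  have H: "H n = map w [0..<Suc n]" for n
  proof (induction n)
    case (Suc n)
    have "H (Suc n) = H n @ [w (Suc n)]" by (simp add: w_def H_def)
    then show ?case using Suc by simp
  qed (simp add: w_def H_def)
  have w_Suc: "w (Suc n) = x (Suc n) \<union> f (map w [0..<Suc n]) (x (Suc n))" for n
    unfolding H[symmetric] by (simp add: w_def H_def)
  have inv: "w n \<subseteq> X \<union> Y \<and> f (map w [0..<Suc n]) (x (Suc n)) \<subseteq> Y" for n
  proof (induction n rule: less_induct)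
    case (less n)
    have "w n \<subseteq> X \<union> Y"
    proof (cases n)
      case 0
      then show ?thesis using w0 s0 by simp
    next
      case (Suc m)
      have "x n \<subseteq> X" by (rule xsub)
      moreover have "f (map w [0..<Suc m]) (x n) \<subseteq> Y" using less[of m] Suc by blast
      ultimately show ?thesis using w_Suc[of m] Suc by auto
    qed
    then have "w j \<subseteq> X \<union> Y" if "j < Suc n" for j
      using that less[of j] by (cases "j = n") simp_all
    then have "history G (map w [0..<Suc n])"
      by (auto simp: history_def simp del: upt_Suc)
    then have "f (map w [0..<Suc n]) (x (Suc n)) \<subseteq> Y"
      using f xsub[of "Suc n"] by (simp add: is_strategy_def del: upt_Suc)
    with \<open>w n \<subseteq> X \<union> Y\<close> show ?case ..
  qed
  have wsub: "w n \<subseteq> X \<union> Y" and fsub: "f (map w [0..<Suc n]) (x (Suc n)) \<subseteq> Y" for n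
    using inv[of n] by simp_all
  have wX: "w n \<inter> X = x n" for n
  proof (cases n)
    case (Suc k)
    then show ?thesis using w_Suc[of k] fsub[of k] xsub[of "Suc k"] by simp
  qed (use w0 x(1) in simp)
  have wY: "w (Suc n) \<inter> Y = f (map w [0..<Suc n]) (x (Suc n))" for n
    using w_Suc[of n] fsub[of n] xsub[of "Suc n"] by simp
  have legal: "rO (w n \<inter> Y) (w (Suc n) \<inter> Y)" for n
  proof (induction n rule: less_induct)
    case (less n)
    obtain p where p: "p 0 = w n \<inter> Y" "\<And>k. rO (p k) (p (Suc k))"
      using rO_path[of "w n \<inter> Y"] by blast
    define v where "v j = (if j \<le> n then w j else x j \<union> p (j - n))" for j
    have psub: "p k \<subseteq> Y" for k using p(2) rO_sub by blast
    have vX: "v j \<inter> X = x j" for j using wX xsub psub by (auto simp: v_def)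
    have vY: "v j \<inter> Y = (if j \<le> n then w j \<inter> Y else p (j - n))" for j
      using xsub psub by (auto simp: v_def)
    have "rO (v j \<inter> Y) (v (Suc j) \<inter> Y)" for j
    proof -
      consider "j < n" | "j = n" | "j > n" by linarith
      then show ?thesis
      proof cases
        case 1
        then show ?thesis using less[of j] vY by simp
      next
        case 2
        then show ?thesis using p(1) p(2)[of 0] vY by simp
      next
        case 3
        then show ?thesis using p(2)[of "j - n"] vY by (simp add: Suc_diff_le)
      qed
    qed
    moreover have "v j \<subseteq> X \<union> Y" for j
      using wsub[of j] xsub[of j] psub[of "j - n"] by (auto simp: v_def)
    ultimately have "play G s0 v"
      unfolding play_iff using vX x(2) w0 by (simp add: v_def)
    moreover have "map v [0..<Suc n] = map w [0..<Suc n]" by (simp add: v_def)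
    moreover have "v n = w n" by (simp add: v_def)
    moreover have "sat (step_val (w n) (x (Suc n))) (trans_in G)"
    proof -
      have "x (Suc n) \<inter> X = x (Suc n)" using xsub by blast
      then show ?thesis
        using sat_trans_in[of "w n" "x (Suc n)"] wX[of n] x(2)[of n] by (simp add: rI_def)
    qed
    ultimately have "sat (step_val (w n) (w (Suc n))) (trans_out G)"
      using f xsub[of "Suc n"] w_Suc[of n] unfolding is_strategy_def by metis
    then show ?case using sat_trans_out[of "w n" "w (Suc n)"] by (simp add: rO_def)
  qed
  show thesis
  proof (rule that)
    show "play G s0 w" unfolding play_iff using w0 wsub wX x(2) legal by simp
    show "consistent G f w" unfolding consistent_def using wX wY by simp
  qed (rule wX)
qed

lemma consistent_plays_agree:
  assumes "play G s0 v" "consistent G f v" "play G s0 w" "consistent G f w"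
    and "\<And>n. n \<le> m \<Longrightarrow> v n \<inter> X = w n \<inter> X"
  shows "n \<le> m \<Longrightarrow> v n = w n"
proof (induction n rule: less_induct)
  case (less n)
  show ?case
  proof (cases n)
    case 0
    then show ?thesis using assms(1,3) by (simp add: play_def)
  next
    case (Suc k)
    have "map v [0..<Suc k] = map w [0..<Suc k]"
      using less Suc by (intro map_cong) auto
    moreover have "v n \<inter> X = w n \<inter> X" using assms(5) less.prems by blast
    ultimately have "v n \<inter> Y = w n \<inter> Y"
      using assms(2,4) Suc unfolding consistent_def by metis
    moreover have "v n \<subseteq> X \<union> Y" "w n \<subseteq> X \<union> Y" using assms(1,3) by (auto simp: play_def)
    ultimately show ?thesis using \<open>v n \<inter> X = w n \<inter> X\<close> by blast
  qed
qed

text \<open>Up to time \<open>m\<close> the inputs are the old ones, so by determinism the play is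
  the old one; afterwards the environment is free to follow any input path.\<close>

lemma change_future_inputs:
  assumes f: "is_strategy G f" and w: "play G s0 w" "consistent G f w"
    and y: "y 0 = w m \<inter> X" "\<And>n. rI (y n) (y (Suc n))"
  obtains v where "play G s0 v" "consistent G f v" "v m = w m" "\<And>n. v (m + n) \<inter> X = y n"
proof -
  define x where "x n = (if n \<le> m then w n \<inter> X else y (n - m))" for n
  have rIw: "rI (w n \<inter> X) (w (Suc n) \<inter> X)" for n using w(1) by (simp add: play_iff)
  have "rI (x n) (x (Suc n))" for n
  proof -
    consider "n < m" | "n = m" | "n > m" by linarith
    then show ?thesis
    proof cases
      case 1
      then show ?thesis using rIw[of n] by (simp add: x_def)
    next
      case 2
      then show ?thesis using y(1) y(2)[of 0] by (simp add: x_def)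
    next
      case 3
      then show ?thesis using y(2)[of "n - m"] by (simp add: x_def Suc_diff_le)
    qed
  qed
  moreover have "x 0 = s0 \<inter> X" "s0 \<subseteq> X \<union> Y" using w(1) by (auto simp: x_def play_def)
  ultimately obtain v where v: "play G s0 v" "consistent G f v" "\<And>n. v n \<inter> X = x n"
    using strategy_outcome[OF f, of s0 x] by blast
  show thesis
  proof (rule that[OF v(1,2)])
    show "v m = w m"
      using consistent_plays_agree[OF v(1,2) w, of m m] v(3) by (simp add: x_def)
    show "v (m + n) \<inter> X = y n" for n
      using v(3)[of "m + n"] y(1) by (cases n) (simp_all add: x_def)
  qed
qed

text \<open>The environment may tour the component of its current input forever; the resulting play shows
  that the states met under a winning strategy form a post-fixpoint of \<open>win_step\<close>.\<close>

lemma Win_necessary: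
  assumes f: "is_strategy G f" and s0: "s0 \<subseteq> X \<union> Y" and wins: "wins_from G \<phi> f s0"
  shows "Win (s0 \<inter> X) (s0 \<inter> Y)"
proof (rule Win_coinduct)
  let ?Z = "\<lambda>i out. \<exists>w m. play G s0 w \<and> consistent G f w \<and> w m \<inter> X = i \<and> w m \<inter> Y = out"
  obtain x where "x 0 = s0 \<inter> X" "\<And>n. rI (x n) (x (Suc n))"
    using rI_path[of "s0 \<inter> X"] by blast
  then obtain w where "play G s0 w" "consistent G f w"
    using strategy_outcome[OF f s0] by metis
  moreover from this have "w 0 = s0" by (simp add: play_def)
  ultimately show "?Z (s0 \<inter> X) (s0 \<inter> Y)" by metis
  fix i out
  assume "?Z i out"
  then obtain w m where w: "play G s0 w" "consistent G f w" and m: "w m \<inter> X = i" "w m \<inter> Y = out"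
    by blast
  have stepsO: "rO (v n \<inter> Y) (v (Suc n) \<inter> Y)" if "play G s0 v" for v n
    using that by (simp add: play_iff)
  show "win_step ?Z i out"
    unfolding win_step_def
  proof (intro conjI allI impI)
    fix i' assume i': "rI i i'"
    then obtain p where p: "p 0 = i'" "\<And>n. rI (p n) (p (Suc n))"
      using rI_path[of i'] rI_sub[OF i'] by blast
    have "rI (case n of 0 \<Rightarrow> i | Suc k \<Rightarrow> p k) (case Suc n of 0 \<Rightarrow> i | Suc k \<Rightarrow> p k)" for n
      using p i' by (cases n) simp_all
    from change_future_inputs[OF f w, of "case_nat i p" m, OF _ this]
    obtain v where v: "play G s0 v" "consistent G f v" "v m = w m"
      "\<And>n. v (m + n) \<inter> X = case_nat i p n"
      using m by auto
    have "v (Suc m) \<inter> X = i'" using v(4)[of 1] p(1) by simp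
    moreover have "rO out (v (Suc m) \<inter> Y)" using stepsO[OF v(1), of m] v(3) m by simp
    ultimately show "\<exists>out'. rO out out' \<and> ?Z i' out'" using v(1,2) by blast
  next
    assume "tI i i"
    have "{y. tI i y \<and> tI y i} \<subseteq> Pow X"
      by (auto dest!: tI_sub)
    then have "finite {y. tI i y \<and> tI y i}"
      using finite_vars(1) finite_subset by blast
    from scc_tour[OF \<open>tI i i\<close> this]
    obtain p where p: "p 0 = i" "\<And>n. rI (p n) (p (Suc n))"
      and tour: "\<And>y. tI i y \<Longrightarrow> tI y i \<Longrightarrow> infinite {n. p n = y}"
      by blast
    from change_future_inputs[OF f w, of p m, OF _ p(2)]
    obtain v where v: "play G s0 v" "consistent G f v" "v m = w m"
      "\<And>n. v (m + n) \<inter> X = p n"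
      using m p(1) by auto
    have visited: "infinite {n. v n \<inter> X = y}" if "eI i y" for y
    proof -
      have "infinite ((+) m ` {n. p n = y})" using tour[of y] that by (simp add: eI_def finite_image_iff)
      moreover have "(+) m ` {n. p n = y} \<subseteq> {n. v n \<inter> X = y}" using v(4) by auto
      ultimately show ?thesis using finite_subset by blast
    qed
    have "finite (range (\<lambda>n. v n \<inter> Y))"
      by (rule finite_subset[of _ "Pow Y"]) (use finite_vars(2) in auto)
    then obtain k where k: "\<And>a b. a \<ge> k \<Longrightarrow> b \<ge> k \<Longrightarrow> tO (v a \<inter> Y) (v b \<inter> Y)"
      using eventually_recurrent[of "\<lambda>n. v n \<inter> Y" rO] stepsO[OF v(1)] by blast
    \<comment> \<open>Late enough for the outputs to remain in one component, and at a return of the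
      input to \<open>i\<close>. The output at this time is the witness for the second conjunct of
      \<open>win_step\<close>.\<close>
    obtain n where n: "n > max k m" "v n \<inter> X = i"
      using visited[of i] \<open>tI i i\<close> unfolding eI_def infinite_nat_iff_unbounded by blast
    let ?out = "v n \<inter> Y"
    have "tO out ?out"
      using tranclp_path[of rO "\<lambda>n. v n \<inter> Y" m n, OF stepsO[OF v(1)]] n v(3) m by simp
    have "tO ?out ?out" using k n by simp
    have guarantee: "\<exists>out'. eO ?out out' \<and> sat (Unp ` out') g"
      if l: "(as, gs) \<in> set \<phi>"
        and A: "\<forall>a\<in>set as. \<exists>i'. eI i i' \<and> sat (Unp ` i') a" and g: "g \<in> set gs" for as gs g
    proof -
      have "GF a v" if a: "a \<in> set as" for a
      proof -
        obtain y where y: "eI i y" "sat (Unp ` y) a" using A a by blast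
        have "{j. v j \<inter> X = y} \<subseteq> {j. sat (Unp ` (v j \<inter> X)) a}" using y(2) by auto
        then show ?thesis
          unfolding GF_restrict[OF form_vars_grk(1)[OF l a]]
          using visited[OF y(1)] finite_subset by blast
      qed
      moreover have "grk_holds \<phi> v" using wins v(1,2) by (simp add: wins_from_def)
      ultimately have "GF g v" using l g unfolding grk_holds_def by blast
      then have "infinite {j. sat (Unp ` (v j \<inter> Y)) g}"
        unfolding GF_restrict[OF form_vars_grk(2)[OF l g]] .
      then obtain j where "j > k" "sat (Unp ` (v j \<inter> Y)) g"
        unfolding infinite_nat_iff_unbounded by blast
      then show "\<exists>out'. eO ?out out' \<and> sat (Unp ` out') g"
        unfolding eO_def using k n by (intro exI[of _ "v j \<inter> Y"]) auto
    qed
    have "good i ?out" unfolding good_def by (auto intro: guarantee)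
    moreover note \<open>tO out ?out\<close> \<open>tO ?out ?out\<close>
    moreover have "?Z i ?out" using v(1,2) n(2) by blast
    ultimately show "\<exists>out'. tO out out' \<and> tO out' out' \<and> good i out' \<and> ?Z i out'" by blast
  qed
qed

end

section \<open>The winning strategy\<close>

context separated_game
begin

lemma eO_trans: "eO a b \<Longrightarrow> eO b c \<Longrightarrow> eO a c" and eO_sym: "eO a b \<Longrightarrow> eO b a"
  and eI_trans: "eI a b \<Longrightarrow> eI b c \<Longrightarrow> eI a c" and eI_sym: "eI a b \<Longrightarrow> eI b a"
  unfolding eO_def eI_def by (auto intro: tranclp_trans)

lemma good_cong: "eI i i' \<Longrightarrow> eO out out' \<Longrightarrow> good i out \<longleftrightarrow> good i' out'"
proof -
  assume e: "eI i i'" "eO out out'"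
  have "eI i a \<longleftrightarrow> eI i' a" "eO out b \<longleftrightarrow> eO out' b" for a b
    using e eI_trans eI_sym eO_trans eO_sym by metis+
  then show ?thesis by (simp add: good_def)
qed

definition "settled i out \<longleftrightarrow> tO out out \<and> good i out \<and> Win i out"

text \<open>Once settled, the output component is never left.\<close>

definition "careful_step i out out' \<longleftrightarrow> rO out out' \<and> (settled i out \<longrightarrow> eO out out')"

abbreviation "guarantees \<equiv> concat (map snd \<phi>)"

text \<open>False for every index behind the list. Such an index is used as a memory value, and its
  targets are then all settled states.\<close>

definition "meets q out \<longleftrightarrow> q < length guarantees \<and> sat (Unp ` out) (guarantees ! q)"

text \<open>A guarantee that the component cannot meet is passed over, since waiting for it would
  block the others. As the state is settled, that guarantee belongs to conjuncts in which some
  assumption fails on the component of the input.\<close>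

definition "target q i out \<longleftrightarrow> settled i out \<and> (meets q out \<or> \<not> (\<exists>out'. eO out out' \<and> meets q out'))"

text \<open>The input is kept fixed in all rounds although it changes during play;
  \<open>attractor_eI\<close> justifies this once the input remains in its component.\<close>

primrec attractor :: "nat \<Rightarrow> nat \<Rightarrow> nat set \<Rightarrow> nat set \<Rightarrow> bool" where
  "attractor q 0 = target q"
| "attractor q (Suc k) = (\<lambda>i out. attractor q k i out \<or> (\<exists>out'. careful_step i out out' \<and> attractor q k i out'))"

text \<open>At a winning state outside the attractor the input lies on no cycle, so it suffices to
  remain winning.\<close>

definition "admissible q i out out' \<longleftrightarrow>
  target q i out \<and> careful_step i out out' \<or>
  (\<exists>k<num_states G. careful_step i out out' \<and> attractor q k i out' \<and> \<not> attractor q k i out) \<or>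
  \<not> attractor q (num_states G) i out \<and> rO out out' \<and> ((\<exists>u. rO out u \<and> Win i u) \<longrightarrow> Win i out')"

lemma admissible_rO: "admissible q i out out' \<Longrightarrow> rO out out'"
  by (auto simp: admissible_def careful_step_def)

lemma attractor_mono: "k \<le> l \<Longrightarrow> attractor q k i out \<Longrightarrow> attractor q l i out"
  by (induction l) (auto simp: le_Suc_eq)

lemma careful_step_settled:
  assumes "tO out out" obtains out' where "careful_step i out out'" "eO out out'"
proof -
  obtain u where u: "rO out u" "rO\<^sup>*\<^sup>* u out" using assms by (meson tranclpD)
  then have "eO out u"
    unfolding eO_def using assms by (meson rtranclp_tranclp_tranclp tranclp.r_into_trancl)
  with u(1) show thesis by (intro that[of u]) (simp_all add: careful_step_def)
qed

text \<open>The least round containing the state decides. Round 0 is the target, which lies on a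
  cycle and so has a step within its component; a later round provides a careful step into the round
  before. Outside the attractor deadlock freedom is enough.\<close>

lemma admissible_total:
  assumes "out \<subseteq> Y" shows "\<exists>out'. admissible q i out out'"
proof (cases "attractor q (num_states G) i out")
  case False
  then show ?thesis using rO_total[OF assms] unfolding admissible_def by blast
next
  case True
  define k where "k = (LEAST k. attractor q k i out)"
  have k: "attractor q k i out" "k \<le> num_states G"
    unfolding k_def using True by (auto intro: LeastI Least_le)
  show ?thesis
  proof (cases k)
    case 0
    then have "target q i out" using k by simp
    moreover from this have "tO out out" by (simp add: target_def settled_def)
    then obtain out' where "careful_step i out out'" by (rule careful_step_settled)
    ultimately show ?thesis unfolding admissible_def by blast
  next
    case (Suc l)
    then have "\<not> attractor q l i out" unfolding k_def by (metis lessI not_less_Least)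
    moreover from this obtain out' where "careful_step i out out'" "attractor q l i out'"
      using k(1) Suc by auto
    ultimately show ?thesis using Suc k(2) unfolding admissible_def by (metis Suc_le_lessD)
  qed
qed

lemma attractor_reaches_settled: "attractor q k i out \<Longrightarrow> \<exists>u. rO\<^sup>*\<^sup>* out u \<and> settled i u"
proof (induction k arbitrary: out)
  case 0
  then show ?case by (auto simp: target_def)
next
  case (Suc k)
  then show ?case by (auto simp: careful_step_def intro: converse_rtranclp_into_rtranclp)
qed

text \<open>The way back from \<open>out'\<close> to \<open>out\<close> lets
  \<open>Win_mono_out\<close> transfer the win, and \<open>good\<close> is constant on
  components.\<close>

lemma settled_eO:
  assumes "settled i out" "eO out out'" "i \<subseteq> X" "eI i i"
  shows "settled i out'"
proof -
  have "rO\<^sup>*\<^sup>* out' out" "tO out' out'" "out \<subseteq> Y"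
    using assms(2) tO_sub[of out out'] by (auto simp: eO_def intro: tranclp_trans)
  then show ?thesis
    using assms good_cong[of i i out out'] Win_mono_out[of out' out i] by (simp add: settled_def)
qed

lemma settled_eI:
  assumes "eI i i'" shows "settled i out \<longleftrightarrow> settled i' out"
proof -
  have *: "settled j' out" if "eI j j'" "settled j out" for j j'
  proof -
    have "tI j j'" "tO out out" using that by (auto simp: eI_def settled_def)
    then show ?thesis
      using that good_cong[of j j' out out] Win_mono_in[of j j' out] tI_sub[of j j'] tO_sub[of out out]
      by (simp add: settled_def eO_def tranclp_into_rtranclp)
  qed
  show ?thesis using *[OF assms] *[OF eI_sym[OF assms]] by blast
qed

lemma target_eI: "eI i i' \<Longrightarrow> target q i = target q i'"
  and careful_step_eI: "eI i i' \<Longrightarrow> careful_step i = careful_step i'"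
  unfolding target_def careful_step_def using settled_eI by (simp_all add: fun_eq_iff)

text \<open>All ingredients see the input only through its component, so distances measured for one
  input stay valid while the environment moves within that component.\<close>

lemma attractor_eI: "eI i i' \<Longrightarrow> attractor q k i = attractor q k i'"
  by (induction k) (auto simp: target_eI careful_step_eI)

lemma attractor_sub: "attractor q k i out \<Longrightarrow> out \<subseteq> Y"
  by (induction k) (use tO_sub rO_sub in \<open>auto simp: target_def settled_def careful_step_def\<close>)

text \<open>Round \<open>Suc k\<close> is determined by round \<open>k\<close>, so growth ends
  within \<open>N\<close> rounds and the program can run a fixed number of them.\<close>

lemma attractor_stable:
  assumes "attractor q k i out" "i \<subseteq> X" shows "attractor q (num_states G) i out"
proof -
  let ?S = "\<lambda>k. {(i, out). i \<subseteq> X \<and> attractor q k i out}"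
  have cong: "?S (Suc k) = ?S (Suc l)" if "?S k = ?S l" for k l
  proof -
    have "i \<subseteq> X \<Longrightarrow> attractor q k i u \<longleftrightarrow> attractor q l i u" for i u using that by blast
    then show ?thesis by auto
  qed
  have "?S (Suc (card (Pow X \<times> Pow Y))) = ?S (card (Pow X \<times> Pow Y))"
  proof (rule incseq_sets_stable)
    show "?S k \<subseteq> Pow X \<times> Pow Y" for k using attractor_sub[of q k] by blast
    show "?S k \<subseteq> ?S (Suc k)" for k by auto
    show "?S (Suc (Suc k)) = ?S (Suc k)" if "?S (Suc k) = ?S k" for k
      by (rule cong) (rule that)
  qed (use finite_vars in simp)
  then have N: "?S (Suc (num_states G)) = ?S (num_states G)" by (simp add: num_states_eq)
  have "?S (num_states G + l) = ?S (num_states G)" for l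
  proof (induction l)
    case (Suc l)
    have "?S (Suc (num_states G + l)) = ?S (Suc (num_states G))"
      by (rule cong) (rule Suc)
    then show ?case using N by (simp only: add_Suc_right)
  qed simp
  moreover have "attractor q (num_states G + k) i out"
    using assms(1) by (rule attractor_mono[rotated]) simp
  ultimately show ?thesis using assms(2) by blast
qed

text \<open>A path to a state of the same component runs inside this component, so all its states
  are settled and all its steps are careful.\<close>

lemma settled_attr:
  assumes "settled i out" "i \<subseteq> X" "eI i i"
  shows "\<exists>k. attractor q k i out"
proof (cases "\<exists>u. eO out u \<and> meets q u")
  case False
  then have "target q i out" using assms by (simp add: target_def)
  then show ?thesis by (metis attractor.simps(1))
next
  case True
  then obtain u where u: "eO out u" "meets q u" by blast
  then have "rO\<^sup>*\<^sup>* out u" by (simp add: eO_def tranclp_into_rtranclp)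
  then show ?thesis
    using u(1) assms(1)
  proof (induction rule: converse_rtranclp_induct)
    case base
    then have "target q i u" using u(2) by (simp add: target_def)
    then show ?case by (metis attractor.simps(1))
  next
    case (step a b)
    have "tO a b" using step.hyps by blast
    moreover have "tO b a"
      using step.hyps(2) step.prems(1) unfolding eO_def by (meson rtranclp_tranclp_tranclp)
    ultimately have ab: "eO a b" by (simp add: eO_def)
    then obtain k where "attractor q k i b"
      using step.IH settled_eO[OF step.prems(2) ab assms(2,3)]
        eO_trans[OF eO_sym[OF ab] step.prems(1)] by blast
    moreover have "careful_step i a b" using ab step.hyps(1) by (simp add: careful_step_def)
    ultimately have "attractor q (Suc k) i a" by auto
    then show ?case ..
  qed
qed

text \<open>The second conjunct of \<open>win_step\<close> provides a path to a settled state. It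
  may run through an earlier settled state, whose component \<open>careful_step\<close> does not
  allow to leave; from there \<open>settled_attr\<close> takes over.\<close>

lemma Win_attr:
  assumes "Win i out" "out \<subseteq> Y" "eI i i"
  shows "attractor q (num_states G) i out"
proof -
  have i: "i \<subseteq> X" "tI i i" using assms(3) tI_sub by (auto simp: eI_def)
  then obtain u where u: "tO out u" "settled i u"
    using assms Win_step[of i out] unfolding win_step_def settled_def by blast
  have "rO\<^sup>*\<^sup>* out u" using u(1) by (rule tranclp_into_rtranclp)
  then have "\<exists>k. attractor q k i out"
  proof (induction rule: converse_rtranclp_induct)
    case base
    show ?case using settled_attr[OF u(2) i(1) assms(3)] .
  next
    case (step a b)
    show ?case
    proof (cases "settled i a")
      case True
      then show ?thesis using settled_attr i(1) assms(3) by blast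
    next
      case False
      then have "careful_step i a b" using step.hyps by (simp add: careful_step_def)
      moreover obtain k where "attractor q k i b" using step.IH by blast
      ultimately have "attractor q (Suc k) i a" by auto
      then show ?thesis ..
    qed
  qed
  then show ?thesis using attractor_stable i(1) by blast
qed

text \<open>A target move can be undone and an attractor move leads on to a settled state, so
  \<open>Win_mono_out\<close> applies to both. In the remaining case a winning answer to
  \<open>i'\<close> exists, and then the move has to be one.\<close>

lemma Win_admissible:
  assumes "Win i out" "rI i i'" "admissible q i' out out'"
  shows "Win i' out'"
proof -
  have sub: "i \<subseteq> X" "i' \<subseteq> X" "out \<subseteq> Y" "out' \<subseteq> Y"
    using rI_sub[OF assms(2)] rO_sub[OF admissible_rO[OF assms(3)]] by auto
  from assms(3) consider
    "target q i' out" "careful_step i' out out'"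
    | k where "attractor q k i' out'"
    | "(\<exists>u. rO out u \<and> Win i' u) \<longrightarrow> Win i' out'"
    unfolding admissible_def by blast
  then show ?thesis
  proof cases
    case 1
    then have "rO\<^sup>*\<^sup>* out' out" "Win i' out"
      by (auto simp: target_def careful_step_def settled_def eO_def)
    then show ?thesis using Win_mono_out sub by blast
  next
    case 2
    then obtain u where "rO\<^sup>*\<^sup>* out' u" "settled i' u" using attractor_reaches_settled by blast
    moreover from this have "Win i' u" "u \<subseteq> Y" using tO_sub by (auto simp: settled_def)
    ultimately show ?thesis using Win_mono_out sub(2) by blast
  next
    case 3
    then show ?thesis
      using assms(1,2) Win_step[OF sub(1,3)] unfolding win_step_def by blast
  qed
qed

text \<open>From some time on the input stays in one component, so all attractors may be taken at
  the fixed input \<open>?i\<close>. Ranks then fall until each target is hit in turn. After one hit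
  the output component is frozen and good against that of \<open>?i\<close>; a guarantee it owes is
  available there, so the targets of this guarantee meet it.\<close>

lemma play_wins:
  assumes x: "\<And>n. rI (x n) (x (Suc n))"
    and y: "\<And>n. admissible (q n) (x (Suc n)) (y n) (y (Suc n))"
    and q: "q 0 = 0" "\<And>n. q (Suc n) = (if target (q n) (x (Suc n)) (y n)
      then Suc (q n) mod Suc (length guarantees) else q n)"
    and Win0: "Win (x 0) (y 0)"
    and l: "(as, gs) \<in> set \<phi>" and as: "\<And>a. a \<in> set as \<Longrightarrow> infinite {n. sat (Unp ` x n) a}"
    and g: "g \<in> set gs"
  shows "infinite {n. sat (Unp ` y n) g}"
proof -
  let ?K = "Suc (length guarantees)"
  have sub: "x n \<subseteq> X" "y n \<subseteq> Y" for n
    using rI_sub[OF x] rO_sub[OF admissible_rO[OF y]] by blast+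
  have qK: "q n < ?K" for n
    by (induction n) (use q in auto)
  have Win: "Win (x n) (y n)" for n
  proof (induction n)
    case (Suc n)
    show ?case by (rule Win_admissible[OF Suc x y])
  qed (rule Win0)
  have "finite (range x)"
    by (rule finite_subset[of _ "Pow X"]) (use finite_vars(1) sub(1) in auto)
  from eventually_recurrent[OF this, of rI, OF x]
  obtain k where k: "\<And>m n. m \<ge> k \<Longrightarrow> n \<ge> k \<Longrightarrow> tI (x m) (x n)" by blast
  let ?i = "x k"
  have e: "eI (x n) ?i" if "n \<ge> k" for n using k that by (simp add: eI_def)
  have ii: "eI ?i ?i" using e by simp
  have Win_i: "Win ?i (y n)" if "n \<ge> k" for n
    using Win_mono_in[OF _ sub(1) sub(2) Win] e[OF that] by (simp add: eI_def tranclp_into_rtranclp)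
  have attrN: "attractor (q n) (num_states G) ?i (y n)" if "n \<ge> k" for n
    by (rule Win_attr[OF Win_i[OF that] sub(2) ii])
  \<comment> \<open>\<open>attrN\<close> rules out the last alternative of
    \<open>admissible\<close>.\<close>
  have move: "careful_step ?i (y n) (y (Suc n)) \<and> (target (q n) ?i (y n) \<or>
      (\<exists>l. attractor (q n) l ?i (y (Suc n)) \<and> \<not> attractor (q n) l ?i (y n)))" if "n \<ge> k" for n
  proof -
    have *: "eI (x (Suc n)) ?i" using e that by simp
    show ?thesis
      using y[of n] attrN[OF that]
      unfolding admissible_def attractor_eI[OF *] target_eI[OF *] careful_step_eI[OF *] by blast
  qed
  define rank where "rank n = (LEAST l. attractor (q n) l ?i (y n))" for n
  have hits: "infinite {n. q n = p \<and> target (q n) ?i (y n)}" if "p < ?K" for p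
  proof (rule round_robin[where rank = rank and ?n0.0 = k])
    fix n assume n: "n \<ge> k"
    have *: "eI (x (Suc n)) ?i" using e n by simp
    show "q (Suc n) = Suc (q n) mod ?K" if "target (q n) ?i (y n)"
      using that q(2)[of n] by (simp add: target_eI[OF *])
    show "q (Suc n) = q n \<and> rank (Suc n) < rank n" if nt: "\<not> target (q n) ?i (y n)"
    proof
      show "q (Suc n) = q n" using nt q(2)[of n] by (simp add: target_eI[OF *])
      obtain l where l: "attractor (q n) l ?i (y (Suc n))" "\<not> attractor (q n) l ?i (y n)"
        using move[OF n] nt by blast
      have "rank (Suc n) \<le> l"
        unfolding rank_def \<open>q (Suc n) = q n\<close> by (rule Least_le) (rule l(1))
      moreover have "attractor (q n) (rank n) ?i (y n)"
        unfolding rank_def by (rule LeastI) (rule attrN[OF n])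
      then have "l < rank n" using l(2) attractor_mono[of "rank n" l] by (metis not_less)
      ultimately show "rank (Suc n) < rank n" by simp
    qed
  qed (use qK that in auto)
  obtain n1 where n1: "n1 > k" "settled ?i (y n1)"
    using hits[of 0] unfolding infinite_nat_iff_unbounded target_def by blast
  have stay: "settled ?i (y n) \<and> eO (y n1) (y n)" if "n \<ge> n1" for n
    using that
  proof (induction n rule: dec_induct)
    case base
    then show ?case using n1 by (simp add: settled_def eO_def)
  next
    case (step n)
    then have "eO (y n) (y (Suc n))" using move[of n] n1(1) by (simp add: careful_step_def)
    then show ?case using step.IH settled_eO[OF _ _ sub(1) ii] eO_trans by blast
  qed
  have "\<exists>i'. eI ?i i' \<and> sat (Unp ` i') a" if a: "a \<in> set as" for a
  proof -
    obtain n where "n > k" "sat (Unp ` x n) a"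
      using as[OF a] unfolding infinite_nat_iff_unbounded by blast
    then show ?thesis using eI_sym[OF e[of n]] by auto
  qed
  moreover have "good ?i (y n1)" using n1 by (simp add: settled_def)
  ultimately obtain u where u: "eO (y n1) u" "sat (Unp ` u) g"
    using l g unfolding good_def by blast
  have "g \<in> set guarantees" using l g by force
  then obtain p where p: "p < length guarantees" "guarantees ! p = g"
    by (metis in_set_conv_nth)
  show ?thesis
    unfolding infinite_nat_iff_unbounded
  proof
    fix m
    obtain n where n: "n > max m n1" "q n = p" "target p ?i (y n)"
      using hits[of p] p(1) unfolding infinite_nat_iff_unbounded by (metis (mono_tags, lifting) less_SucI mem_Collect_eq)
    then have "eO (y n) u" using stay[of n] u(1) eO_sym eO_trans by (metis max_less_iff_conj less_imp_le)
    then have "meets p (y n)" using n(3) u(2) p unfolding target_def meets_def by blast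
    then show "\<exists>n>m. n \<in> {n. sat (Unp ` y n) g}"
      using n(1) p(2) by (auto simp: meets_def)
  qed
qed

end

section \<open>Memory updates and correctness of the symbolic strategy\<close>

lemma mem_run_snoc: "mem_run S q (h @ [s, t]) = mem_step S (mem_run S q (h @ [s])) s t"
proof (induction h arbitrary: q)
  case (Cons a h)
  then show ?case by (cases h) auto
qed simp

context separated_game
begin

text \<open>Common form for all BDDs of the algorithm: on it, symbolic operations become connectives
  and bounded quantifiers over the four state components.\<close>

definition game_bdd :: "(nat set \<Rightarrow> nat set \<Rightarrow> nat set \<Rightarrow> nat set \<Rightarrow> bool) \<Rightarrow> bdd" where
  "game_bdd Q = {\<sigma>. Q (unp_part X \<sigma>) (unp_part Y \<sigma>) (pri_part X \<sigma>) (pri_part Y \<sigma>)}"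

lemma step_val_game_bdd: "step_val s t \<in> game_bdd Q \<longleftrightarrow> Q (s \<inter> X) (s \<inter> Y) (t \<inter> X) (t \<inter> Y)"
proof -
  have "unp_part V (step_val s t) = s \<inter> V" "pri_part V (step_val s t) = t \<inter> V" for V
    by (auto simp: step_val_def unp_part_def pri_part_def)
  then show ?thesis by (simp add: game_bdd_def)
qed

text \<open>Stated for any selection \<open>pick\<close> of admissible moves because it is used
  twice: with a choice function, to show that winning initial states suffice for realizability, and
  with the selection computed by the program. Moves and edges depend on the old output and the new
  input.\<close>

lemma strategy_wins:
  fixes S :: sym_strategy
  defines "K \<equiv> Suc (length guarantees)"
  assumes pick: "\<And>q i out. i \<subseteq> X \<Longrightarrow> out \<subseteq> Y \<Longrightarrow> admissible q i out (pick q i out)"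
    and size: "mem_size S = K" and init: "mem_init S = 0"
    and move: "\<And>q. q < K \<Longrightarrow> move S q = game_bdd (\<lambda>_ out i' out'. out' = pick q i' out)"
    and edges: "edges S = map (\<lambda>e. (e, game_bdd (\<lambda>_ out i' _. target e i' out), Suc e mod K)) [0..<K]"
    and Win: "\<forall>i \<subseteq> X. sat (Unp ` i) (init_in G) \<longrightarrow>
      (\<exists>out \<subseteq> Y. sat (Unp ` out) (init_out G) \<and> Win i out)"
  shows "\<exists>f. winning_strategy G \<phi> f \<and> represents G S f"
proof -
  \<comment> \<open>One edge leaves each memory value, so the first match is the only one.\<close>
  have mem_step: "mem_step S q s t = (if target q (t \<inter> X) (s \<inter> Y) then Suc q mod K else q)"
    if "q < K" for q s t
  proof -
    let ?P = "\<lambda>(p, C, r::nat). p = q \<and> step_val s t \<in> C"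
    have P: "?P (e, game_bdd (\<lambda>_ out i' _. target e i' out), Suc e mod K) \<longleftrightarrow>
        e = q \<and> target q (t \<inter> X) (s \<inter> Y)" for e
      by (auto simp: step_val_game_bdd)
    show ?thesis
    proof (cases "find ?P (edges S)")
      case None
      then have "\<not> target q (t \<inter> X) (s \<inter> Y)"
        using that P unfolding find_None_iff edges by force
      then show ?thesis using None by (simp add: mem_step_def)
    next
      case (Some x)
      then obtain e where "x = (e, game_bdd (\<lambda>_ out i' _. target e i' out), Suc e mod K)" "?P x"
        unfolding find_Some_iff edges by auto
      then show ?thesis using Some P[of e] by (auto simp: mem_step_def)
    qed
  qed
  define m where "m h = mem_run S 0 h" for h
  have m_K: "m h < K" for h
  proof (induction h rule: rev_induct)
    case Nil
    show ?case by (simp add: m_def K_def)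
  next
    case (snoc t h)
    show ?case
    proof (cases h rule: rev_cases)
      case Nil
      then show ?thesis by (simp add: m_def K_def)
    next
      case (snoc h' s)
      then show ?thesis
        using \<open>m h < K\<close> mem_step unfolding m_def by (simp add: mem_run_snoc K_def)
    qed
  qed
  define f where "f h i = pick (m h) i (last h \<inter> Y)" for h i
  have f_rel: "admissible (m h) i (last h \<inter> Y) (f h i)" if "i \<subseteq> X" for h i
    unfolding f_def using that by (intro pick) auto
  have strategy: "is_strategy G f"
    unfolding is_strategy_def
  proof (intro conjI allI impI)
    fix h i assume "history G h" "i \<subseteq> X"
    then show "f h i \<subseteq> Y" using f_rel[of i h] admissible_rO rO_sub by blast
  next
    fix s0 w n i assume "play G s0 w" and i: "i \<subseteq> X"
    let ?o = "f (map w [0..<Suc n]) i"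
    have r: "rO (w n \<inter> Y) ?o"
      using admissible_rO[OF f_rel[OF i, of "map w [0..<Suc n]"]] by simp
    then have "(i \<union> ?o) \<inter> Y = ?o" using i rO_sub[OF r] by simp
    then show "sat (step_val (w n) (i \<union> ?o)) (trans_out G)"
      using r sat_trans_out[of "w n" "i \<union> ?o"] by (simp add: rO_def del: upt_Suc)
  qed
  have wins: "wins_from G \<phi> f s" if "Win (s \<inter> X) (s \<inter> Y)" for s
    unfolding wins_from_def
  proof (intro allI impI)
    fix w assume w: "play G s w" "consistent G f w"
    define x where "x n = w n \<inter> X" for n
    define y where "y n = w n \<inter> Y" for n
    define q where "q n = m (map w [0..<Suc n])" for n
    have x: "rI (x n) (x (Suc n))" for n using w(1) by (simp add: play_iff x_def)
    have y: "admissible (q n) (x (Suc n)) (y n) (y (Suc n))" for n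
    proof -
      have "y (Suc n) = f (map w [0..<Suc n]) (x (Suc n))"
        using w(2) unfolding consistent_def x_def y_def by blast
      then show ?thesis using f_rel[of "x (Suc n)" "map w [0..<Suc n]"] by (simp add: q_def y_def x_def)
    qed
    have "map w [0..<Suc (Suc n)] = map w [0..<n] @ [w n, w (Suc n)]"
      and "map w [0..<Suc n] = map w [0..<n] @ [w n]" for n by simp_all
    then have q: "q (Suc n) = (if target (q n) (x (Suc n)) (y n) then Suc (q n) mod K else q n)" for n
      using m_K[of "map w [0..<Suc n]"] unfolding q_def m_def x_def y_def
      by (simp only: mem_run_snoc mem_step)
    have W: "Win (x 0) (y 0)" "q 0 = 0"
      using that w(1) by (simp_all add: x_def y_def q_def m_def play_def)
    have "GF g w" if l: "(as, gs) \<in> set \<phi>" and a: "\<forall>a \<in> set as. GF a w" and g: "g \<in> set gs" for as gs g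
    proof -
      have "infinite {n. sat (Unp ` x n) a}" if "a \<in> set as" for a
        using bspec[OF a that] unfolding x_def GF_restrict[OF form_vars_grk(1)[OF l that]] .
      then have "infinite {n. sat (Unp ` y n) g}"
        using play_wins[OF x y W(2) _ W(1) l _ g] q unfolding K_def by blast
      then show ?thesis unfolding y_def by (simp add: GF_restrict[OF form_vars_grk(2)[OF l g]])
    qed
    then show "grk_holds \<phi> w" unfolding grk_holds_def by blast
  qed
  have "winning_strategy G \<phi> f"
    unfolding winning_strategy_def
  proof (intro conjI allI impI strategy)
    fix i assume i: "i \<subseteq> X" "sat (Unp ` i) (init_in G)"
    then obtain out where out: "out \<subseteq> Y" "sat (Unp ` out) (init_out G)" "Win i out"
      using Win by blast
    moreover have "sat (Unp ` (i \<union> out)) (init_out G)"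
      using out i(1) sat_restrict[OF form_vars_game(2), of "i \<union> out"] by simp
    moreover have "wins_from G \<phi> f (i \<union> out)"
      using out i(1) by (intro wins) simp
    ultimately show "\<exists>out\<subseteq>Y. sat (Unp ` (i \<union> out)) (init_out G) \<and> wins_from G \<phi> f (i \<union> out)"
      by blast
  qed
  moreover have "represents G S f"
    unfolding represents_def
  proof (intro conjI allI impI)
    show "wf_sym_strategy S"
      unfolding wf_sym_strategy_def size init edges by (auto simp: K_def)
    fix h i out assume "history G h" "i \<subseteq> X" "out \<subseteq> Y"
    then show "step_val (last h) (i \<union> out) \<in> move S (mem_run S (mem_init S) h) \<longleftrightarrow> f h i = out"
      using move[OF m_K[of h]] unfolding init m_def[symmetric]
      by (auto simp: step_val_game_bdd f_def)
  qed
  ultimately show ?thesis by blast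
qed

lemma realizable_iff:
  "realizable G \<phi> \<longleftrightarrow> (\<forall>i \<subseteq> X. sat (Unp ` i) (init_in G) \<longrightarrow>
      (\<exists>out \<subseteq> Y. sat (Unp ` out) (init_out G) \<and> Win i out))" (is "_ \<longleftrightarrow> ?W")
proof
  assume "realizable G \<phi>"
  then obtain f where f: "winning_strategy G \<phi> f" unfolding realizable_def ..
  show ?W
  proof (intro allI impI)
    fix i assume i: "i \<subseteq> X" "sat (Unp ` i) (init_in G)"
    then obtain out where out: "out \<subseteq> Y" "sat (Unp ` (i \<union> out)) (init_out G)"
      "wins_from G \<phi> f (i \<union> out)"
      using f unfolding winning_strategy_def by blast
    have "sat (Unp ` out) (init_out G)"
      using out i(1) sat_restrict[OF form_vars_game(2), of "i \<union> out"] by simp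
    moreover have "Win i out"
      using Win_necessary[of f "i \<union> out"] f out i(1) by (auto simp: winning_strategy_def)
    ultimately show "\<exists>out \<subseteq> Y. sat (Unp ` out) (init_out G) \<and> Win i out" using out(1) by blast
  qed
next
  assume ?W
  define pick where "pick q i out = (SOME out'. admissible q i out out')" for q i out
  have "admissible q i out (pick q i out)" if "out \<subseteq> Y" for q i out
    unfolding pick_def using admissible_total[OF that] by (rule someI_ex)
  then show "realizable G \<phi>"
    using strategy_wins[of pick "\<lparr>mem_size = Suc (length guarantees), mem_init = 0,
        move = \<lambda>q. game_bdd (\<lambda>_ out i' out'. out' = pick q i' out),
        edges = map (\<lambda>e. (e, game_bdd (\<lambda>_ out i' _. target e i' out), Suc e mod Suc (length guarantees)))
          [0..<Suc (length guarantees)]\<rparr>"] \<open>?W\<close>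
    unfolding realizable_def by auto
qed

end

section \<open>Symbolic computation of the winning region\<close>

text \<open>Needed because the input stores the assumptions of all conjuncts in one flat array, and
  likewise the guarantees.\<close>

lemma concat_nth_prefix:
  "l < length xss \<Longrightarrow> j < length (xss ! l) \<Longrightarrow>
    sum_list (map length (take l xss)) + j < length (concat xss) \<and>
    concat xss ! (sum_list (map length (take l xss)) + j) = xss ! l ! j"
proof (induction xss arbitrary: l)
  case (Cons xs xss)
  then show ?case by (cases l) (auto simp: nth_append add.assoc)
qed simp

context separated_game
begin

section \<open>Symbolic operations on game BDDs\<close>

lemma game_bdd_bool:
  "game_bdd P \<inter> game_bdd Q = game_bdd (\<lambda>i out i' out'. P i out i' out' \<and> Q i out i' out')"
  "game_bdd P \<union> game_bdd Q = game_bdd (\<lambda>i out i' out'. P i out i' out' \<or> Q i out i' out')"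
  "- game_bdd P = game_bdd (\<lambda>i out i' out'. \<not> P i out i' out')"
  by (auto simp: game_bdd_def)

lemma game_bdd_ex:
  "bdd_ex (Unp ` X) (game_bdd Q) = game_bdd (\<lambda>_ out i' out'. \<exists>i \<subseteq> X. Q i out i' out')"
  "bdd_ex (Unp ` Y) (game_bdd Q) = game_bdd (\<lambda>i _ i' out'. \<exists>out \<subseteq> Y. Q i out i' out')"
  "bdd_ex (Pri ` X) (game_bdd Q) = game_bdd (\<lambda>i out _ out'. \<exists>i' \<subseteq> X. Q i out i' out')"
  "bdd_ex (Pri ` Y) (game_bdd Q) = game_bdd (\<lambda>i out i' _. \<exists>out' \<subseteq> Y. Q i out i' out')"
  using disjoint_vars disjoint_vars[THEN trans[OF Int_commute]]
  by (intro set_eqI; simp add: game_bdd_def bdd_ex_unp bdd_ex_pri part_update cong: conj_cong)+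

lemma game_bdd_all:
  "bdd_all (Unp ` X) (game_bdd Q) = game_bdd (\<lambda>_ out i' out'. \<forall>i \<subseteq> X. Q i out i' out')"
  "bdd_all (Pri ` X) (game_bdd Q) = game_bdd (\<lambda>i out _ out'. \<forall>i' \<subseteq> X. Q i out i' out')"
  by (simp_all add: bdd_all_ex game_bdd_bool game_bdd_ex)

lemma game_bdd_rename:
  "bdd_rename X (game_bdd Q) = game_bdd (\<lambda>i out i' out'. Q i' out i out')"
  "bdd_rename Y (game_bdd Q) = game_bdd (\<lambda>i out i' out'. Q i out' i' out)"
  using disjoint_vars disjoint_vars[THEN trans[OF Int_commute]]
  by (intro set_eqI; simp add: game_bdd_def bdd_rename_def part_swap)+

lemma game_bdd_const: "UNIV = game_bdd (\<lambda>_ _ _ _. True)" "{} = game_bdd (\<lambda>_ _ _ _. False)"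
  by (simp_all add: game_bdd_def)

lemma game_bdd_rel: "rel_bdd X R = game_bdd (\<lambda>i _ i' _. R i i')" "rel_bdd Y R = game_bdd (\<lambda>_ out _ out'. R out out')"
  by (simp_all add: game_bdd_def rel_bdd_def)

lemma game_bdd_cong:
  "(\<And>i out i' out'. i \<subseteq> X \<Longrightarrow> out \<subseteq> Y \<Longrightarrow> i' \<subseteq> X \<Longrightarrow> out' \<subseteq> Y \<Longrightarrow> P i out i' out' \<longleftrightarrow> Q i out i' out') \<Longrightarrow>
    game_bdd P = game_bdd Q"
  by (simp add: game_bdd_def)

lemma game_bdd_closed: "game_bdd (\<lambda>_ _ _ _. P) = UNIV \<longleftrightarrow> P"
  by (simp add: game_bdd_def)

lemma rel_bdd_trans:
  "bdd_of (trans_in G) = rel_bdd X rI" "bdd_of (trans_out G) = rel_bdd Y rO"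
proof -
  have *: "sat \<sigma> p \<longleftrightarrow> sat (step_val (unp_part V \<sigma>) (pri_part V \<sigma>)) p"
    if p: "form_vars p \<subseteq> Unp ` V \<union> Pri ` V" for p V \<sigma>
  proof (rule sat_cong)
    fix x assume "x \<in> form_vars p"
    then obtain v where "v \<in> V" "x = Unp v \<or> x = Pri v" using p by blast
    then show "x \<in> \<sigma> \<longleftrightarrow> x \<in> step_val (unp_part V \<sigma>) (pri_part V \<sigma>)"
      by (auto simp: step_val_def unp_part_def pri_part_def)
  qed
  show "bdd_of (trans_in G) = rel_bdd X rI" "bdd_of (trans_out G) = rel_bdd Y rO"
    using *[OF form_vars_game(3)] *[OF form_vars_game(4)]
    by (simp_all add: bdd_of_def rel_bdd_def rI_def rO_def)
qed

lemma rel_bdd_state: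
  assumes "form_vars p \<subseteq> Unp ` V" shows "bdd_of p = rel_bdd V (\<lambda>x _. sat (Unp ` x) p)"
proof -
  have "sat \<sigma> p \<longleftrightarrow> sat (Unp ` unp_part V \<sigma>) p" for \<sigma>
  proof (rule sat_cong)
    fix x assume "x \<in> form_vars p"
    then obtain v where "v \<in> V" "x = Unp v" using assms by blast
    then show "x \<in> \<sigma> \<longleftrightarrow> x \<in> Unp ` unp_part V \<sigma>" by (auto simp: unp_part_def)
  qed
  then show ?thesis by (simp add: bdd_of_def rel_bdd_def)
qed

section \<open>Contents of the input arrays\<close>

definition inp :: "store \<Rightarrow> bool" where
  "inp st \<longleftrightarrow> (\<forall>a<5. nums st a = nums (input_store G \<phi>) a \<and> bdds st a = bdds (input_store G \<phi>) a)"

lemma inp_frame: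
  assumes "inp s" "frame A B s t" "\<forall>p \<in> A \<union> B. fst p \<ge> 5"
  shows "inp t"
  unfolding inp_def
proof (intro allI impI conjI ext)
  fix a j :: nat assume "a < 5"
  then have "(a, j) \<notin> A" "(a, j) \<notin> B" using assms(3) by force+
  then show "nums t a j = nums (input_store G \<phi>) a j" "bdds t a j = bdds (input_store G \<phi>) a j"
    using assms(1) \<open>a < 5\<close> frame_nums[OF assms(2)] frame_bdds[OF assms(2)] by (simp_all add: inp_def)
qed

lemma inp_input: "inp (input_store G \<phi>)"
  by (simp add: inp_def)

abbreviation "in_list \<equiv> sorted_list_of_set X"
abbreviation "out_list \<equiv> sorted_list_of_set Y"

lemma inp_nums:
  assumes "inp st"
  shows "nums st 0 0 = length in_list" "nums st 0 (Suc 0) = length out_list" "nums st 0 2 = length \<phi>"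
    "l < length \<phi> \<Longrightarrow> nums st 3 l = length (fst (\<phi> ! l))"
    "l < length \<phi> \<Longrightarrow> nums st 4 l = length (snd (\<phi> ! l))"
  using assms
  by (simp_all add: inp_def input_store_def Let_def table_def split_beta numeral_eq_Suc)

lemma inp_slice:
  assumes "inp st"
  shows "nums st (Suc 0) ` {..<nums st 0 0} = X" "nums st (Suc (Suc 0)) ` {..<nums st 0 (Suc 0)} = Y"
    "slice_val (vars_slice 0) st = X" "slice_val (vars_slice 1) st = Y"
proof -
  have "(\<lambda>j. table d xss a j) ` {..<length (xss ! a)} = set (xss ! a)" if "a < length xss"
    for d :: nat and xss :: "nat list list" and a
    using that by (auto simp: table_def in_set_conv_nth)
  note * = this[of "Suc 0" _ 0] this[of "Suc (Suc 0)" _ 0]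
  show "nums st (Suc 0) ` {..<nums st 0 0} = X" "nums st (Suc (Suc 0)) ` {..<nums st 0 (Suc 0)} = Y"
    using assms inp_nums[OF assms] finite_vars
      *[of "[[length in_list, length out_list, length \<phi>], in_list, out_list,
          map (\<lambda>(as, gs). length as) \<phi>, map (\<lambda>(as, gs). length gs) \<phi>]"]
    by (simp_all add: inp_def input_store_def Let_def)
  then show "slice_val (vars_slice 0) st = X" "slice_val (vars_slice 1) st = Y"
    by (simp_all add: vars_slice_def)
qed

lemma inp_bdds:
  assumes "inp st"
  shows "bdds st 0 0 = rel_bdd X (\<lambda>x _. sat (Unp ` x) (init_in G))"
    "bdds st 0 (Suc 0) = rel_bdd Y (\<lambda>x _. sat (Unp ` x) (init_out G))"
    "bdds st 0 2 = rel_bdd X rI" "bdds st 0 3 = rel_bdd Y rO"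
    "j < length (concat (map fst \<phi>)) \<Longrightarrow>
      bdds st 1 j = rel_bdd X (\<lambda>x _. sat (Unp ` x) (concat (map fst \<phi>) ! j))"
    "bdds st 2 j = rel_bdd Y (\<lambda>x _. meets j x)"
    "j < length in_list \<Longrightarrow> bdds st 3 j = bdd_of (Atom (Unp (in_list ! j)))"
    "j < length out_list \<Longrightarrow> bdds st 4 j = bdd_of (Atom (Unp (out_list ! j)))"
proof -
  have st: "bdds st a j = bdds (input_store G \<phi>) a j" if "a < 5" for a j
    using assms that by (simp add: inp_def)
  note simps = st input_store_def Let_def table_def numeral_eq_Suc
  show "bdds st 0 0 = rel_bdd X (\<lambda>x _. sat (Unp ` x) (init_in G))"
    "bdds st 0 (Suc 0) = rel_bdd Y (\<lambda>x _. sat (Unp ` x) (init_out G))"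
    "bdds st 0 2 = rel_bdd X rI" "bdds st 0 3 = rel_bdd Y rO"
    using form_vars_game by (simp_all add: simps rel_bdd_trans rel_bdd_state)
  show "bdds st 1 j = rel_bdd X (\<lambda>x _. sat (Unp ` x) (concat (map fst \<phi>) ! j))"
    if "j < length (concat (map fst \<phi>))"
  proof -
    have "concat (map fst \<phi>) ! j \<in> set (concat (map fst \<phi>))" using that by (rule nth_mem)
    then have "form_vars (concat (map fst \<phi>) ! j) \<subseteq> Unp ` X" by (auto dest: form_vars_grk)
    then show ?thesis using that by (simp add: simps flip: rel_bdd_state)
  qed
  show "bdds st 2 j = rel_bdd Y (\<lambda>x _. meets j x)"
  proof (cases "j < length guarantees")
    case True
    then have "guarantees ! j \<in> set guarantees" by (rule nth_mem)
    then have "form_vars (guarantees ! j) \<subseteq> Unp ` Y" by (auto dest: form_vars_grk)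
    then show ?thesis using True by (simp add: simps meets_def flip: rel_bdd_state)
  next
    case False
    then show ?thesis by (simp add: simps meets_def rel_bdd_def)
  qed
  show "j < length in_list \<Longrightarrow> bdds st 3 j = bdd_of (Atom (Unp (in_list ! j)))"
    "j < length out_list \<Longrightarrow> bdds st 4 j = bdd_of (Atom (Unp (out_list ! j)))"
    by (simp_all add: simps)
qed

end

text \<open>Array 10 is the working memory. Cells 1 and 2: reachability of inputs and of outputs; 3
  and 4: mutual reachability; 5: \<open>good\<close>; 6 and 7: the current conjunct; 8: the winning
  region. In synthesis, 9: \<open>settled\<close>; 10: \<open>careful_step\<close>; 11:
  \<open>target\<close>; 12: the attractor; 13: moves into it; 14: candidate moves; 15: selected
  moves; 16: states that already have one.\<close>

abbreviation "cell10 n \<equiv> BCell 10 (Num n)"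
abbreviation "in_vars \<equiv> vars_slice 0"
abbreviation "out_vars \<equiv> vars_slice 1"

text \<open>Cell 6 of number array 8 ends as the number of all guarantees and later bounds the loop
  over memory values.\<close>

definition good_prog :: prog where
  "good_prog = Seq (Put 10 (Num 5) (BConst True)) (Seq (Assign 8 (Num 5) (Num 0)) (Seq (Assign 8 (Num 6) (Num 0))
     (For 3 (Cell 0 (Num 2)) (Seq (accumulate 0) (Seq (accumulate 1)
       (Put 10 (Num 5) (BAnd (cell10 5) (BImp (cell10 6) (cell10 7)))))))))"

text \<open>Transcribes \<open>win_step\<close>. A state lies on a cycle iff it is mutually
  reachable with some state, which is how cycles are tested here. The one-step part renames the
  winning region in both kinds of variables, the reachability part only in the outputs, since it
  keeps the input.\<close>

definition win_exp :: bexp where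
  "win_exp = BAnd
     (BAll (Primed in_vars) (BImp (BCell 0 (Num 2))
       (BEx (Primed out_vars) (BAnd (BCell 0 (Num 3)) (BRen in_vars (BRen out_vars (cell10 8)))))))
     (BImp (BEx (Primed in_vars) (cell10 3))
       (BEx (Primed out_vars) (BAnd (cell10 2) (BAnd (BRen out_vars (BEx (Primed out_vars) (cell10 4)))
         (BAnd (BRen out_vars (cell10 5)) (BRen out_vars (cell10 8)))))))"

definition win_prog :: prog where
  "win_prog = Seq (Assign 8 (Num 0) (Times (var 1) (var 2))) (Seq (Put 10 (Num 8) (BConst True))
     (For 3 (var 0) (Put 10 (Num 8) win_exp)))"

definition answer_prog :: prog where
  "answer_prog = Test_Valid 5 (Num 0) (BAll (Unprimed in_vars) (BImp (BCell 0 (Num 0))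
     (BEx (Unprimed out_vars) (BAnd (BCell 0 (Num 1)) (cell10 8)))))"

definition solve_prog :: prog where
  "solve_prog = Seq (singletons 0) (Seq (singletons 1) (Seq (closure 0) (Seq (closure 1)
     (Seq good_prog (Seq win_prog answer_prog)))))"

lemma gfs_length_ge: "length ps \<le> gfs_length ps"
  unfolding gfs_length_def conj_length_def by (induction ps) auto

text \<open>Every formula and every implication sign contributes to the length. The factor 2 pays
  for \<open>Suc\<close>, which is what absorbs additive constants; the empty condition has length
  1.\<close>

lemma grk_length_ge:
  "Suc (\<Sum>l<length \<phi>. 1 + length (fst (\<phi> ! l)) + length (snd (\<phi> ! l))) \<le> 2 * grk_length \<phi>"
proof (cases "\<phi> = []")
  case False
  have "(\<Sum>l<length \<phi>. 1 + length (fst (\<phi> ! l)) + length (snd (\<phi> ! l)))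
      = sum_list (map (\<lambda>(as, gs). length as + 1 + length gs) \<phi>)"
    by (simp add: sum_list_sum_nth atLeast0LessThan split_beta add.commute)
  also have "\<dots> \<le> sum_list (map (\<lambda>(as, gs). gfs_length as + 1 + gfs_length gs) \<phi>)"
    by (intro sum_list_mono) (auto intro!: add_mono gfs_length_ge)
  also have "\<dots> \<le> grk_length \<phi>"
    using False by (simp add: grk_length_def conj_length_def)
  finally have "(\<Sum>l<length \<phi>. 1 + length (fst (\<phi> ! l)) + length (snd (\<phi> ! l))) \<le> grk_length \<phi>" .
  moreover have "length \<phi> \<ge> 1" using False by (simp add: Suc_leI)
  moreover have "length \<phi> \<le> (\<Sum>l<length \<phi>. 1 + length (fst (\<phi> ! l)) + length (snd (\<phi> ! l)))"
    using sum_mono[of "{..<length \<phi>}" "\<lambda>_. 1" "\<lambda>l. 1 + length (fst (\<phi> ! l)) + length (snd (\<phi> ! l))"]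
    by simp
  ultimately show ?thesis by linarith
qed (simp add: grk_length_def conj_length_def)

context separated_game
begin

definition "assumptions_met l i \<longleftrightarrow> (\<forall>a \<in> set (fst (\<phi> ! l)). \<exists>i'. eI i i' \<and> sat (Unp ` i') a)"
definition "guarantees_met l out \<longleftrightarrow> (\<forall>g \<in> set (snd (\<phi> ! l)). \<exists>out'. eO out out' \<and> sat (Unp ` out') g)"

lemma good_iff: "good i out \<longleftrightarrow> (\<forall>l<length \<phi>. assumptions_met l i \<longrightarrow> guarantees_met l out)"
  unfolding good_def assumptions_met_def guarantees_met_def all_set_conv_all_nth by (simp add: split_beta)

lemma eI_sub: "eI i i' \<Longrightarrow> i \<subseteq> X \<and> i' \<subseteq> X" and eO_sub: "eO out out' \<Longrightarrow> out \<subseteq> Y \<and> out' \<subseteq> Y"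
  by (auto simp: eI_def eO_def dest!: tI_sub tO_sub)

lemma ex_eI: "(\<exists>i' \<subseteq> X. eI i i' \<and> P i') \<longleftrightarrow> (\<exists>i'. eI i i' \<and> P i')"
  and ex_eO: "(\<exists>out' \<subseteq> Y. eO out out' \<and> Q out') \<longleftrightarrow> (\<exists>out'. eO out out' \<and> Q out')"
  by (metis eI_sub) (metis eO_sub)

lemma good_runs:
  assumes inp: "inp st" and E: "bdds st 10 3 = rel_bdd X eI" "bdds st 10 4 = rel_bdd Y eO"
  shows "runs good_prog st (2 + (\<Sum>l<length \<phi>. 10 + 8 * length (fst (\<phi> ! l)) + 8 * length (snd (\<phi> ! l))))
    (\<lambda>s. frame {(8, 3), (8, 4), (8, 5), (8, 6)} {(10, 5), (10, 6), (10, 7)} st s \<and>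
      nums s 8 6 = length guarantees \<and> bdds s 10 5 = game_bdd (\<lambda>i out _ _. good i out))"
proof -
  let ?F = "frame {(8, 3), (8, 4), (8, 5), (8, 6)} {(10, 5), (10, 6), (10, 7)} st"
  let ?p = "\<lambda>l. sum_list (map length (take l (map fst \<phi>)))"
  let ?q = "\<lambda>l. sum_list (map length (take l (map snd \<phi>)))"
  let ?G = "\<lambda>l. game_bdd (\<lambda>i out _ _. \<forall>k<l. assumptions_met k i \<longrightarrow> guarantees_met k out)"
  let ?I = "\<lambda>l s. ?F s \<and> nums s 8 3 = l \<and> nums s 8 5 = ?p l \<and> nums s 8 6 = ?q l \<and> bdds s 10 5 = ?G l"
  have inpF: "inp s" if "?F s" for s using inp_frame[OF inp that] by simp
  show ?thesis
    unfolding good_prog_def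
  proof (rule runs_cost[OF runs_Seq[OF runs_Put[OF runs_Seq[OF runs_Assign[OF runs_Seq[OF runs_Assign[OF
      runs_For[where n = "length \<phi>" and I = ?I and
        C = "\<lambda>l. 10 + 8 * length (fst (\<phi> ! l)) + 8 * length (snd (\<phi> ! l))"]]]]]]]])
    fix l s assume l: "l < length \<phi>" and I: "?I l s"
    let ?n = "length (fst (\<phi> ! l))" and ?m = "length (snd (\<phi> ! l))"
    have F: "?F s" and inps: "inp s" using I inpF by blast+
    have E': "bdds s 10 3 = rel_bdd X eI" "bdds s 10 4 = rel_bdd Y eO"
      using E frame_bdds[OF F] by simp_all
    have 1: "runs (accumulate 0) s (2 + 8 * ?n) (\<lambda>s1. frame {(8, 4), (8, 5)} {(10, 6)} s s1 \<and>
        nums s1 8 5 = ?p (Suc l) \<and> bdds s1 10 6 = rel_bdd X (\<lambda>i _. assumptions_met l i))"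
    proof (rule runs_weaken[OF accumulate_runs[where a = 0 and V = X and l = l and p = "?p l" and n = ?n
          and e = eI and P = "\<lambda>j x. sat (Unp ` x) (fst (\<phi> ! l) ! j)"]])
      fix j assume "j < ?n"
      then show "bdds s (Suc 0) (?p l + j) = rel_bdd X (\<lambda>x _. sat (Unp ` x) (fst (\<phi> ! l) ! j))"
        using concat_nth_prefix[of l "map fst \<phi>" j] l inp_bdds(5)[OF inps, of "?p l + j"] by simp
    next
      fix s1
      have "rel_bdd X (\<lambda>x _. \<forall>j<?n. \<exists>y\<subseteq>X. eI x y \<and> sat (Unp ` y) (fst (\<phi> ! l) ! j)) =
          rel_bdd X (\<lambda>i _. assumptions_met l i)"
        by (simp add: assumptions_met_def all_set_conv_all_nth ex_eI)
      then show "frame {(8, 4), (8, 5 + 0)} {(10, 6 + 0)} s s1 \<and> nums s1 8 (5 + 0) = ?p l + ?n \<and>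
          bdds s1 10 (6 + 0) = rel_bdd X (\<lambda>x _. \<forall>j<?n. \<exists>y\<subseteq>X. eI x y \<and> sat (Unp ` y) (fst (\<phi> ! l) ! j)) \<Longrightarrow>
        frame {(8, 4), (8, 5)} {(10, 6)} s s1 \<and>
        nums s1 8 5 = ?p (Suc l) \<and> bdds s1 10 6 = rel_bdd X (\<lambda>i _. assumptions_met l i)"
        using l by (simp add: take_Suc_conv_app_nth)
    qed (use I l E' inp_slice[OF inps] inp_nums[OF inps] in simp_all)
    show "runs (Seq (accumulate 0) (Seq (accumulate 1)
       (Put 10 (Num 5) (BAnd (cell10 5) (BImp (cell10 6) (cell10 7)))))) s (10 + 8 * ?n + 8 * ?m)
      (\<lambda>s'. ?I (Suc l) (set_num 8 3 (Suc (nums s' 8 3)) s'))"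
    proof (rule runs_cost[OF runs_SeqI[OF 1]])
      fix s1
      assume s1: "frame {(8, 4), (8, 5)} {(10, 6)} s s1 \<and>
        nums s1 8 5 = ?p (Suc l) \<and> bdds s1 10 6 = rel_bdd X (\<lambda>i _. assumptions_met l i)"
      then have F1: "frame {(8, 4), (8, 5)} {(10, 6)} s s1" by blast
      have Fs1: "?F s1" by (rule frame_trans[OF F frame_mono[OF F1]]) auto
      then have inp1: "inp s1" by (rule inpF)
      have 2: "runs (accumulate 1) s1 (2 + 8 * ?m) (\<lambda>s2. frame {(8, 4), (8, 6)} {(10, 7)} s1 s2 \<and>
          nums s2 8 6 = ?q (Suc l) \<and> bdds s2 10 7 = rel_bdd Y (\<lambda>out _. guarantees_met l out))"
      proof (rule runs_weaken[OF accumulate_runs[where a = 1 and V = Y and l = l and p = "?q l" and n = ?m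
            and e = eO and P = "\<lambda>j x. sat (Unp ` x) (snd (\<phi> ! l) ! j)"]])
        fix j assume "j < ?m"
        then show "bdds s1 (Suc 1) (?q l + j) = rel_bdd Y (\<lambda>x _. sat (Unp ` x) (snd (\<phi> ! l) ! j))"
          using concat_nth_prefix[of l "map snd \<phi>" j] l inp_bdds(6)[OF inp1, of "?q l + j"]
          by (simp add: meets_def numeral_2_eq_2)
      next
        fix s2
        have "rel_bdd Y (\<lambda>x _. \<forall>j<?m. \<exists>y\<subseteq>Y. eO x y \<and> sat (Unp ` y) (snd (\<phi> ! l) ! j)) =
            rel_bdd Y (\<lambda>out _. guarantees_met l out)"
          by (simp add: guarantees_met_def all_set_conv_all_nth ex_eO)
        then show "frame {(8, 4), (8, 5 + 1)} {(10, 6 + 1)} s1 s2 \<and> nums s2 8 (5 + 1) = ?q l + ?m \<and>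
            bdds s2 10 (6 + 1) = rel_bdd Y (\<lambda>x _. \<forall>j<?m. \<exists>y\<subseteq>Y. eO x y \<and> sat (Unp ` y) (snd (\<phi> ! l) ! j)) \<Longrightarrow>
          frame {(8, 4), (8, 6)} {(10, 7)} s1 s2 \<and>
          nums s2 8 6 = ?q (Suc l) \<and> bdds s2 10 7 = rel_bdd Y (\<lambda>out _. guarantees_met l out)"
          using l by (simp add: take_Suc_conv_app_nth)
      qed (use I l E' inp_slice[OF inp1] inp_nums[OF inp1] frame_nums[OF F1] frame_bdds[OF F1] in simp_all)
      show "runs (Seq (accumulate 1) (Put 10 (Num 5) (BAnd (cell10 5) (BImp (cell10 6) (cell10 7))))) s1
         (2 + 8 * ?m + 6) (\<lambda>s'. ?I (Suc l) (set_num 8 3 (Suc (nums s' 8 3)) s'))"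
      proof (rule runs_cost[OF runs_SeqI[OF 2]])
        fix s2
        assume s2: "frame {(8, 4), (8, 6)} {(10, 7)} s1 s2 \<and>
          nums s2 8 6 = ?q (Suc l) \<and> bdds s2 10 7 = rel_bdd Y (\<lambda>out _. guarantees_met l out)"
        then have F2: "frame {(8, 4), (8, 6)} {(10, 7)} s1 s2" by blast
        have Fs2: "?F s2" by (rule frame_trans[OF Fs1 frame_mono[OF F2]]) auto
        let ?e = "BAnd (cell10 5) (BImp (cell10 6) (cell10 7))"
        have "bval ?e s2 = game_bdd (\<lambda>i out _ _. (\<forall>k<l. assumptions_met k i \<longrightarrow> guarantees_met k out) \<and>
            (\<not> assumptions_met l i \<or> guarantees_met l out))"
          using I s1 s2 frame_bdds[OF F1] frame_bdds[OF F2] by (simp add: game_bdd_rel game_bdd_bool)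
        also have "\<dots> = ?G (Suc l)" by (rule game_bdd_cong) (auto simp: less_Suc_eq)
        finally have val: "bval ?e s2 = ?G (Suc l)" .
        show "runs (Put 10 (Num 5) ?e) s2 6 (\<lambda>s'. ?I (Suc l) (set_num 8 3 (Suc (nums s' 8 3)) s'))"
        proof (rule runs_cost[OF runs_Put])
          show "?I (Suc l) (set_num 8 3 (Suc (nums (set_bdd 10 (aval (Num 5) s2) (bval ?e s2) s2) 8 3))
              (set_bdd 10 (aval (Num 5) s2) (bval ?e s2) s2))"
            unfolding val using Fs2 I s1 s2 frame_nums[OF F1] frame_nums[OF F2] by simp
        qed simp_all
      qed simp
    qed simp
  next
    fix l s assume I: "?I l s"
    then have "inp s" using inpF by blast
    then show "nums s 8 3 = l \<and> aval (Cell 0 (Num 2)) s = length \<phi>" using I inp_nums by simp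
  next
    fix s assume I: "?I (length \<phi>) s"
    then show "?F s \<and> nums s 8 6 = length guarantees \<and> bdds s 10 5 = game_bdd (\<lambda>i out _ _. good i out)"
      by (simp add: good_iff length_concat)
  qed (simp_all add: game_bdd_const)
qed

lemma win_exp_val:
  assumes inp: "inp s" and T: "bdds s 10 2 = rel_bdd Y tO"
    and E: "bdds s 10 3 = rel_bdd X eI" "bdds s 10 4 = rel_bdd Y eO"
    and good: "bdds s 10 5 = game_bdd (\<lambda>i out _ _. good i out)" and Z: "bdds s 10 8 = game_bdd (\<lambda>i out _ _. Z i out)"
  shows "bval win_exp s = game_bdd (\<lambda>i out _ _. win_step Z i out)"
proof -
  have cyc: "(\<exists>i' \<subseteq> X. eI i i') \<longleftrightarrow> tI i i" "(\<exists>out' \<subseteq> Y. eO out out') \<longleftrightarrow> tO out out" for i out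
    using tI_sub[of i i] tO_sub[of out out] by (auto simp: eI_def eO_def intro: tranclp_trans)
  have "bval win_exp s = game_bdd (\<lambda>i out _ _.
      (\<forall>i' \<subseteq> X. \<not> rI i i' \<or> (\<exists>out' \<subseteq> Y. rO out out' \<and> Z i' out')) \<and>
      (\<not> (\<exists>i' \<subseteq> X. eI i i') \<or>
        (\<exists>out' \<subseteq> Y. tO out out' \<and> (\<exists>out'' \<subseteq> Y. eO out' out'') \<and> good i out' \<and> Z i out')))"
    using T E good Z inp_bdds(3,4)[OF inp] inp_slice(3,4)[OF inp]
    unfolding win_exp_def by (simp add: game_bdd_rel game_bdd_ex game_bdd_all game_bdd_bool game_bdd_rename)
  also have "\<dots> = game_bdd (\<lambda>i out _ _. win_step Z i out)"
    unfolding cyc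
  proof (rule game_bdd_cong)
    fix i out :: "nat set"
    have "rI i i' \<Longrightarrow> i' \<subseteq> X" "rO out out' \<Longrightarrow> out' \<subseteq> Y" "tO out out' \<Longrightarrow> out' \<subseteq> Y" for i' out'
      using rI_sub[of i i'] rO_sub[of out out'] tO_sub[of out out'] by blast+
    then show "(\<forall>i'\<subseteq>X. \<not> rI i i' \<or> (\<exists>out'\<subseteq>Y. rO out out' \<and> Z i' out')) \<and>
       (\<not> tI i i \<or> (\<exists>out'\<subseteq>Y. tO out out' \<and> tO out' out' \<and> good i out' \<and> Z i out')) \<longleftrightarrow> win_step Z i out"
      unfolding win_step_def by metis
  qed
  finally show ?thesis .
qed

lemma win_runs:
  assumes inp: "inp st" and T: "bdds st 10 2 = rel_bdd Y tO"
    and E: "bdds st 10 3 = rel_bdd X eI" "bdds st 10 4 = rel_bdd Y eO"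
    and good: "bdds st 10 5 = game_bdd (\<lambda>i out _ _. good i out)"
    and num: "nums st 8 1 = 2 ^ length in_list" "nums st 8 2 = 2 ^ length out_list"
  shows "runs win_prog st (2 + 26 * num_states G) (\<lambda>s. frame {(8, 0), (8, 3)} {(10, 8)} st s \<and>
    nums s 8 0 = num_states G \<and> bdds s 10 8 = game_bdd (\<lambda>i out _ _. Win i out))"
proof -
  let ?F = "frame {(8, 0), (8, 3)} {(10, 8)} st"
  let ?I = "\<lambda>n s. ?F s \<and> nums s 8 3 = n \<and> nums s 8 0 = num_states G \<and>
    bdds s 10 8 = game_bdd (\<lambda>i out _ _. win_iter n i out)"
  have N: "nums st 8 1 * nums st 8 2 = num_states G"
    using num finite_vars by (simp add: num_states_eq card_cartesian_product card_Pow)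
  show ?thesis
    unfolding win_prog_def
  proof (rule runs_cost[OF runs_Seq[OF runs_Assign[OF runs_Seq[OF runs_Put[OF
      runs_For[where n = "num_states G" and I = ?I and C = "\<lambda>_. 26"]]]]]])
    fix n s assume I: "?I n s"
    then have F: "?F s" by blast
    have inps: "inp s" using inp_frame[OF inp F] by simp
    have val: "bval win_exp s = game_bdd (\<lambda>i out _ _. win_iter (Suc n) i out)"
      unfolding win_iter_Suc
      by (rule win_exp_val[OF inps]) (use I T E good frame_bdds[OF F] in simp_all)
    show "runs (Put 10 (Num 8) win_exp) s 26 (\<lambda>s'. ?I (Suc n) (set_num 8 3 (Suc (nums s' 8 3)) s'))"
    proof (rule runs_cost[OF runs_Put])
      show "?I (Suc n) (set_num 8 3 (Suc (nums (set_bdd 10 (aval (Num 8) s) (bval win_exp s) s) 8 3))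
          (set_bdd 10 (aval (Num 8) s) (bval win_exp s) s))"
        unfolding val using I by simp
    qed (simp_all add: win_exp_def)
  qed (use N in \<open>simp_all add: game_bdd_const win_iter_def\<close>)
qed

lemma answer_runs:
  assumes inp: "inp st" and Win: "bdds st 10 8 = game_bdd (\<lambda>i out _ _. Win i out)"
  shows "runs answer_prog st 9 (\<lambda>s. frame {(5, 0)} {} st s \<and> (answer s \<longleftrightarrow> realizable G \<phi>))"
proof -
  let ?e = "BAll (Unprimed in_vars) (BImp (BCell 0 (Num 0)) (BEx (Unprimed out_vars) (BAnd (BCell 0 (Num 1)) (cell10 8))))"
  have val: "bval ?e st = game_bdd (\<lambda>_ _ _ _. \<forall>i \<subseteq> X. \<not> sat (Unp ` i) (init_in G) \<or>
      (\<exists>out \<subseteq> Y. sat (Unp ` out) (init_out G) \<and> Win i out))"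
    using Win inp_bdds(1,2)[OF inp] inp_slice(3,4)[OF inp]
    by (simp add: game_bdd_rel game_bdd_ex game_bdd_all game_bdd_bool)
  have "bval ?e st = UNIV \<longleftrightarrow> realizable G \<phi>"
    unfolding val game_bdd_closed realizable_iff by (simp only: imp_conv_disj)
  then show ?thesis
    unfolding answer_prog_def
    by (intro runs_cost[OF runs_Test_Valid]) (simp_all add: answer_def)
qed

abbreviation "out_enum \<equiv> nth_subset out_list (length out_list)"

lemma enum_images:
  "nth_subset in_list (length in_list) ` {..<2 ^ length in_list} = Pow X"
  "out_enum ` {..<2 ^ length out_list} = Pow Y"
  using nth_subset_image[of "length in_list" in_list] nth_subset_image[of "length out_list" out_list]
    finite_vars by simp_all

definition solved :: "store \<Rightarrow> bool" where
  "solved s \<longleftrightarrow> inp s \<and> nums s 8 0 = num_states G \<and> nums s 8 2 = 2 ^ length out_list \<and>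
     nums s 8 6 = length guarantees \<and>
     (\<forall>j<2 ^ length out_list. bdds s 12 j = rel_bdd Y (\<lambda>out _. out = out_enum j)) \<and>
     bdds s 10 4 = rel_bdd Y eO \<and> bdds s 10 5 = game_bdd (\<lambda>i out _ _. good i out) \<and>
     bdds s 10 8 = game_bdd (\<lambda>i out _ _. Win i out) \<and> (answer s \<longleftrightarrow> realizable G \<phi>)"

lemma power_le_num_states:
  "2 ^ length in_list \<le> num_states G" "2 ^ length out_list \<le> num_states G" "1 \<le> num_states G"
  using finite_vars by (simp_all add: num_states_eq card_cartesian_product card_Pow)

lemma solve_runs:
  "runs solve_prog (input_store G \<phi>) (101 * (grk_length \<phi> + num_states G)) solved"
proof -
  let ?s0 = "input_store G \<phi>" and ?n = "2 ^ length in_list :: nat" and ?m = "2 ^ length out_list :: nat"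
  let ?F1 = "frame {(8, 1), (8, 3), (8, 4)} ({11} \<times> UNIV)"
  let ?F2 = "frame {(8, 2), (8, 3), (8, 4)} ({12} \<times> UNIV)"
  let ?F3 = "frame {(8, 3)} {(10, 1), (10, 3)}"
  let ?F4 = "frame {(8, 3)} {(10, 2), (10, 4)}"
  let ?F5 = "frame {(8, 3), (8, 4), (8, 5), (8, 6)} {(10, 5), (10, 6), (10, 7)}"
  let ?F6 = "frame {(8, 0), (8, 3)} {(10, 8)}"
  let ?c5 = "2 + (\<Sum>l<length \<phi>. 10 + 8 * length (fst (\<phi> ! l)) + 8 * length (snd (\<phi> ! l)))"
  have eI: "eI = (\<lambda>x y. tI x y \<and> tI y x)" and eO: "eO = (\<lambda>x y. tO x y \<and> tO y x)"
    by (simp_all add: eI_def eO_def fun_eq_iff)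
  show ?thesis
    unfolding solve_prog_def
  proof (rule runs_cost[OF runs_SeqI])
    show "runs (singletons 0) ?s0 (11 * ?n) (\<lambda>s. ?F1 ?s0 s \<and> nums s 8 1 = ?n \<and>
        (\<forall>j<?n. bdds s 11 j = {\<sigma>. unp_part X \<sigma> = nth_subset in_list (length in_list) j}))"
      using singletons_runs[of 0 ?s0 in_list] inp_nums(1)[OF inp_input] inp_bdds(7)[OF inp_input] finite_vars
      by simp
  next
    fix s1 assume s1: "?F1 ?s0 s1 \<and> nums s1 8 1 = ?n \<and>
        (\<forall>j<?n. bdds s1 11 j = {\<sigma>. unp_part X \<sigma> = nth_subset in_list (length in_list) j})"
    then have i1: "inp s1" using inp_frame[OF inp_input, of _ _ s1] by auto
    show "runs (Seq (singletons 1) (Seq (closure 0) (Seq (closure 1) (Seq good_prog (Seq win_prog answer_prog))))) s1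
        (11 * ?m + (7 + 13 * ?n + (7 + 13 * ?m + (?c5 + (2 + 26 * num_states G + 9))))) solved"
    proof (rule runs_SeqI)
      show "runs (singletons 1) s1 (11 * ?m) (\<lambda>s. ?F2 s1 s \<and> nums s 8 2 = ?m \<and>
          (\<forall>j<?m. bdds s 12 j = {\<sigma>. unp_part Y \<sigma> = out_enum j}))"
        using singletons_runs[of 1 s1 out_list] inp_nums(2)[OF i1] inp_bdds(8)[OF i1] finite_vars
        by (simp add: numeral_2_eq_2)
    next
      fix s2 assume s2: "?F2 s1 s2 \<and> nums s2 8 2 = ?m \<and> (\<forall>j<?m. bdds s2 12 j = {\<sigma>. unp_part Y \<sigma> = out_enum j})"
      then have i2: "inp s2" using inp_frame[OF i1, of _ _ s2] by auto
      have f2: "?F2 s1 s2" using s2 by blast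
      show "runs (Seq (closure 0) (Seq (closure 1) (Seq good_prog (Seq win_prog answer_prog)))) s2
          (7 + 13 * ?n + (7 + 13 * ?m + (?c5 + (2 + 26 * num_states G + 9)))) solved"
      proof (rule runs_SeqI)
        show "runs (closure 0) s2 (7 + 13 * ?n) (\<lambda>s. ?F3 s2 s \<and> bdds s 10 1 = rel_bdd X tI \<and> bdds s 10 3 = rel_bdd X eI)"
          using closure_runs[of 0 s2 X rI ?n "nth_subset in_list (length in_list)"]
            inp_slice[OF i2] inp_bdds(3)[OF i2] rI_sub enum_images(1) s1 frame_nums[OF f2] frame_bdds[OF f2]
          by (simp add: eI)
      next
        fix s3 assume s3: "?F3 s2 s3 \<and> bdds s3 10 1 = rel_bdd X tI \<and> bdds s3 10 3 = rel_bdd X eI"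
        then have i3: "inp s3" using inp_frame[OF i2, of _ _ s3] by auto
        have f3: "?F3 s2 s3" using s3 by blast
        show "runs (Seq (closure 1) (Seq good_prog (Seq win_prog answer_prog))) s3
            (7 + 13 * ?m + (?c5 + (2 + 26 * num_states G + 9))) solved"
        proof (rule runs_SeqI)
          show "runs (closure 1) s3 (7 + 13 * ?m) (\<lambda>s. ?F4 s3 s \<and> bdds s 10 2 = rel_bdd Y tO \<and> bdds s 10 4 = rel_bdd Y eO)"
            using closure_runs[of 1 s3 Y rO ?m out_enum]
              inp_slice[OF i3] inp_bdds(4)[OF i3, unfolded numeral_3_eq_3] rO_sub enum_images(2) s2 frame_nums[OF f3] frame_bdds[OF f3]
            by (simp add: eO numeral_2_eq_2)
        next
          fix s4 assume s4: "?F4 s3 s4 \<and> bdds s4 10 2 = rel_bdd Y tO \<and> bdds s4 10 4 = rel_bdd Y eO"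
          then have i4: "inp s4" using inp_frame[OF i3, of _ _ s4] by auto
          have f4: "?F4 s3 s4" using s4 by blast
          have E4: "bdds s4 10 3 = rel_bdd X eI" using s3 frame_bdds[OF f4] by simp
          show "runs (Seq good_prog (Seq win_prog answer_prog)) s4 (?c5 + (2 + 26 * num_states G + 9)) solved"
          proof (rule runs_SeqI[OF good_runs[OF i4 E4]])
            show "bdds s4 10 4 = rel_bdd Y eO" using s4 by blast
          next
            fix s5 assume s5: "?F5 s4 s5 \<and> nums s5 8 6 = length guarantees \<and> bdds s5 10 5 = game_bdd (\<lambda>i out _ _. good i out)"
            then have i5: "inp s5" using inp_frame[OF i4, of _ _ s5] by auto
            have f5: "?F5 s4 s5" using s5 by blast
            show "runs (Seq win_prog answer_prog) s5 (2 + 26 * num_states G + 9) solved"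
            proof (rule runs_SeqI[OF win_runs[OF i5]])
              fix s6 assume s6: "?F6 s5 s6 \<and> nums s6 8 0 = num_states G \<and> bdds s6 10 8 = game_bdd (\<lambda>i out _ _. Win i out)"
              then have i6: "inp s6" using inp_frame[OF i5, of _ _ s6] by auto
              have f6: "?F6 s5 s6" using s6 by blast
              show "runs answer_prog s6 9 solved"
              proof (rule runs_weaken[OF answer_runs[OF i6] order_refl])
                fix s7 assume s7: "frame {(5, 0)} {} s6 s7 \<and> (answer s7 \<longleftrightarrow> realizable G \<phi>)"
                then have i7: "inp s7" using inp_frame[OF i6, of _ _ s7] by auto
                have f7: "frame {(5, 0)} {} s6 s7" using s7 by blast
                note f = frame_nums[OF f3] frame_nums[OF f4] frame_nums[OF f5] frame_nums[OF f6] frame_nums[OF f7]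
                  frame_bdds[OF f3] frame_bdds[OF f4] frame_bdds[OF f5] frame_bdds[OF f6] frame_bdds[OF f7]
                show "solved s7"
                  unfolding solved_def using i7 s2 s4 s5 s6 s7 by (simp add: f) (simp add: rel_bdd_def)
              qed (use s6 in blast)
            qed (use s1 s2 E4 s4 s5 frame_nums[OF f2] frame_nums[OF f3] frame_nums[OF f4] frame_nums[OF f5] frame_bdds[OF f5]
                in simp_all)
          qed
        qed
      qed
    qed
  next
    have "?c5 \<le> 2 + 10 * (\<Sum>l<length \<phi>. 1 + length (fst (\<phi> ! l)) + length (snd (\<phi> ! l)))"
      unfolding sum_distrib_left by (intro add_left_mono sum_mono) simp
    then have "?c5 \<le> 20 * grk_length \<phi>" using grk_length_ge[of \<phi>] by linarith
    \<comment> \<open>Per state, singletons and closures contribute 48, the fixpoint 26 and the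
      constants 25, in total 99. The bound on \<open>?c5\<close> takes care of the
      condition.\<close>
    then show "11 * ?n + (11 * ?m + (7 + 13 * ?n + (7 + 13 * ?m + (?c5 + (2 + 26 * num_states G + 9)))))
        \<le> 101 * (grk_length \<phi> + num_states G)"
      using power_le_num_states unfolding add_mult_distrib2 by linarith
  qed
qed

end

section \<open>Symbolic synthesis\<close>

definition target_exp :: bexp where
  "target_exp = BAnd (cell10 9) (BOr (BCell 2 (var 3))
     (BNot (BEx (Primed out_vars) (BAnd (cell10 4) (BRen out_vars (BCell 2 (var 3)))))))"

text \<open>Cell 14 admits only moves of states that are new in this round into the previous round,
  hence it is updated before cell 12 grows.\<close>

definition attractor_prog :: prog where
  "attractor_prog = For 4 (var 0)
     (Seq (Put 10 (Num 13) (BAnd (cell10 10) (BRen out_vars (cell10 12))))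
     (Seq (Put 10 (Num 14) (BOr (cell10 14) (BAnd (cell10 13) (BNot (cell10 12)))))
       (Put 10 (Num 12) (BOr (cell10 12) (BEx (Primed out_vars) (cell10 13))))))"

definition admissible_exp :: bexp where
  "admissible_exp = BOr (cell10 14) (BAnd (BNot (cell10 12)) (BAnd (BCell 0 (Num 3))
     (BImp (BEx (Primed out_vars) (BAnd (BCell 0 (Num 3)) (BRen out_vars (cell10 8))))
       (BRen out_vars (cell10 8)))))"

text \<open>Makes the relation in cell 14 functional: the first matching singleton wins.\<close>

definition pick_prog :: prog where
  "pick_prog = (let cand = BAnd (cell10 14) (BRen out_vars (BCell 12 (var 4))) in
     For 4 (var 2)
     (Seq (Put 10 (Num 15) (BOr (cell10 15) (BAnd cand (BNot (cell10 16)))))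
       (Put 10 (Num 16) (BOr (cell10 16) (BEx (Primed out_vars) cand)))))"

text \<open>The fixpoints never move the input, so it is carried in the unprimed copy. The two
  results are renamed at the end, because moves and edges refer to the input that has just
  arrived.\<close>

definition memory_prog :: prog where
  "memory_prog =
     Seq (Put 10 (Num 11) target_exp) (Seq (Put 10 (Num 12) (cell10 11))
     (Seq (Put 10 (Num 14) (BAnd (cell10 11) (cell10 10))) (Seq attractor_prog
     (Seq (Put 10 (Num 14) admissible_exp) (Seq (Put 10 (Num 15) (BConst False))
     (Seq (Put 10 (Num 16) (BConst False)) (Seq pick_prog
     (Seq (Put 5 (var 3) (BRen in_vars (cell10 15))) (Seq (Put 6 (var 3) (BRen in_vars (cell10 11)))
     (Seq (Assign 6 (var 3) (var 3)) (Assign 7 (var 3) (Plus (var 3) (Num 1)))))))))))))"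

text \<open>There is one memory value more than there are guarantees. It reads the BDD of false behind the
  guarantees, hence is left as soon as the play has settled, and it makes the memory nonempty.\<close>

definition synth_prog :: prog where
  "synth_prog = Seq solve_prog
     (Seq (Put 10 (Num 9) (BAnd (BEx (Primed out_vars) (cell10 4)) (BAnd (cell10 5) (cell10 8))))
     (Seq (Put 10 (Num 10) (BAnd (BCell 0 (Num 3)) (BImp (cell10 9) (cell10 4))))
     (Seq (For 3 (Plus (var 6) (Num 1)) memory_prog)
     (Seq (Assign 7 (var 6) (Num 0)) (Seq (Assign 5 (Num 1) (Plus (var 6) (Num 1)))
     (Seq (Assign 5 (Num 2) (Num 0)) (Assign 5 (Num 3) (Plus (var 6) (Num 1)))))))))"

context separated_game
begin

lemma attractor_runs:
  assumes inp: "inp st" and N: "nums st 8 0 = num_states G"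
    and careful_step: "bdds st 10 10 = game_bdd (\<lambda>i out _ out'. careful_step i out out')"
    and A: "bdds st 10 12 = game_bdd (\<lambda>i out _ _. target q i out)"
    and R: "bdds st 10 14 = game_bdd (\<lambda>i out _ out'. target q i out \<and> careful_step i out out')"
  shows "runs attractor_prog st (17 * num_states G) (\<lambda>s. frame {(8, 4)} {(10, 12), (10, 13), (10, 14)} st s \<and>
    bdds s 10 12 = game_bdd (\<lambda>i out _ _. attractor q (num_states G) i out) \<and>
    bdds s 10 14 = game_bdd (\<lambda>i out _ out'. target q i out \<and> careful_step i out out' \<or>
      (\<exists>k<num_states G. careful_step i out out' \<and> attractor q k i out' \<and> \<not> attractor q k i out)))"
proof -
  let ?F = "frame {(8, 4)} {(10, 12), (10, 13), (10, 14)} st"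
  let ?A = "\<lambda>k. game_bdd (\<lambda>i out _ _. attractor q k i out)"
  let ?R = "\<lambda>k. game_bdd (\<lambda>i out _ out'. target q i out \<and> careful_step i out out' \<or>
      (\<exists>j<k. careful_step i out out' \<and> attractor q j i out' \<and> \<not> attractor q j i out))"
  let ?I = "\<lambda>k s. ?F s \<and> nums s 8 4 = k \<and> bdds s 10 12 = ?A k \<and> bdds s 10 14 = ?R k"
  show ?thesis
    unfolding attractor_prog_def
  proof (rule runs_cost[OF runs_For[where n = "num_states G" and I = ?I and C = "\<lambda>_. 17"]])
    fix k s assume I: "?I k s"
    then have F: "?F s" by blast
    have "inp s" using inp_frame[OF inp F] by simp
    note sl = inp_slice(4)[OF this]
    have careful_step': "bdds s 10 10 = game_bdd (\<lambda>i out _ out'. careful_step i out out')"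
      using frame_bdds[OF F] careful_step by simp
    let ?New = "game_bdd (\<lambda>i out _ out'. careful_step i out out' \<and> attractor q k i out')"
    let ?e1 = "BAnd (cell10 10) (BRen out_vars (cell10 12))"
    let ?e2 = "BOr (cell10 14) (BAnd (cell10 13) (BNot (cell10 12)))"
    let ?e3 = "BOr (cell10 12) (BEx (Primed out_vars) (cell10 13))"
    let ?s1 = "set_bdd 10 13 ?New s"
    let ?s2 = "set_bdd 10 14 (?R (Suc k)) ?s1"
    let ?s3 = "set_bdd 10 12 (?A (Suc k)) ?s2"
    have slice: "slice_val out_vars ?s2 = Y"
      using sl slice_val_teq[of ?s2 s] by simp
    have 1: "bval ?e1 s = ?New"
      using I careful_step' sl by (simp add: game_bdd_bool game_bdd_rename)
    have "bval ?e2 ?s1 = game_bdd (\<lambda>i out _ out'. (target q i out \<and> careful_step i out out' \<or>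
      (\<exists>j<k. careful_step i out out' \<and> attractor q j i out' \<and> \<not> attractor q j i out)) \<or>
      (careful_step i out out' \<and> attractor q k i out') \<and> \<not> attractor q k i out)"
      using I by (simp add: game_bdd_bool)
    also have "\<dots> = ?R (Suc k)" by (rule game_bdd_cong) (auto simp: less_Suc_eq)
    finally have 2: "bval ?e2 ?s1 = ?R (Suc k)" .
    have "bval ?e3 ?s2 = game_bdd (\<lambda>i out _ _. attractor q k i out \<or> (\<exists>out' \<subseteq> Y. careful_step i out out' \<and> attractor q k i out'))"
      using I slice by (simp add: game_bdd_bool game_bdd_ex)
    also have "\<dots> = ?A (Suc k)"
      by (rule game_bdd_cong) (simp, metis attractor_sub)
    finally have 3: "bval ?e3 ?s2 = ?A (Suc k)" .
    show "runs (Seq (Put 10 (Num 13) ?e1) (Seq (Put 10 (Num 14) ?e2) (Put 10 (Num 12) ?e3))) s 17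
      (\<lambda>s'. ?I (Suc k) (set_num 8 4 (Suc (nums s' 8 4)) s'))"
    proof (rule runs_cost, rule runs_Seq, rule runs_Put_eq[OF 1 aval.simps(1)], rule runs_Seq,
        rule runs_Put_eq[OF 2 aval.simps(1)], rule runs_Put_eq[OF 3 aval.simps(1)])
      show "?I (Suc k) (set_num 8 4 (Suc (nums ?s3 8 4)) ?s3)"
        using I by simp
    qed simp_all
  next
    fix k s assume I: "?I k s"
    then have F: "?F s" by blast
    show "nums s 8 4 = k \<and> aval (var 0) s = num_states G" using I N frame_nums[OF F] by simp
  qed (use A R in simp_all)
qed

text \<open>The left side is what the loop of \<open>pick_prog\<close> accumulates; the right side
  is the graph of a selection once \<open>Q\<close> is an equation.\<close>

lemma Least_first:
  "(\<exists>j<n. P j \<and> (\<forall>j'<j. \<not> P j') \<and> Q j) \<longleftrightarrow> (\<exists>j<n. P j) \<and> Q (LEAST j. P j)" for n :: nat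
proof
  assume "\<exists>j<n. P j \<and> (\<forall>j'<j. \<not> P j') \<and> Q j"
  then obtain j where j: "j < n" "P j" "\<forall>j'<j. \<not> P j'" "Q j" by blast
  then have "(LEAST j. P j) = j" by (metis Least_equality linorder_not_less)
  then show "(\<exists>j<n. P j) \<and> Q (LEAST j. P j)" using j by blast
next
  assume "(\<exists>j<n. P j) \<and> Q (LEAST j. P j)"
  then obtain j where "j < n" "P j" "Q (LEAST j. P j)" by blast
  then show "\<exists>j<n. P j \<and> (\<forall>j'<j. \<not> P j') \<and> Q j"
    by (intro exI[of _ "LEAST j. P j"]) (auto intro: LeastI dest: not_less_Least order_le_less_trans[OF Least_le])
qed

text \<open>Selection in the order of the singletons, so that a loop over the output states computes
  it.\<close>

definition pick :: "(nat set \<Rightarrow> nat set \<Rightarrow> nat set \<Rightarrow> bool) \<Rightarrow> nat set \<Rightarrow> nat set \<Rightarrow> nat set" where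
  "pick r i out = out_enum (LEAST j. r i out (out_enum j))"

lemma pick_admissible: 
  assumes "r i out out'" "out' \<subseteq> Y" shows "r i out (pick r i out)"
proof -
  obtain j where "out' = out_enum j" using enum_images(2) assms(2) by (metis PowI imageE)
  then have "r i out (out_enum j)" using assms(1) by simp
  then show ?thesis unfolding pick_def by (rule LeastI)
qed

lemma pick_runs:
  assumes inp: "inp st" and num: "nums st 8 2 = 2 ^ length out_list"
    and S: "\<And>j. j < 2 ^ length out_list \<Longrightarrow> bdds st 12 j = rel_bdd Y (\<lambda>out _. out = out_enum j)"
    and R: "bdds st 10 14 = game_bdd (\<lambda>i out _ out'. r i out out')"
    and total: "\<And>i out. i \<subseteq> X \<Longrightarrow> out \<subseteq> Y \<Longrightarrow> \<exists>out' \<subseteq> Y. r i out out'"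
    and init: "bdds st 10 15 = {}" "bdds st 10 16 = {}"
  shows "runs pick_prog st (18 * 2 ^ length out_list) (\<lambda>s. frame {(8, 4)} {(10, 15), (10, 16)} st s \<and>
    bdds s 10 15 = game_bdd (\<lambda>i out _ out'. out' = pick r i out))"
proof -
  let ?F = "frame {(8, 4)} {(10, 15), (10, 16)} st" and ?n = "2 ^ length out_list :: nat"
  let ?M = "\<lambda>n. game_bdd (\<lambda>i out _ out'. \<exists>j<n. r i out (out_enum j) \<and> (\<forall>j'<j. \<not> r i out (out_enum j')) \<and> out' = out_enum j)"
  let ?D = "\<lambda>n. game_bdd (\<lambda>i out _ _. \<exists>j<n. r i out (out_enum j))"
  let ?I = "\<lambda>n s. ?F s \<and> nums s 8 4 = n \<and> bdds s 10 15 = ?M n \<and> bdds s 10 16 = ?D n"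
  show ?thesis
    unfolding pick_prog_def Let_def
  proof (rule runs_cost[OF runs_For[where n = ?n and I = ?I and C = "\<lambda>_. 18"]])
    fix j s assume j: "j < ?n" and I: "?I j s"
    then have F: "?F s" by blast
    have "inp s" using inp_frame[OF inp F] by simp
    note sl = inp_slice(4)[OF this]
    have keep: "bdds s 12 j = rel_bdd Y (\<lambda>out _. out = out_enum j)"
      "bdds s 10 14 = game_bdd (\<lambda>i out _ out'. r i out out')"
      using frame_bdds[OF F] S[OF j] R by simp_all
    have zj: "out_enum j \<subseteq> Y" using enum_images(2) j by blast
    let ?cand = "BAnd (cell10 14) (BRen out_vars (BCell 12 (var 4)))"
    let ?e1 = "BOr (cell10 15) (BAnd ?cand (BNot (cell10 16)))"
    let ?e2 = "BOr (cell10 16) (BEx (Primed out_vars) ?cand)"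
    let ?s1 = "set_bdd 10 15 (?M (Suc j)) s"
    let ?s2 = "set_bdd 10 16 (?D (Suc j)) ?s1"
    have slice: "slice_val out_vars ?s1 = Y"
      using sl slice_val_teq[of ?s1 s] by simp
    have "bval ?e1 s = game_bdd (\<lambda>i out _ out'.
        (\<exists>k<j. r i out (out_enum k) \<and> (\<forall>j'<k. \<not> r i out (out_enum j')) \<and> out' = out_enum k) \<or>
        (r i out out' \<and> out' = out_enum j) \<and> \<not> (\<exists>k<j. r i out (out_enum k)))"
      using I keep sl by (simp add: game_bdd_rel game_bdd_bool game_bdd_rename)
    also have "\<dots> = ?M (Suc j)" by (rule game_bdd_cong) (auto simp: less_Suc_eq)
    finally have 1: "bval ?e1 s = ?M (Suc j)" .
    have "bval ?e2 ?s1 = game_bdd (\<lambda>i out _ _. (\<exists>k<j. r i out (out_enum k)) \<or>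
        (\<exists>out' \<subseteq> Y. r i out out' \<and> out' = out_enum j))"
      using I keep slice by (simp add: game_bdd_rel game_bdd_bool game_bdd_rename game_bdd_ex)
    also have "\<dots> = ?D (Suc j)" using zj by (intro game_bdd_cong) (auto simp: less_Suc_eq)
    finally have 2: "bval ?e2 ?s1 = ?D (Suc j)" .
    show "runs (Seq (Put 10 (Num 15) ?e1) (Put 10 (Num 16) ?e2)) s 18
      (\<lambda>s'. ?I (Suc j) (set_num 8 4 (Suc (nums s' 8 4)) s'))"
    proof (rule runs_cost, rule runs_Seq, rule runs_Put_eq[OF 1 aval.simps(1)],
        rule runs_Put_eq[OF 2 aval.simps(1)])
      show "?I (Suc j) (set_num 8 4 (Suc (nums ?s2 8 4)) ?s2)"
        using I by simp
    qed simp_all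
  next
    fix k s assume I: "?I k s"
    then have F: "?F s" by blast
    show "nums s 8 4 = k \<and> aval (var 2) s = ?n" using I num frame_nums[OF F] by simp
  next
    fix s assume I: "?I ?n s"
    have "?M ?n = game_bdd (\<lambda>i out _ out'. out' = pick r i out)"
    proof (rule game_bdd_cong)
      fix i out out' :: "nat set" assume "i \<subseteq> X" "out \<subseteq> Y"
      then obtain u where u: "u \<subseteq> Y" "r i out u" using total[of i out] by blast
      then have "u \<in> out_enum ` {..<?n}" using enum_images(2) by simp
      with u(2) have "\<exists>j<?n. r i out (out_enum j)" by blast
      then show "(\<exists>j<?n. r i out (out_enum j) \<and> (\<forall>j'<j. \<not> r i out (out_enum j')) \<and> out' = out_enum j)
          \<longleftrightarrow> out' = pick r i out"
        unfolding Least_first pick_def by blast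
    qed
    then show "?F s \<and> bdds s 10 15 = game_bdd (\<lambda>i out _ out'. out' = pick r i out)" using I by simp
  qed (use init in \<open>simp_all add: game_bdd_const\<close>)
qed

text \<open>The data shared by all memory values, which one round of the memory loop reads and
  leaves alone.\<close>

definition synth_env :: "store \<Rightarrow> bool" where
  "synth_env s \<longleftrightarrow> inp s \<and> nums s 8 0 = num_states G \<and> nums s 8 2 = 2 ^ length out_list \<and>
     nums s 8 6 = length guarantees \<and>
     (\<forall>j<2 ^ length out_list. bdds s 12 j = rel_bdd Y (\<lambda>out _. out = out_enum j)) \<and>
     bdds s 10 4 = rel_bdd Y eO \<and> bdds s 10 8 = game_bdd (\<lambda>i out _ _. Win i out) \<and>
     bdds s 10 9 = game_bdd (\<lambda>i out _ _. settled i out) \<and> bdds s 10 10 = game_bdd (\<lambda>i out _ out'. careful_step i out out')"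

lemma synth_env_frame:
  assumes "synth_env s" and F: "frame A B s t" and "A \<subseteq> {(8, 3), (8, 4)} \<union> {5, 6, 7} \<times> UNIV"
    and "B \<subseteq> {10} \<times> {11, 12, 13, 14, 15, 16} \<union> {5, 6} \<times> UNIV"
  shows "synth_env t"
proof -
  have F': "frame ({(8, 3), (8, 4)} \<union> {5, 6, 7} \<times> UNIV) ({10} \<times> {11, 12, 13, 14, 15, 16} \<union> {5, 6} \<times> UNIV) s t"
    using assms by (blast intro: frame_mono)
  have "inp t" by (rule inp_frame[OF _ F']) (use assms(1) in \<open>auto simp: synth_env_def\<close>)
  then show ?thesis
    using assms(1) frame_nums[OF F'] frame_bdds[OF F'] by (simp add: synth_env_def)
qed

lemma target_exp_val:
  assumes env: "synth_env s" and q: "nums s 8 3 = q"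
  shows "bval target_exp s = game_bdd (\<lambda>i out _ _. target q i out)"
proof -
  have inp: "inp s" using env by (simp add: synth_env_def)
  have "bval target_exp s = game_bdd (\<lambda>i out _ _. settled i out \<and>
      (meets q out \<or> \<not> (\<exists>out' \<subseteq> Y. eO out out' \<and> meets q out')))"
    using env q inp_bdds(6)[OF inp] inp_slice(4)[OF inp]
    by (simp add: target_exp_def synth_env_def game_bdd_rel game_bdd_bool game_bdd_rename game_bdd_ex)
  then show ?thesis unfolding ex_eO target_def .
qed

lemma admissible_exp_val:
  assumes env: "synth_env s" and A: "bdds s 10 12 = game_bdd (\<lambda>i out _ _. attractor q (num_states G) i out)"
    and R: "bdds s 10 14 = game_bdd (\<lambda>i out _ out'. target q i out \<and> careful_step i out out' \<or>
      (\<exists>k<num_states G. careful_step i out out' \<and> attractor q k i out' \<and> \<not> attractor q k i out))"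
  shows "bval admissible_exp s = game_bdd (\<lambda>i out _ out'. admissible q i out out')"
proof -
  have inp: "inp s" using env by (simp add: synth_env_def)
  have "bval admissible_exp s = game_bdd (\<lambda>i out _ out'. (target q i out \<and> careful_step i out out' \<or>
      (\<exists>k<num_states G. careful_step i out out' \<and> attractor q k i out' \<and> \<not> attractor q k i out)) \<or>
      \<not> attractor q (num_states G) i out \<and> rO out out' \<and> (\<not> (\<exists>u \<subseteq> Y. rO out u \<and> Win i u) \<or> Win i out'))"
    using env A R inp_bdds(4)[OF inp] inp_slice(4)[OF inp]
    by (simp add: admissible_exp_def synth_env_def game_bdd_rel game_bdd_bool game_bdd_rename game_bdd_ex)
  also have "\<dots> = game_bdd (\<lambda>i out _ out'. admissible q i out out')"
  proof (rule game_bdd_cong)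
    fix i out i' out'
    have "(\<exists>u \<subseteq> Y. rO out u \<and> Win i u) \<longleftrightarrow> (\<exists>u. rO out u \<and> Win i u)" by (metis rO_sub)
    then show "(target q i out \<and> careful_step i out out' \<or>
      (\<exists>k<num_states G. careful_step i out out' \<and> attractor q k i out' \<and> \<not> attractor q k i out)) \<or>
      \<not> attractor q (num_states G) i out \<and> rO out out' \<and> (\<not> (\<exists>u \<subseteq> Y. rO out u \<and> Win i u) \<or> Win i out')
      \<longleftrightarrow> admissible q i out out'"
      unfolding admissible_def by blast
  qed
  finally show ?thesis .
qed

lemma memory_runs:
  assumes env: "synth_env st" and q: "nums st 8 3 = q"
  shows "runs memory_prog st (78 * num_states G) (\<lambda>s.
    frame {(8, 4), (6, q), (7, q)} ({10} \<times> {11, 12, 13, 14, 15, 16} \<union> {(5, q), (6, q)}) st s \<and>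
    bdds s 5 q = game_bdd (\<lambda>_ out i' out'. out' = pick (admissible q) i' out) \<and>
    bdds s 6 q = game_bdd (\<lambda>_ out i' _. target q i' out) \<and> nums s 6 q = q \<and> nums s 7 q = Suc q)"
proof -
  let ?A = "{(8, 4), (6, q), (7, q)}" and ?B = "{10} \<times> {11, 12, 13, 14, 15, 16} \<union> {(5, q), (6, q)}"
  let ?F = "frame ?A ?B st"
  have env': "synth_env s" if "?F s" for s using synth_env_frame[OF env that] by auto
  let ?T = "game_bdd (\<lambda>i out _ _. target q i out)"
  let ?s1 = "set_bdd 10 11 ?T st"
  let ?s2 = "set_bdd 10 12 ?T ?s1"
  let ?Init = "game_bdd (\<lambda>i out _ out'. target q i out \<and> careful_step i out out')"
  let ?s3 = "set_bdd 10 14 ?Init ?s2"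
  let ?R = "game_bdd (\<lambda>i out _ out'. admissible q i out out')"
  let ?M = "game_bdd (\<lambda>_ out i' out'. out' = pick (admissible q) i' out)" and ?T' = "game_bdd (\<lambda>_ out i' _. target q i' out)"
  note 1 = target_exp_val[OF env q]
  have 2: "bval (cell10 11) ?s1 = ?T" by simp
  have 3: "bval (BAnd (cell10 11) (cell10 10)) ?s2 = ?Init"
    using env by (simp add: synth_env_def game_bdd_bool)
  have F3: "?F ?s3" by simp
  note env3 = env'[OF F3]
  show ?thesis
    unfolding memory_prog_def
  proof (rule runs_cost, rule runs_Seq, rule runs_Put_eq[OF 1 aval.simps(1)], rule runs_Seq,
      rule runs_Put_eq[OF 2 aval.simps(1)], rule runs_Seq, rule runs_Put_eq[OF 3 aval.simps(1)])
    show "runs (Seq attractor_prog (Seq (Put 10 (Num 14) admissible_exp) (Seq (Put 10 (Num 15) (BConst False))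
       (Seq (Put 10 (Num 16) (BConst False)) (Seq pick_prog
       (Seq (Put 5 (var 3) (BRen in_vars (cell10 15))) (Seq (Put 6 (var 3) (BRen in_vars (cell10 11)))
       (Seq (Assign 6 (var 3) (var 3)) (Assign 7 (var 3) (Plus (var 3) (Num 1))))))))))) ?s3
       (17 * num_states G + (Suc (bcost admissible_exp) + (2 + (2 + (18 * 2 ^ length out_list + (3 + (3 + (0 + 0))))))))
       (\<lambda>s. ?F s \<and> bdds s 5 q = ?M \<and> bdds s 6 q = ?T' \<and> nums s 6 q = q \<and> nums s 7 q = Suc q)"
    proof (rule runs_SeqI[OF attractor_runs[of ?s3 q]])
      fix s4
      let ?F4 = "frame {(8, 4)} {(10, 12), (10, 13), (10, 14)} ?s3 s4"
      assume s4: "?F4 \<and>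
        bdds s4 10 12 = game_bdd (\<lambda>i out _ _. attractor q (num_states G) i out) \<and>
        bdds s4 10 14 = game_bdd (\<lambda>i out _ out'. target q i out \<and> careful_step i out out' \<or>
          (\<exists>k<num_states G. careful_step i out out' \<and> attractor q k i out' \<and> \<not> attractor q k i out))"
      then have f4: ?F4 by blast
      have "frame ?A ?B ?s3 s4" by (rule frame_mono[OF f4]) auto
      then have F4: "?F s4" using frame_trans[OF F3] by blast
      have 4: "bval admissible_exp s4 = ?R" using admissible_exp_val[OF env'[OF F4]] s4 by blast
      let ?s5 = "set_bdd 10 14 ?R s4"
      let ?s6 = "set_bdd 10 15 {} ?s5"
      let ?s7 = "set_bdd 10 16 {} ?s6"
      have false: "bval (BConst False) s = {}" for s by simp
      have F7: "?F ?s7" using F4 by simp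
      note env7 = env'[OF F7]
      have T7: "bdds ?s7 10 11 = ?T" using frame_bdds[OF f4] by simp
      show "runs (Seq (Put 10 (Num 14) admissible_exp) (Seq (Put 10 (Num 15) (BConst False))
         (Seq (Put 10 (Num 16) (BConst False)) (Seq pick_prog
         (Seq (Put 5 (var 3) (BRen in_vars (cell10 15))) (Seq (Put 6 (var 3) (BRen in_vars (cell10 11)))
         (Seq (Assign 6 (var 3) (var 3)) (Assign 7 (var 3) (Plus (var 3) (Num 1)))))))))) s4
         (Suc (bcost admissible_exp) + (2 + (2 + (18 * 2 ^ length out_list + (3 + (3 + (0 + 0)))))))
         (\<lambda>s. ?F s \<and> bdds s 5 q = ?M \<and> bdds s 6 q = ?T' \<and> nums s 6 q = q \<and> nums s 7 q = Suc q)"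
      proof (rule runs_cost, rule runs_Seq, rule runs_Put_eq[OF 4 aval.simps(1)], rule runs_Seq,
          rule runs_Put_eq[OF false aval.simps(1)], rule runs_Seq, rule runs_Put_eq[OF false aval.simps(1)])
        show "runs (Seq pick_prog
         (Seq (Put 5 (var 3) (BRen in_vars (cell10 15))) (Seq (Put 6 (var 3) (BRen in_vars (cell10 11)))
         (Seq (Assign 6 (var 3) (var 3)) (Assign 7 (var 3) (Plus (var 3) (Num 1))))))) ?s7
         (18 * 2 ^ length out_list + (3 + (3 + (0 + 0))))
         (\<lambda>s. ?F s \<and> bdds s 5 q = ?M \<and> bdds s 6 q = ?T' \<and> nums s 6 q = q \<and> nums s 7 q = Suc q)"
        proof (rule runs_SeqI[OF pick_runs[of ?s7 "admissible q"]])
          fix s8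
          assume s8: "frame {(8, 4)} {(10, 15), (10, 16)} ?s7 s8 \<and>
            bdds s8 10 15 = game_bdd (\<lambda>i out _ out'. out' = pick (admissible q) i out)"
          then have f8: "frame {(8, 4)} {(10, 15), (10, 16)} ?s7 s8" by blast
          have "frame ?A ?B ?s7 s8" by (rule frame_mono[OF f8]) auto
          then have F8: "?F s8" using frame_trans[OF F7] by blast
          have "inp s8" using env'[OF F8] by (simp add: synth_env_def)
          note sl = inp_slice(3)[OF this]
          have a8: "aval (var 3) s8 = q" using q frame_nums[OF F8] by simp
          let ?s9 = "set_bdd 5 q ?M s8"
          have 9: "bval (BRen in_vars (cell10 15)) s8 = ?M"
            using s8 sl by (simp add: game_bdd_rename)
          have "slice_val in_vars ?s9 = X" using sl slice_val_teq[of ?s9 s8] by simp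
          then have 10: "bval (BRen in_vars (cell10 11)) ?s9 = ?T'"
            using T7 frame_bdds[OF f8] by (simp add: game_bdd_rename)
          have a9: "aval (var 3) ?s9 = q" using a8 by simp
          show "runs (Seq (Put 5 (var 3) (BRen in_vars (cell10 15))) (Seq (Put 6 (var 3) (BRen in_vars (cell10 11)))
             (Seq (Assign 6 (var 3) (var 3)) (Assign 7 (var 3) (Plus (var 3) (Num 1)))))) s8 (3 + (3 + (0 + 0)))
             (\<lambda>s. ?F s \<and> bdds s 5 q = ?M \<and> bdds s 6 q = ?T' \<and> nums s 6 q = q \<and> nums s 7 q = Suc q)"
          proof (rule runs_cost, rule runs_Seq, rule runs_Put_eq[OF 9 a8], rule runs_Seq,
              rule runs_Put_eq[OF 10 a9], rule runs_Seq, rule runs_Assign, rule runs_Assign)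
          qed (use F8 a8 in simp_all)
        next
          fix i out assume "i \<subseteq> X" "out \<subseteq> Y"
          then obtain out' where r: "admissible q i out out'" using admissible_total[of out q i] by blast
          then show "\<exists>out' \<subseteq> Y. admissible q i out out'" using rO_sub[OF admissible_rO[OF r]] by blast
        qed (use env7 in \<open>simp_all add: synth_env_def\<close>)
      qed (simp_all add: admissible_exp_def)
    qed (use env3 in \<open>simp_all add: synth_env_def\<close>)
  next
    \<comment> \<open>43 sums up the expressions evaluated once; 17 and 18 are the costs of one
      round of the attractor and of the selection. Together they give 78.\<close>
    have "43 + (17 * num_states G + 18 * 2 ^ length out_list) \<le> 78 * num_states G"
      using power_le_num_states by linarith
    then show "Suc (bcost target_exp) + (Suc (bcost (cell10 11)) + (Suc (bcost (BAnd (cell10 11) (cell10 10))) +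
      (17 * num_states G + (Suc (bcost admissible_exp) + (2 + (2 + (18 * 2 ^ length out_list + (3 + (3 + (0 + 0)))))))))) \<le> 78 * num_states G"
      by (simp add: target_exp_def admissible_exp_def)
  qed (simp_all add: target_exp_def)
qed

lemma synth_runs:
  "runs synth_prog (input_store G \<phi>) (400 * (grk_length \<phi> * num_states G)) (synthesis_output G \<phi>)"
proof -
  let ?K = "Suc (length guarantees)"
  let ?e9 = "BAnd (BEx (Primed out_vars) (cell10 4)) (BAnd (cell10 5) (cell10 8))"
  let ?e10 = "BAnd (BCell 0 (Num 3)) (BImp (cell10 9) (cell10 4))"
  let ?S = "game_bdd (\<lambda>i out _ _. settled i out)" and ?P = "game_bdd (\<lambda>i out _ out'. careful_step i out out')"
  let ?M = "\<lambda>q. game_bdd (\<lambda>_ out i' out'. out' = pick (admissible q) i' out)" and ?T = "\<lambda>q. game_bdd (\<lambda>_ out i' _. target q i' out)"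
  let ?rest = "Seq (Assign 7 (var 6) (Num 0)) (Seq (Assign 5 (Num 1) (Plus (var 6) (Num 1)))
     (Seq (Assign 5 (Num 2) (Num 0)) (Assign 5 (Num 3) (Plus (var 6) (Num 1)))))"
  show ?thesis
    unfolding synth_prog_def
  proof (rule runs_cost[OF runs_SeqI[OF solve_runs]])
    fix s assume s: "solved s"
    then have inp: "inp s" by (simp add: solved_def)
    note sl = inp_slice(4)[OF inp]
    let ?s1 = "set_bdd 10 9 ?S s"
    let ?s2 = "set_bdd 10 10 ?P ?s1"
    have "bval ?e9 s = game_bdd (\<lambda>i out _ _. (\<exists>u \<subseteq> Y. eO out u) \<and> good i out \<and> Win i out)"
      using s sl by (simp add: solved_def game_bdd_rel game_bdd_bool game_bdd_ex)
    also have "\<dots> = ?S"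
    proof -
      have "(\<exists>u \<subseteq> Y. eO out u) \<longleftrightarrow> tO out out" for out
        using tO_sub[of out out] by (auto simp: eO_def intro: tranclp_trans)
      then show ?thesis by (simp add: settled_def)
    qed
    finally have 9: "bval ?e9 s = ?S" .
    have "bval ?e10 ?s1 = game_bdd (\<lambda>i out _ out'. rO out out' \<and> (\<not> settled i out \<or> eO out out'))"
      using s inp_bdds(4)[OF inp] by (simp add: solved_def game_bdd_rel game_bdd_bool)
    then have 10: "bval ?e10 ?s1 = ?P" by (simp only: careful_step_def imp_conv_disj)
    have "inp ?s2" using inp_frame[OF inp, of "{}" "{(10, 9), (10, 10)}" ?s2] by simp
    then have env2: "synth_env ?s2" using s by (simp add: synth_env_def solved_def)
    have ans2: "nums ?s2 5 0 = 1 \<longleftrightarrow> realizable G \<phi>" using s by (simp add: solved_def answer_def)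
    let ?F = "frame ({(8, 3), (8, 4)} \<union> {6, 7} \<times> UNIV) ({10} \<times> {11, 12, 13, 14, 15, 16} \<union> {5, 6} \<times> UNIV) ?s2"
    let ?I = "\<lambda>n s. ?F s \<and> nums s 8 3 = n \<and>
      (\<forall>q<n. bdds s 5 q = ?M q \<and> bdds s 6 q = ?T q \<and> nums s 6 q = q \<and> nums s 7 q = Suc q)"
    have env': "synth_env t" if "?F t" for t using synth_env_frame[OF env2 that] by auto
    show "runs (Seq (Put 10 (Num 9) ?e9) (Seq (Put 10 (Num 10) ?e10)
        (Seq (For 3 (Plus (var 6) (Num 1)) memory_prog) ?rest))) s
        (Suc (bcost ?e9) + (Suc (bcost ?e10) + ((\<Sum>q<?K. 78 * num_states G) + (0 + (0 + (0 + 0))))))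
        (synthesis_output G \<phi>)"
    proof (rule runs_Seq, rule runs_Put_eq[OF 9 aval.simps(1)], rule runs_Seq,
        rule runs_Put_eq[OF 10 aval.simps(1)], rule runs_Seq, rule runs_For[where n = ?K and I = ?I])
      fix q t assume q: "q < ?K" and I: "?I q t"
      then have F: "?F t" by blast
      show "runs memory_prog t (78 * num_states G) (\<lambda>t'. ?I (Suc q) (set_num 8 3 (Suc (nums t' 8 3)) t'))"
      proof (rule runs_weaken[OF memory_runs[OF env'[OF F], of q] order_refl])
        fix u
        let ?f = "frame {(8, 4), (6, q), (7, q)} ({10} \<times> {11, 12, 13, 14, 15, 16} \<union> {(5, q), (6, q)}) t u"
        assume u: "?f \<and> bdds u 5 q = ?M q \<and> bdds u 6 q = ?T q \<and> nums u 6 q = q \<and> nums u 7 q = Suc q"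
        then have f: ?f by blast
        have "?F u" by (rule frame_trans[OF F frame_mono[OF f]]) auto
        then show "?I (Suc q) (set_num 8 3 (Suc (nums u 8 3)) u)"
          using I u frame_nums[OF f] frame_bdds[OF f] by (auto simp: less_Suc_eq)
      qed (use I in blast)
    next
      fix n t assume I: "?I n t"
      then have "synth_env t" using env' by blast
      then show "nums t 8 3 = n \<and> aval (Plus (var 6) (Num 1)) t = ?K" using I by (simp add: synth_env_def)
    next
      fix t assume I: "?I ?K t"
      then have F: "?F t" by blast
      have six: "nums t 8 6 = length guarantees" using env'[OF F] by (simp add: synth_env_def)
      \<comment> \<open>The loop stored \<open>Suc q\<close> as the successor of \<open>q\<close>;
        overwriting the last one by 0 makes the edges count modulo \<open>?K\<close>.\<close>
      let ?t = "set_num 5 3 ?K (set_num 5 2 0 (set_num 5 1 ?K (set_num 7 (length guarantees) 0 t)))"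
      have "synthesis_output G \<phi> ?t"
        unfolding synthesis_output_def
      proof (intro conjI impI)
        show "answer ?t \<longleftrightarrow> realizable G \<phi>" using ans2 frame_nums[OF F] by (simp add: answer_def)
        assume "realizable G \<phi>"
        show "\<exists>f. winning_strategy G \<phi> f \<and> represents G (output_strategy ?t) f"
        proof (rule strategy_wins[where pick = "\<lambda>q. pick (admissible q)"])
          fix q i out assume "i \<subseteq> X" "out \<subseteq> Y"
          then obtain out' where r: "admissible q i out out'" using admissible_total[of out q i] by blast
          then have "out' \<subseteq> Y" using rO_sub[OF admissible_rO[OF r]] by blast
          then show "admissible q i out (pick (admissible q) i out)" by (rule pick_admissible[where r = "admissible q", OF r])
        next
          fix q assume "q < ?K"
          then show "move (output_strategy ?t) q = ?M q" using I by (simp add: output_strategy_def)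
        next
          show "edges (output_strategy ?t) = map (\<lambda>e. (e, ?T e, Suc e mod ?K)) [0..<?K]"
            using I by (auto simp: output_strategy_def simp del: upt_Suc)
        next
          show "\<forall>i \<subseteq> X. sat (Unp ` i) (init_in G) \<longrightarrow> (\<exists>out \<subseteq> Y. sat (Unp ` out) (init_out G) \<and> Win i out)"
            using \<open>realizable G \<phi>\<close> unfolding realizable_iff .
        qed (simp_all add: output_strategy_def)
      qed
      then show "runs ?rest t (0 + (0 + (0 + 0))) (synthesis_output G \<phi>)"
        by (intro runs_Seq runs_Assign) (simp add: six)
    qed simp_all
  next
    have "length guarantees = (\<Sum>l<length \<phi>. length (snd (\<phi> ! l)))"
      by (simp add: length_concat sum_list_sum_nth atLeast0LessThan)
    also have "\<dots> \<le> (\<Sum>l<length \<phi>. 1 + length (fst (\<phi> ! l)) + length (snd (\<phi> ! l)))"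
      by (intro sum_mono) simp
    finally have K: "?K \<le> 2 * grk_length \<phi>" using grk_length_ge[of \<phi>] by linarith
    have "1 \<le> grk_length \<phi>" using K by linarith
    define p where "p = grk_length \<phi> * num_states G"
    define r where "r = ?K * num_states G"
    have le: "num_states G \<le> p" "grk_length \<phi> \<le> p"
      using \<open>1 \<le> grk_length \<phi>\<close> power_le_num_states(3) by (simp_all add: p_def)
    have r: "r \<le> 2 * p"
      unfolding r_def p_def using mult_right_mono[OF K, of "num_states G"] by simp
    have sum: "(\<Sum>q<?K. 78 * num_states G) = 78 * r" by (simp add: r_def)
    have cost: "Suc (bcost ?e9) = 7" "Suc (bcost ?e10) = 6" by simp_all
    \<comment> \<open>In multiples of \<open>p\<close>: 202 for solving, as both summands are at
      most \<open>p\<close>; 156 for the memory values, since \<open>r\<close> is at most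
      \<open>2 * p\<close>; 13 for the two expressions. The sum stays below 400.\<close>
    show "101 * (grk_length \<phi> + num_states G) + (Suc (bcost ?e9) + (Suc (bcost ?e10) +
        ((\<Sum>q<?K. 78 * num_states G) + (0 + (0 + (0 + 0)))))) \<le> 400 * (grk_length \<phi> * num_states G)"
      unfolding cost sum p_def[symmetric] add_mult_distrib2 using le r power_le_num_states(3) by linarith
  qed
qed

end

theorem theorem4:
  shows "(\<exists>P c. \<forall>G \<phi>. separated_grk_game G \<phi> \<longrightarrow>
            (\<exists>t st. exec P (input_store G \<phi>) t st \<and> realizability_output G \<phi> st \<and>
                    t \<le> c * (grk_length \<phi> + num_states G))) \<and>
         (\<exists>P c. \<forall>G \<phi>. separated_grk_game G \<phi> \<longrightarrow>
            (\<exists>t st. exec P (input_store G \<phi>) t st \<and> synthesis_output G \<phi> st \<and>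
                    t \<le> c * (grk_length \<phi> * num_states G)))"
proof (rule conjI; (rule exI)+; intro allI impI)
  fix G \<phi> assume "separated_grk_game G \<phi>"
  then interpret separated_game G \<phi> by unfold_locales
  obtain t s st where "exec solve_prog (input_store G \<phi>) t s"
    "t \<le> 101 * (grk_length \<phi> + num_states G)" "teq st s" "solved st"
    using solve_runs teq_refl unfolding runs_def by blast
  then show "\<exists>t st. exec solve_prog (input_store G \<phi>) t st \<and> realizability_output G \<phi> st \<and>
      t \<le> 101 * (grk_length \<phi> + num_states G)"
    unfolding realizability_output_def solved_def answer_def teq_def by metis
next
  fix G \<phi> assume "separated_grk_game G \<phi>"
  then interpret separated_game G \<phi> by unfold_locales
  obtain t s st where s: "exec synth_prog (input_store G \<phi>) t s"
    "t \<le> 400 * (grk_length \<phi> * num_states G)" "teq st s" "synthesis_output G \<phi> st"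
    using synth_runs teq_refl unfolding runs_def by blast
  \<comment> \<open>The run ends in \<open>s\<close>, which differs from the analysed store only in
    scratch; no output array is scratch.\<close>
  then have "output_strategy s = output_strategy st" "answer s \<longleftrightarrow> answer st"
    by (simp_all add: teq_def output_strategy_def answer_def)
  then show "\<exists>t st. exec synth_prog (input_store G \<phi>) t st \<and> synthesis_output G \<phi> st \<and>
      t \<le> 400 * (grk_length \<phi> * num_states G)"
    using s unfolding synthesis_output_def by metis
qed

end
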